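(* Let $K$ be a field of characteristic zero, let $1\le k\le n$, let $q(z)\in K[z]=K[z_1,\dots,z_n]$, let $\Phi_i:=\partial_i-\partial_i(q(z))$ for $1\le i\le n$, and let $\mathcal{C}=\{\Phi_i\mid 1\le i\le k\}$. Let $\mathcal{M}$ be the $\mathcal{D}[z]$-module with underlying space $K[z]$ and action $\ast$ given in the context, regarded also as a $\mathcal{D}[z'']$-module, where $z''=(z_{k+1},\dots,z_n)$. Then: (a) $\operatorname{Im}\mathcal{C}$, as a subspace of $\mathcal{M}$, is a $\mathcal{D}[z'']$-submodule of the $\mathcal{D}[z'']$-module $\mathcal{M}$. (b) The quotient $\mathcal{M}/\operatorname{Im}\mathcal{C}$ is a holonomic $\mathcal{D}[z'']$-module.
   Context: $\partial_i:=\partial/\partial z_i$, and $\operatorname{Im}\mathcal{C}:=\sum_{i=1}^k\Phi_i(K[z])$. $\mathcal{D}[z]$ is the Weyl algebra of $K[z]$, i.e. the subalgebra of $\operatorname{End}_K(K[z])$ generated by the derivations $\partial_i$ and the multiplication operators by $z_i$ ($1\le i\le n$). $\mathcal{M}$ is the vector space $K[z]$ with the $\mathcal{D}[z]$-module structure determined by $z_i\ast f:=z_if$ and $\partial_i\ast f:=\Phi_i f=\partial_i f-f\,\partial_i q$ for $1\le i\le n$, $f\in K[z]$ (well defined since the $\Phi_i$ commute). $\mathcal{D}[z'']$ is the Weyl algebra of $K[z'']=K[z_{k+1},\dots,z_n]$, viewed as the subalgebra of $\mathcal{D}[z]$ generated by $z_j,\partial_j$ for $k+1\le j\le n$. When $k=n$,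 $\mathcal{D}[z'']=K$, and a holonomic $K$-module is a finite-dimensional $K$-vector space. *)

theory Defs
  imports
    "HOL-Library.Poly_Mapping"
    "HOL-Library.FuncSet"
    "HOL-Computational_Algebra.Polynomial"
    "HOL-Algebra.Generated_Rings"
    "HOL-Algebra.AbelCoset"
    "HOL-Algebra.Module"
    "Jordan_Normal_Form.Missing_VectorSpace"
begin

hide_const (open) Polynomial.smult Modules.module


section \<open>Polynomials in the variables \<open>z\<^sub>1, \<dots>, z\<^sub>n\<close>\<close>

text \<open>Monomials are exponent functions of finite support and polynomials are coefficient functions
  of finite support. The type has countably many variables \<open>z\<^sub>0, z\<^sub>1, \<dots>\<close>; \<open>polys n\<close> is
  \<open>K[z\<^sub>1, \<dots>, z\<^sub>n]\<close>.\<close>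

type_synonym 'a mpoly = "(nat \<Rightarrow>\<^sub>0 nat) \<Rightarrow>\<^sub>0 'a"

definition polys :: "nat \<Rightarrow> 'a::field_char_0 mpoly set" where
  "polys n = {p. \<forall>m\<in>Poly_Mapping.keys p. Poly_Mapping.keys m \<subseteq> {1..n}}"

definition const :: "'a::field_char_0 \<Rightarrow> 'a mpoly" where
  "const c = Poly_Mapping.single 0 c"

definition var :: "nat \<Rightarrow> 'a::field_char_0 mpoly" where
  "var i = Poly_Mapping.single (Poly_Mapping.single i 1) 1"

definition pd :: "nat \<Rightarrow> 'a::field_char_0 mpoly \<Rightarrow> 'a mpoly" where
  "pd i p = (\<Sum>m\<in>Poly_Mapping.keys p.
     Poly_Mapping.single (m - Poly_Mapping.single i 1)
       (of_nat (Poly_Mapping.lookup m i) * Poly_Mapping.lookup p m))"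

definition Phi :: "'a::field_char_0 mpoly \<Rightarrow> nat \<Rightarrow> 'a mpoly \<Rightarrow> 'a mpoly" where
  "Phi q i f = pd i f - f * pd i q"


section \<open>Weyl algebras\<close>

text \<open>Operators on \<open>K[z]\<close> are represented as functions that are \<open>undefined\<close> outside \<open>polys n\<close>, so
  that equality of operators is equality of functions.\<close>

definition End_K :: "nat \<Rightarrow> ('a::field_char_0 mpoly \<Rightarrow> 'a mpoly) ring" where
  "End_K n =
    \<lparr>carrier = {F \<in> polys n \<rightarrow>\<^sub>E polys n.
        (\<forall>f\<in>polys n. \<forall>g\<in>polys n. F (f + g) = F f + F g) \<and>
        (\<forall>c. \<forall>f\<in>polys n. F (const c * f) = const c * F f)},
     mult = compose (polys n),
     one = (\<lambda>f\<in>polys n. f),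
     zero = (\<lambda>f\<in>polys n. 0),
     add = (\<lambda>F G. \<lambda>f\<in>polys n. F f + G f)\<rparr>"

definition mul_op :: "nat \<Rightarrow> 'a::field_char_0 mpoly \<Rightarrow> 'a mpoly \<Rightarrow> 'a mpoly" where
  "mul_op n p = (\<lambda>f\<in>polys n. p * f)"

definition pd_op :: "nat \<Rightarrow> nat \<Rightarrow> 'a::field_char_0 mpoly \<Rightarrow> 'a mpoly" where
  "pd_op n i = (\<lambda>f\<in>polys n. pd i f)"

definition scalar_ops :: "nat \<Rightarrow> ('a::field_char_0 mpoly \<Rightarrow> 'a mpoly) set" where
  "scalar_ops n = {mul_op n (const c) |c. True}"

definition weyl_gens :: "nat \<Rightarrow> nat set \<Rightarrow> ('a::field_char_0 mpoly \<Rightarrow> 'a mpoly) set" where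
  "weyl_gens n I = (\<lambda>i. mul_op n (var i)) ` I \<union> pd_op n ` I"

text \<open>The subring generated by the scalars together with \<open>z\<^sub>i, \<partial>\<^sub>i\<close> (\<open>i \<in> I\<close>) is the \<open>K\<close>-subalgebra
  generated by \<open>z\<^sub>i, \<partial>\<^sub>i\<close> (\<open>i \<in> I\<close>). Thus \<open>\<D>[z]\<close> is \<open>weyl n {1..n}\<close> and its subalgebra
  \<open>\<D>[z'']\<close> is \<open>weyl n {k+1..n}\<close>.\<close>

definition weyl :: "nat \<Rightarrow> nat set \<Rightarrow> ('a::field_char_0 mpoly \<Rightarrow> 'a mpoly) ring" where
  "weyl n I = (End_K n)\<lparr>carrier := generate_ring (End_K n) (scalar_ops n \<union> weyl_gens n I)\<rparr>"

text \<open>The copy of \<open>K\<close> inside the Weyl algebras.\<close>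

definition scalar_field :: "nat \<Rightarrow> ('a::field_char_0 mpoly \<Rightarrow> 'a mpoly) ring" where
  "scalar_field n = (End_K n)\<lparr>carrier := scalar_ops n\<rparr>"


section \<open>Left modules over a ring that need not be commutative\<close>

text \<open>These are the axioms of the locale for modules in HOL-Algebra, except that the ring of scalars
  is not assumed to be commutative. The fields \<open>mult\<close> and \<open>one\<close> of a module record play no role.\<close>

locale left_module = R?: ring R + M?: abelian_group M
  for R :: "('r, 'u) ring_scheme" and M :: "('r, 'm, 'v) module_scheme" +
  assumes lsmult_closed:
      "\<lbrakk>a \<in> carrier R; x \<in> carrier M\<rbrakk> \<Longrightarrow> a \<odot>\<^bsub>M\<^esub> x \<in> carrier M"
    and lsmult_l_distr:
      "\<lbrakk>a \<in> carrier R; b \<in> carrier R; x \<in> carrier M\<rbrakk> \<Longrightarrow>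
        (a \<oplus>\<^bsub>R\<^esub> b) \<odot>\<^bsub>M\<^esub> x = a \<odot>\<^bsub>M\<^esub> x \<oplus>\<^bsub>M\<^esub> b \<odot>\<^bsub>M\<^esub> x"
    and lsmult_r_distr:
      "\<lbrakk>a \<in> carrier R; x \<in> carrier M; y \<in> carrier M\<rbrakk> \<Longrightarrow>
        a \<odot>\<^bsub>M\<^esub> (x \<oplus>\<^bsub>M\<^esub> y) = a \<odot>\<^bsub>M\<^esub> x \<oplus>\<^bsub>M\<^esub> a \<odot>\<^bsub>M\<^esub> y"
    and lsmult_assoc:
      "\<lbrakk>a \<in> carrier R; b \<in> carrier R; x \<in> carrier M\<rbrakk> \<Longrightarrow>
        (a \<otimes>\<^bsub>R\<^esub> b) \<odot>\<^bsub>M\<^esub> x = a \<odot>\<^bsub>M\<^esub> (b \<odot>\<^bsub>M\<^esub> x)"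
    and lsmult_one:
      "x \<in> carrier M \<Longrightarrow> \<one>\<^bsub>R\<^esub> \<odot>\<^bsub>M\<^esub> x = x"

text \<open>\<^const>\<open>Module.submodule\<close> itself does not refer to commutativity of the ring.\<close>

definition left_submodule ::
    "'m set \<Rightarrow> ('r, 'u) ring_scheme \<Rightarrow> ('r, 'm, 'v) module_scheme \<Rightarrow> bool" where
  "left_submodule N R M \<longleftrightarrow> left_module R M \<and> Module.submodule N R M"

definition quot_module :: "('r, 'm) module \<Rightarrow> 'm set \<Rightarrow> ('r, 'm set) module" where
  "quot_module M N =
    \<lparr>carrier = a_rcosets\<^bsub>M\<^esub> N,
     mult = undefined,
     one = undefined,
     zero = N,
     add = set_add M,
     smult = (\<lambda>r X. \<Union>x\<in>X. N +>\<^bsub>M\<^esub> (r \<odot>\<^bsub>M\<^esub> x))\<rparr>"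

text \<open>All \<open>\<Sum>\<^sub>g b\<^sub>g g\<close> with coefficients \<open>b\<^sub>g\<close> in a set \<open>B\<close> of ring elements.\<close>

definition combinations :: "('r, 'm, 'v) module_scheme \<Rightarrow> 'r set \<Rightarrow> 'm set \<Rightarrow> 'm set" where
  "combinations N B G = {(\<Oplus>\<^bsub>N\<^esub> g\<in>G. b g \<odot>\<^bsub>N\<^esub> g) |b. b \<in> G \<rightarrow> B}"

definition finite_generating_set ::
    "('r, 'u) ring_scheme \<Rightarrow> ('r, 'm, 'v) module_scheme \<Rightarrow> 'm set \<Rightarrow> bool" where
  "finite_generating_set R N G \<longleftrightarrow>
     finite G \<and> G \<subseteq> carrier N \<and> combinations N (carrier R) G = carrier N"


section \<open>Holonomic modules\<close>

text \<open>The Bernstein filtration: \<open>bernstein n I j\<close> is the \<open>K\<close>-span of all products of at most \<open>j\<close> of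
  the generators \<open>z\<^sub>i, \<partial>\<^sub>i\<close> (\<open>i \<in> I\<close>), equivalently of all \<open>z\<^sup>\<alpha>\<partial>\<^sup>\<beta>\<close> with \<open>|\<alpha>| + |\<beta>| \<le> j\<close>. Since scalars
  occur at every level \<open>j\<close>, products of fewer than \<open>j\<close> generators are included.\<close>

inductive in_bernstein :: "nat \<Rightarrow> nat set \<Rightarrow> nat \<Rightarrow> ('a::field_char_0 mpoly \<Rightarrow> 'a mpoly) \<Rightarrow> bool"
  for n I where
  scalar: "c \<in> scalar_ops n \<Longrightarrow> in_bernstein n I j c"
| step: "g \<in> weyl_gens n I \<Longrightarrow> in_bernstein n I j F \<Longrightarrow>
    in_bernstein n I (Suc j) (g \<otimes>\<^bsub>End_K n\<^esub> F)"
| add: "in_bernstein n I j F \<Longrightarrow> in_bernstein n I j G \<Longrightarrow> in_bernstein n I j (F \<oplus>\<^bsub>End_K n\<^esub> G)"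

definition bernstein :: "nat \<Rightarrow> nat set \<Rightarrow> nat \<Rightarrow> ('a::field_char_0 mpoly \<Rightarrow> 'a mpoly) set" where
  "bernstein n I j = {F. in_bernstein n I j F}"

definition dim_K :: "nat \<Rightarrow> ('a::field_char_0 mpoly \<Rightarrow> 'a mpoly, 'm) module \<Rightarrow> 'm set \<Rightarrow> nat" where
  "dim_K n N W = vectorspace.dim (scalar_field n) (N\<lparr>carrier := W\<rparr>)"

text \<open>The dimension \<open>d(N)\<close> of a finitely generated left module \<open>N\<close> over the Weyl algebra: for a finite
  generating set \<open>G\<close>, \<open>\<Gamma>\<^sub>j = B\<^sub>j G\<close> is a good filtration of \<open>N\<close>, and \<open>d(N)\<close> is the degree of the
  polynomial \<open>\<chi>\<close> with \<open>dim\<^sub>K \<Gamma>\<^sub>j = \<chi>(j)\<close> for all large \<open>j\<close>. It does not depend on \<open>G\<close>, so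
  existential quantification over \<open>G\<close> is harmless.\<close>

definition has_bernstein_dim ::
    "nat \<Rightarrow> nat set \<Rightarrow> ('a::field_char_0 mpoly \<Rightarrow> 'a mpoly, 'm) module \<Rightarrow> nat \<Rightarrow> bool" where
  "has_bernstein_dim n I N d \<longleftrightarrow>
     (\<exists>G (\<chi> :: rat poly). finite_generating_set (weyl n I) N G \<and>
        (\<forall>\<^sub>F j in sequentially.
           of_nat (dim_K n N (combinations N (bernstein n I j) G)) = poly \<chi> (of_nat j)) \<and>
        Polynomial.degree \<chi> = d)"

text \<open>A finitely generated module over the Weyl algebra in \<open>m\<close> variables is holonomic if it is zero or
  has dimension \<open>m\<close>. For \<open>m = 0\<close>, where \<open>B\<^sub>j = K\<close>, this says that it is a finite-dimensional
  vector space.\<close>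

definition holonomic ::
    "nat \<Rightarrow> nat set \<Rightarrow> ('a::field_char_0 mpoly \<Rightarrow> 'a mpoly, 'm) module \<Rightarrow> bool" where
  "holonomic n I N \<longleftrightarrow>
     left_module (weyl n I) N \<and>
     (\<exists>G. finite_generating_set (weyl n I) N G) \<and>
     (carrier N = {\<zero>\<^bsub>N\<^esub>} \<or> has_bernstein_dim n I N (card I))"


section \<open>The module \<open>\<M>\<close> and the subspace \<open>Im \<C>\<close>\<close>

text \<open>The algebra homomorphism \<open>\<D>[z] \<rightarrow> End\<^sub>K(K[z])\<close> with \<open>z\<^sub>i \<mapsto> z\<^sub>i\<close> and \<open>\<partial>\<^sub>i \<mapsto> \<Phi>\<^sub>i\<close>. It exists because
  the \<open>\<Phi>\<^sub>i\<close> commute and \<open>[\<Phi>\<^sub>i, z\<^sub>j] = \<delta>\<^sub>i\<^sub>j\<close>; extensionality fixes its values outside \<open>\<D>[z]\<close>.\<close>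

definition twist ::
    "nat \<Rightarrow> 'a::field_char_0 mpoly \<Rightarrow> ('a mpoly \<Rightarrow> 'a mpoly) \<Rightarrow> ('a mpoly \<Rightarrow> 'a mpoly)" where
  "twist n q = (THE \<tau>.
     \<tau> \<in> ring_hom (weyl n {1..n}) (End_K n) \<and>
     \<tau> \<in> extensional (carrier (weyl n {1..n})) \<and>
     (\<forall>c. \<tau> (mul_op n (const c)) = mul_op n (const c)) \<and>
     (\<forall>i\<in>{1..n}. \<tau> (mul_op n (var i)) = mul_op n (var i)) \<and>
     (\<forall>i\<in>{1..n}. \<tau> (pd_op n i) = (\<lambda>f\<in>polys n. Phi q i f)))"

definition twisted_module ::
    "nat \<Rightarrow> 'a::field_char_0 mpoly \<Rightarrow> ('a mpoly \<Rightarrow> 'a mpoly, 'a mpoly) module" where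
  "twisted_module n q =
    \<lparr>carrier = polys n, mult = (*), one = 1, zero = 0, add = (+), smult = twist n q\<rparr>"

definition Im_C :: "nat \<Rightarrow> nat \<Rightarrow> 'a::field_char_0 mpoly \<Rightarrow> 'a mpoly set" where
  "Im_C n k q = {(\<Sum>i\<in>{1..k}. Phi q i (f i)) |f. f \<in> {1..k} \<rightarrow> polys n}"

end

theory Submission
  imports Defs
begin

text \<open>The modules are compared with their dimensions along filtrations. Let \<open>V\<close> be a \<open>K\<close>-space on which
  operators \<open>X\<^sub>i\<close> and \<open>D\<^sub>i\<close> act with the relations of the Weyl algebra, and let \<open>F\<^sub>0 \<subseteq> F\<^sub>1 \<subseteq> \<dots>\<close> be an exhaustive
  filtration with \<open>X\<^sub>i F\<^sub>j, D\<^sub>i F\<^sub>j \<subseteq> F\<^bsub>j+1\<^esub>\<close>. For a subspace \<open>U\<close> write \<open>r\<^sub>j(U)\<close> for the dimension of the image of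
  \<open>F\<^sub>j\<close> in \<open>V/U\<close>. On \<open>K[z]\<close> with \<open>X\<^sub>i = z\<^sub>i\<close> and \<open>D\<^sub>i = \<Phi>\<^sub>i\<close>, the filtration by degree, scaled by the degree
  of \<open>q\<close>, has \<open>r\<^sub>j(0) = O(j\<^sup>n)\<close>. Quotients of \<open>V\<close> are treated as independence modulo a subspace, so no
  quotient spaces occur until the very end.

  Each passage from \<open>U\<close> to \<open>U + D\<^sub>i V\<close> lowers the growth by one (\<open>growth_image\<close>). Modulo a subspace that
  \<open>X\<^sub>i\<close> preserves, everything killed by a power of \<open>D\<^sub>i\<close> lies in the image of \<open>D\<^sub>i\<close>. Hence if elements \<open>f\<^sub>a\<close> of
  \<open>F\<^sub>j\<close> are independent modulo \<open>U + D\<^sub>i V\<close>, the elements \<open>D\<^sub>i\<^sup>t f\<^sub>a\<close> with \<open>t \<le> j\<close> are independent modulo \<open>U\<close>; they lie in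
  \<open>F\<^bsub>2j\<^esub>\<close>, and so \<open>(j + 1) r\<^sub>j(U + D\<^sub>i V) \<le> r\<^bsub>2j\<^esub>(U)\<close>. Starting from \<open>U = 0\<close>, this gives \<open>r\<^sub>j(Im \<C>) = O(j\<^bsup>n-k\<^esup>)\<close>.
  The operators \<open>z\<^sub>i, \<Phi>\<^sub>i\<close> with \<open>i > k\<close> commute with \<open>\<Phi>\<^sub>1, \<dots>, \<Phi>\<^sub>k\<close>, which makes \<open>Im \<C>\<close> a submodule.

  It remains to see that a module \<open>V/U\<close> over the Weyl algebra in \<open>m\<close> variables with \<open>r\<^sub>j(U) = O(j\<^sup>m)\<close> is
  holonomic. Bernstein's inequality is used in the form that any element \<open>u\<close> outside a submodule \<open>W\<close>
  generates a space of dimension at least \<open>(t + 1)\<^sup>m\<close> modulo \<open>W\<close> by operators of degree at most \<open>4mt\<close>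
  (\<open>bernstein_lower_bound\<close>). In a chain of \<open>r\<close> submodules each step contributes that much, so \<open>r\<close> is
  bounded and \<open>V/U\<close> is finitely generated (\<open>finitely_generated_if_growth\<close>). For a finite set of
  generators, the dimension of \<open>B\<^sub>j G\<close> is the number of standard monomials of degree at most \<open>j\<close>, those
  which are not congruent to a combination of smaller ones in a graded order. Their exponents are closed
  under divisors, and by Dickson's lemma the counting function of such a set is eventually a polynomial
  (\<open>hilbert_polynomial\<close>). The growth bounds it by \<open>O(j\<^sup>m)\<close> from above, the lower bound by a multiple of \<open>j\<^sup>m\<close>
  from below, so its degree is \<open>m\<close> unless the quotient is zero.

  Operators are handled through their normally ordered symbols, which are polynomials in twice as many
  variables. The symbols also yield the homomorphism \<open>\<partial>\<^sub>i \<mapsto> \<Phi>\<^sub>i\<close>: a differential operator determines its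
  symbol, and the symbol of a product depends on the symbols of the factors only.\<close>

section \<open>Linear independence modulo a subspace\<close>

text \<open>A homogeneous linear system with fewer equations than unknowns has a nonzero solution.\<close>

lemma homogeneous_system:
  fixes M :: "'t \<Rightarrow> 'i \<Rightarrow> 'a::field"
  assumes "finite R" "finite A" "card R < card A"
  shows "\<exists>c. (\<exists>a\<in>A. c a \<noteq> 0) \<and> (\<forall>t\<in>R. (\<Sum>a\<in>A. c a * M t a) = 0)"
  using assms
proof (induction R arbitrary: A M rule: finite_induct)
  case empty
  then have "A \<noteq> {}" by auto
  then show ?case by (intro exI[of _ "\<lambda>_. 1"]) auto
next
  case (insert t R)
  show ?case
  proof (cases "\<forall>a\<in>A. M t a = 0")
    case True
    have "card R < card A" using insert by simp
    from insert.IH[OF insert.prems(1) this, of M] obtain c where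
      c: "\<exists>a\<in>A. c a \<noteq> 0" "\<forall>s\<in>R. (\<Sum>a\<in>A. c a * M s a) = 0" by blast
    have "(\<Sum>a\<in>A. c a * M t a) = 0" using True by simp
    with c show ?thesis by blast
  next
    case False
    then obtain p where p: "p \<in> A" "M t p \<noteq> 0" by blast
    let ?A = "A - {p}"
    have "card R < card ?A" using insert p by simp
    from insert.IH[OF _ this, of "\<lambda>s a. M s a - M s p * M t a / M t p"] insert.prems
    obtain c where c: "\<exists>a\<in>?A. c a \<noteq> 0"
      "\<forall>s\<in>R. (\<Sum>a\<in>?A. c a * (M s a - M s p * M t a / M t p)) = 0" by auto
    define d where "d = c(p := - (\<Sum>a\<in>?A. c a * M t a) / M t p)"
    have split: "(\<Sum>a\<in>A. d a * M s a) = d p * M s p + (\<Sum>a\<in>?A. c a * M s a)" for s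
    proof -
      have "(\<Sum>a\<in>A. d a * M s a) = d p * M s p + (\<Sum>a\<in>?A. d a * M s a)"
        using p insert.prems by (simp add: sum.remove)
      also have "(\<Sum>a\<in>?A. d a * M s a) = (\<Sum>a\<in>?A. c a * M s a)"
        by (rule sum.cong) (auto simp: d_def)
      finally show ?thesis .
    qed
    have t0: "(\<Sum>a\<in>A. d a * M t a) = 0"
      using p by (simp add: split) (simp add: d_def)
    have "(\<Sum>a\<in>A. d a * M s a) = 0" if "s \<in> R" for s
    proof -
      have "0 = (\<Sum>a\<in>?A. c a * M s a - M s p / M t p * (c a * M t a))"
        using c(2) that by (simp add: algebra_simps)
      also have "\<dots> = (\<Sum>a\<in>?A. c a * M s a) - M s p / M t p * (\<Sum>a\<in>?A. c a * M t a)"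
        by (simp add: sum_subtractf sum_distrib_left)
      also have "\<dots> = (\<Sum>a\<in>A. d a * M s a)"
        unfolding split by (simp add: d_def)
      finally show ?thesis by simp
    qed
    moreover have "\<exists>a\<in>A. d a \<noteq> 0" using c(1) by (auto simp: d_def)
    ultimately show ?thesis using t0 by blast
  qed
qed

text \<open>An extension of the vector space locale by nothing but a name, so that the constants defined here
  stay apart from those of the instances of that locale.\<close>

locale K_space = vector_space scale
  for scale :: "'a::field \<Rightarrow> 'b::ab_group_add \<Rightarrow> 'b" (infixr \<open>*s\<close> 75)
begin

text \<open>The family \<open>f\<close>, indexed by a finite set \<open>A\<close>, is linearly independent modulo \<open>U\<close>.\<close>

definition indep_mod :: "'b set \<Rightarrow> 'i set \<Rightarrow> ('i \<Rightarrow> 'b) \<Rightarrow> bool" where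
  "indep_mod U A f \<longleftrightarrow> finite A \<and> (\<forall>c. (\<Sum>a\<in>A. c a *s f a) \<in> U \<longrightarrow> (\<forall>a\<in>A. c a = 0))"

lemma indep_mod_finite: "indep_mod U A f \<Longrightarrow> finite A"
  by (simp add: indep_mod_def)

lemma indep_modD: "indep_mod U A f \<Longrightarrow> (\<Sum>a\<in>A. c a *s f a) \<in> U \<Longrightarrow> a \<in> A \<Longrightarrow> c a = 0"
  by (auto simp: indep_mod_def)

text \<open>A family that is independent modulo \<open>U\<close> is at most as large as any family spanning it modulo \<open>U\<close>.\<close>

lemma indep_mod_card_le:
  assumes U: "subspace U" and f: "indep_mod U A f" and B: "finite B"
    and span: "\<And>a. a \<in> A \<Longrightarrow> f a - (\<Sum>b\<in>B. l a b *s g b) \<in> U"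
  shows "card A \<le> card B"
proof (rule ccontr)
  assume "\<not> card A \<le> card B"
  with homogeneous_system[OF B indep_mod_finite[OF f], of "\<lambda>b a. l a b"]
  obtain c where c: "\<exists>a\<in>A. c a \<noteq> 0" "\<forall>b\<in>B. (\<Sum>a\<in>A. c a * l a b) = 0" by auto
  have "(\<Sum>a\<in>A. c a *s (\<Sum>b\<in>B. l a b *s g b)) = (\<Sum>a\<in>A. \<Sum>b\<in>B. (c a * l a b) *s g b)"
    by (simp add: scale_sum_right)
  also have "\<dots> = (\<Sum>b\<in>B. (\<Sum>a\<in>A. c a * l a b) *s g b)"
    by (subst sum.swap) (simp add: scale_sum_left)
  also have "\<dots> = 0" using c(2) by simp
  finally have eq: "(\<Sum>a\<in>A. c a *s (\<Sum>b\<in>B. l a b *s g b)) = 0" .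
  have "(\<Sum>a\<in>A. c a *s (f a - (\<Sum>b\<in>B. l a b *s g b))) \<in> U"
    by (intro subspace_sum[OF U] subspace_scale[OF U] span)
  then have "(\<Sum>a\<in>A. c a *s f a) \<in> U"
    by (simp add: scale_right_diff_distrib sum_subtractf eq)
  with f c(1) show False by (auto simp: indep_mod_def)
qed

lemma indep_mod_reindex:
  assumes "indep_mod U A f" "bij_betw \<pi> B A"
  shows "indep_mod U B (f \<circ> \<pi>)"
  unfolding indep_mod_def
proof (intro conjI allI impI ballI)
  show "finite B" using assms bij_betw_finite indep_mod_finite by blast
  fix c b assume c: "(\<Sum>b\<in>B. c b *s (f \<circ> \<pi>) b) \<in> U" and b: "b \<in> B"
  let ?r = "the_inv_into B \<pi>"
  have inj: "inj_on \<pi> B" using assms(2) by (simp add: bij_betw_def)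
  have "(\<Sum>a\<in>A. c (?r a) *s f a) = (\<Sum>b\<in>B. c (?r (\<pi> b)) *s f (\<pi> b))"
    by (rule sum.reindex_bij_betw[OF assms(2), symmetric])
  also have "\<dots> = (\<Sum>b\<in>B. c b *s (f \<circ> \<pi>) b)"
    by (rule sum.cong) (auto simp: the_inv_into_f_f[OF inj])
  finally have "(\<Sum>a\<in>A. c (?r a) *s f a) \<in> U" using c by simp
  moreover have "\<pi> b \<in> A" using assms(2) b by (auto simp: bij_betw_def)
  ultimately have "c (?r (\<pi> b)) = 0"
    using indep_modD[OF assms(1), of "\<lambda>a. c (?r a)"] by blast
  then show "c b = 0" using the_inv_into_f_f[OF inj b] by simp
qed

lemma indep_mod_cong:
  "A = B \<Longrightarrow> (\<And>a. a \<in> B \<Longrightarrow> f a = g a) \<Longrightarrow> indep_mod U A f \<longleftrightarrow> indep_mod U B g"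
  by (simp add: indep_mod_def)

lemma indep_mod_Un:
  assumes U: "subspace U" and W: "subspace W" "U \<subseteq> W"
    and A: "indep_mod U A f" "f ` A \<subseteq> W" and B: "indep_mod W B f" and AB: "A \<inter> B = {}"
  shows "indep_mod U (A \<union> B) f"
  unfolding indep_mod_def
proof (intro conjI allI impI)
  have fin: "finite A" "finite B" using A B indep_mod_finite by auto
  then show "finite (A \<union> B)" by simp
  fix c assume c: "(\<Sum>a\<in>A \<union> B. c a *s f a) \<in> U"
  have eq: "(\<Sum>a\<in>A \<union> B. c a *s f a) = (\<Sum>a\<in>A. c a *s f a) + (\<Sum>a\<in>B. c a *s f a)"
    by (rule sum.union_disjoint[OF fin AB])
  have "(\<Sum>a\<in>A. c a *s f a) \<in> W"
    using A(2) by (intro subspace_sum[OF W(1)] subspace_scale[OF W(1)]) auto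
  moreover have "(\<Sum>a\<in>A. c a *s f a) + (\<Sum>a\<in>B. c a *s f a) \<in> W"
    using c W(2) eq by auto
  ultimately have "(\<Sum>a\<in>B. c a *s f a) \<in> W"
    using subspace_diff[OF W(1)] by fastforce
  then have B0: "\<forall>a\<in>B. c a = 0" using B by (auto simp: indep_mod_def)
  then have "(\<Sum>a\<in>A. c a *s f a) \<in> U" using c eq by simp
  then have "\<forall>a\<in>A. c a = 0" using A by (auto simp: indep_mod_def)
  with B0 show "\<forall>a\<in>A \<union> B. c a = 0" by blast
qed

lemma indep_mod_insert:
  assumes U: "subspace U" and A: "indep_mod U A f" and i: "i \<notin> A"
    and nospan: "\<And>l. f i - (\<Sum>a\<in>A. l a *s f a) \<notin> U"
  shows "indep_mod U (insert i A) f"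
  unfolding indep_mod_def
proof (intro conjI allI impI)
  have fin: "finite A" using A indep_mod_finite by auto
  then show "finite (insert i A)" by simp
  fix c assume "(\<Sum>a\<in>insert i A. c a *s f a) \<in> U"
  then have c: "c i *s f i + (\<Sum>a\<in>A. c a *s f a) \<in> U" using fin i by simp
  have ci: "c i = 0"
  proof (rule ccontr)
    assume ci: "c i \<noteq> 0"
    have "(1 / c i) *s (c i *s f i + (\<Sum>a\<in>A. c a *s f a)) \<in> U" by (rule subspace_scale[OF U c])
    then have "f i - (\<Sum>a\<in>A. (- c a / c i) *s f a) \<in> U"
      using ci by (simp add: scale_right_distrib scale_sum_right sum_negf)
    with nospan[of "\<lambda>a. - c a / c i"] show False by blast
  qed
  then have "(\<Sum>a\<in>A. c a *s f a) \<in> U" using c by simp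
  with A ci show "\<forall>a\<in>insert i A. c a = 0" by (auto simp: indep_mod_def)
qed

text \<open>Every finite family contains an independent one that spans it modulo \<open>U\<close>.\<close>

lemma indep_mod_maximal:
  assumes U: "subspace U" and I: "finite I"
  obtains A l where "A \<subseteq> I" "indep_mod U A f"
    "\<And>i. i \<in> I \<Longrightarrow> f i - (\<Sum>a\<in>A. l i a *s f a) \<in> U"
proof -
  have "\<exists>A. A \<subseteq> I \<and> indep_mod U A f \<and> (\<forall>i\<in>I. \<exists>l. f i - (\<Sum>a\<in>A. l a *s f a) \<in> U)"
    using I
  proof (induction I rule: finite_induct)
    case empty
    show ?case by (intro exI[of _ "{}"]) (simp add: indep_mod_def)
  next
    case (insert i I)
    then obtain A where A: "A \<subseteq> I" "indep_mod U A f"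
      "\<And>i. i \<in> I \<Longrightarrow> \<exists>l. f i - (\<Sum>a\<in>A. l a *s f a) \<in> U" by blast
    have fin: "finite A" using A(2) by (rule indep_mod_finite)
    have iA: "i \<notin> A" using A(1) insert by blast
    show ?case
    proof (cases "\<exists>l. f i - (\<Sum>a\<in>A. l a *s f a) \<in> U")
      case True
      with A show ?thesis by (intro exI[of _ A]) auto
    next
      case False
      have "\<exists>l. f x - (\<Sum>a\<in>insert i A. l a *s f a) \<in> U" if "x \<in> insert i I" for x
      proof (cases "x = i")
        case True
        have "f i - (\<Sum>a\<in>insert i A. (if a = i then 1 else 0) *s f a) = 0"
          using fin by (simp add: if_distrib[of "\<lambda>c. c *s _"] cong: if_cong)
        then show ?thesis using subspace_0[OF U] True by metis
      next
        case False
        with that A(3) obtain l where l: "f x - (\<Sum>a\<in>A. l a *s f a) \<in> U" by blast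
        have "(\<Sum>a\<in>insert i A. (l(i := 0)) a *s f a) = (\<Sum>a\<in>A. l a *s f a)"
          using fin iA by (simp, intro sum.cong) auto
        with l show ?thesis by metis
      qed
      moreover have "indep_mod U (insert i A) f"
        using indep_mod_insert[OF U A(2) iA] False by blast
      ultimately show ?thesis using A(1) by (intro exI[of _ "insert i A"]) auto
    qed
  qed
  then show ?thesis using that by metis
qed

lemma span_Un_image:
  assumes U: "subspace U" and T: "finite T" and w: "w \<in> span (U \<union> f ` T)"
  obtains l where "w - (\<Sum>t\<in>T. l t *s f t) \<in> U"
proof -
  obtain x y where xy: "x \<in> span U" "y \<in> span (f ` T)" "w = x + y"
    using w unfolding span_Un by blast
  then have x: "x \<in> U" using U by (simp add: span_eq_iff[THEN iffD2])
  obtain k where k: "y = (\<Sum>v\<in>f ` T. k v *s v)" using xy(2) T by (auto simp: span_finite)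
  \<comment> \<open>\<open>f\<close> need not be injective: one preimage of each vector carries its coefficient\<close>
  define l where "l t = (if t \<in> inv_into T f ` f ` T then k (f t) else 0)" for t
  have "(\<Sum>t\<in>T. l t *s f t) = (\<Sum>t\<in>inv_into T f ` f ` T. k (f t) *s f t)"
    using T by (intro sum.mono_neutral_cong_right) (auto simp: l_def inv_into_into)
  also have "\<dots> = y"
    unfolding k by (subst sum.reindex[OF inj_on_inv_into]) (auto simp: f_inv_into_f)
  finally have "w - (\<Sum>t\<in>T. l t *s f t) \<in> U" using xy(3) x by simp
  then show ?thesis using that by blast
qed

lemma span_linear_subset:
  assumes add: "\<And>v w. T (v + w) = T v + T w" and scale: "\<And>c v. T (c *s v) = c *s T v"
    and L: "subspace L" and S: "\<And>v. v \<in> S \<Longrightarrow> T v \<in> L" and w: "w \<in> span S"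
  shows "T w \<in> L"
  using w
proof (induction rule: span_induct)
  case base
  have "T 0 = 0" using add[of 0 0] by simp
  then show ?case
    by (intro subspaceI) (simp_all add: add scale subspace_0[OF L] subspace_add[OF L] subspace_scale[OF L])
qed (rule S)

end

section \<open>Polynomials: degrees and derivatives\<close>

abbreviation "lookup \<equiv> Poly_Mapping.lookup"
abbreviation "keys \<equiv> Poly_Mapping.keys"
abbreviation "single \<equiv> Poly_Mapping.single"

lemma poly_mapping_sum_single:
  "p = (\<Sum>m\<in>keys p. single m (lookup p m))"
  by (rule poly_mapping_eqI)
    (auto simp: lookup_sum lookup_single when_def in_keys_iff if_distrib cong: if_cong)

lemma poly_mapping_additive_eqI:
  fixes F G :: "('k \<Rightarrow>\<^sub>0 'c::comm_monoid_add) \<Rightarrow> 'd::ab_group_add"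
  assumes "\<And>p q. F (p + q) = F p + F q" "\<And>p q. G (p + q) = G p + G q"
    and "\<And>m a. F (single m a) = G (single m a)"
  shows "F p = G p"
proof -
  have F0: "F 0 = 0" and G0: "G 0 = 0" using assms(1,2)[of 0 0] by auto
  have "F (\<Sum>m\<in>S. single m (f m)) = G (\<Sum>m\<in>S. single m (f m))"
    if "finite S" for S and f :: "'k \<Rightarrow> 'c"
    using that by (induction S rule: finite_induct) (simp_all add: F0 G0 assms)
  then show ?thesis
    by (subst (1 2) poly_mapping_sum_single) simp
qed

lemma sum_keys_superset:
  assumes "finite S" "keys p \<subseteq> S" "\<And>m. h m 0 = (0::'d::comm_monoid_add)"
  shows "(\<Sum>m\<in>keys p. h m (lookup p m)) = (\<Sum>m\<in>S. h m (lookup p m))"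
  using assms by (intro sum.mono_neutral_left) (auto simp: in_keys_iff)

lemma sum_keys_add:
  fixes p q :: "'k \<Rightarrow>\<^sub>0 'c::comm_monoid_add"
  assumes "\<And>m. h m 0 = (0::'d::comm_monoid_add)" "\<And>m a b. h m (a + b) = h m a + h m b"
  shows "(\<Sum>m\<in>keys (p + q). h m (lookup (p + q) m)) =
    (\<Sum>m\<in>keys p. h m (lookup p m)) +
    (\<Sum>m\<in>keys q. h m (lookup q m))"
proof -
  let ?S = "keys p \<union> keys q"
  have S: "finite ?S" "keys (p + q) \<subseteq> ?S" by (auto simp: Poly_Mapping.keys_add)
  have "(\<Sum>m\<in>keys r. h m (lookup r m)) = (\<Sum>m\<in>?S. h m (lookup r m))"
    if "keys r \<subseteq> ?S" for r
    by (rule sum_keys_superset[where h = h, OF S(1) that]) (rule assms(1))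
  from this[OF S(2)] this[of p] this[of q] show ?thesis
    by (simp add: lookup_add assms(2) sum.distrib)
qed

lemma const_add: "const (a + b) = const a + const b"
  and const_mult: "const (a * b) = const a * const b"
  and const_0 [simp]: "const 0 = 0"
  and const_1 [simp]: "const 1 = 1"
  and const_minus: "const (- a) = - const a"
  by (simp_all add: const_def single_add mult_single single_uminus)

lemma const_mult_single: "const c * single m a = single m (c * a)"
  by (simp add: const_def mult_single)

lemma var_mult_single:
  "var i * single m a = single (m + single i 1) a"
  by (simp add: var_def mult_single add.commute)

lemma pd_single: "pd i (single m a) =
    single (m - single i 1) (of_nat (lookup m i) * a)"
  by (cases "a = 0") (simp_all add: pd_def)

lemma pd_add: "pd i (p + q) = pd i p + pd i q"
  unfolding pd_def
  by (rule sum_keys_add) (simp_all add: algebra_simps single_add)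

lemma pd_0 [simp]: "pd i 0 = 0"
  by (simp add: pd_def)

lemma pd_uminus: "pd i (- p) = - pd i p"
  using pd_add[of i p "- p"] by (simp add: add_eq_0_iff)

lemma pd_diff: "pd i (p - q) = pd i p - pd i q"
  using pd_add[of i p "- q"] by (simp add: pd_uminus)

lemma lookup_pd: "lookup (pd i p) m =
    of_nat (Suc (lookup m i)) * lookup p (m + single i 1)"
proof (rule poly_mapping_additive_eqI[where F = "\<lambda>p. lookup (pd i p) m"])
  fix m' and a :: 'a
  show "lookup (pd i (single m' a)) m = of_nat (Suc (lookup m i)) *
      lookup (single m' a) (m + single i 1)"
  proof (cases "lookup m' i = 0")
    case True
    then have "m' \<noteq> m + single i 1" by (auto simp: lookup_add)
    with True show ?thesis by (simp add: pd_single lookup_single)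
  next
    case False
    then have "m' - single i 1 + single i 1 = m'"
      by (intro poly_mapping_eqI) (auto simp: lookup_add lookup_minus lookup_single when_def)
    then have "m' - single i 1 = m \<longleftrightarrow> m' = m + single i 1" by auto
    with False show ?thesis by (auto simp: pd_single lookup_single when_def lookup_add)
  qed
qed (simp_all add: pd_add lookup_add algebra_simps)

lemma pd_mult: "pd i (p * q) = pd i p * q + p * pd i q"
proof (rule poly_mapping_additive_eqI[where F = "\<lambda>p. pd i (p * q)"])
  fix m and a :: 'a
  show "pd i (single m a * q) = pd i (single m a) * q + single m a * pd i q"
  proof (rule poly_mapping_additive_eqI[where F = "\<lambda>q. pd i (single m a * q)"])
    fix m' and b :: 'a
    let ?e = "single i (1::nat)"
    have 1: "lookup m i \<noteq> 0 \<Longrightarrow> m - ?e + m' = m + m' - ?e"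
      by (intro poly_mapping_eqI) (auto simp: lookup_add lookup_minus lookup_single when_def)
    have 2: "lookup m' i \<noteq> 0 \<Longrightarrow> m + (m' - ?e) = m + m' - ?e"
      by (intro poly_mapping_eqI) (auto simp: lookup_add lookup_minus lookup_single when_def)
    show "pd i (single m a * single m' b) =
        pd i (single m a) * single m' b + single m a * pd i (single m' b)"
      using 1 2
      by (cases "lookup m i = 0"; cases "lookup m' i = 0")
        (simp_all add: mult_single pd_single lookup_add single_add[symmetric] algebra_simps)
  qed (simp_all add: pd_add algebra_simps)
qed (simp_all add: pd_add algebra_simps)

lemma pd_const [simp]: "pd i (const c) = 0"
  by (simp add: const_def pd_single)

lemma pd_var: "pd i (var j) = (if i = j then 1 else 0)"
  by (auto simp: var_def pd_single lookup_single)

lemma pd_commute: "pd i (pd j p) = pd j (pd i p)"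
proof (rule poly_mapping_eqI)
  fix m
  have "m + single i 1 + single j 1 =
    m + single j 1 + single i (1::nat)" by (simp add: ac_simps)
  then show "lookup (pd i (pd j p)) m = lookup (pd j (pd i p)) m"
    by (auto simp: lookup_pd lookup_add lookup_single when_def)
qed

text \<open>The total degree of an exponent.\<close>

definition tdeg :: "(nat \<Rightarrow>\<^sub>0 nat) \<Rightarrow> nat" where
  "tdeg m = (\<Sum>i\<in>keys m. lookup m i)"

lemma tdeg_add: "tdeg (m + m') = tdeg m + tdeg m'"
  unfolding tdeg_def by (rule sum_keys_add) auto

lemma tdeg_0 [simp]: "tdeg 0 = 0"
  and tdeg_single [simp]: "tdeg (single i k) = k"
  by (simp_all add: tdeg_def)

lemma tdeg_eq_0_iff: "tdeg m = 0 \<longleftrightarrow> m = 0"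
  by (auto simp: tdeg_def in_keys_iff intro!: poly_mapping_eqI)

lemma tdeg_eq_sum: "finite J \<Longrightarrow> keys m \<subseteq> J \<Longrightarrow> tdeg m = (\<Sum>i\<in>J. lookup m i)"
  unfolding tdeg_def by (rule sum_keys_superset[where h = "\<lambda>_ a. a"]) auto

lemma lookup_le_tdeg: "lookup m i \<le> tdeg m"
  by (cases "i \<in> keys m") (auto simp: tdeg_def in_keys_iff intro: member_le_sum)

lemma diff_single_add:
  "lookup m i \<noteq> (0::nat) \<Longrightarrow> m - single i 1 + single i 1 = m"
  by (intro poly_mapping_eqI) (auto simp: lookup_add lookup_minus lookup_single when_def)

lemma tdeg_diff_single: "tdeg (m - single i 1) \<le> tdeg m"
proof (cases "lookup m i = 0")
  case True
  then have "m - single i 1 = m"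
    by (intro poly_mapping_eqI) (auto simp: lookup_minus lookup_single when_def)
  then show ?thesis by simp
next
  case False
  from tdeg_add[of "m - single i 1" "single i 1"]
  show ?thesis by (metis diff_single_add[OF False] le_add1)
qed

lemma keys_diff_single: "keys (m - single i (1::nat)) \<subseteq> keys m"
  by (auto simp: in_keys_iff lookup_minus)

lemma keys_add_nat: "keys (m + m' :: nat \<Rightarrow>\<^sub>0 nat) = keys m \<union> keys m'"
  by (auto simp: in_keys_iff lookup_add)

text \<open>Exponents and polynomials in the variables with index in \<open>J\<close>, of total degree at most \<open>d\<close>.\<close>

definition exps_le :: "nat set \<Rightarrow> nat \<Rightarrow> (nat \<Rightarrow>\<^sub>0 nat) set" where
  "exps_le J d = {m. keys m \<subseteq> J \<and> tdeg m \<le> d}"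

definition polys_le :: "nat set \<Rightarrow> nat \<Rightarrow> 'a::field_char_0 mpoly set" where
  "polys_le J d = {p. keys p \<subseteq> exps_le J d}"

lemma exps_le_mono: "d \<le> e \<Longrightarrow> exps_le J d \<subseteq> exps_le J e"
  by (auto simp: exps_le_def)

lemma exps_le_add: "m \<in> exps_le J d \<Longrightarrow> m' \<in> exps_le J e \<Longrightarrow> m + m' \<in> exps_le J (d + e)"
  by (auto simp: exps_le_def tdeg_add keys_add_nat)

lemma exps_le_add_single: "m \<in> exps_le J d \<Longrightarrow> i \<in> J \<Longrightarrow> m + single i 1 \<in> exps_le J (Suc d)"
  using exps_le_add[of m J d "single i 1" 1] by (auto simp: exps_le_def)

lemma exps_le_diff_single: "m \<in> exps_le J d \<Longrightarrow> m - single i 1 \<in> exps_le J d"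
  using tdeg_diff_single[of m i] keys_diff_single[of m i] by (auto simp: exps_le_def)

lemma exps_le_box:
  assumes "finite J"
  shows "finite (exps_le J d)" "card (exps_le J d) \<le> (d + 1) ^ card J"
proof -
  let ?r = "\<lambda>m. restrict (lookup m) J"
  have inj: "inj_on ?r (exps_le J d)"
  proof (rule inj_onI, rule poly_mapping_eqI)
    fix m m' i assume *: "m \<in> exps_le J d" "m' \<in> exps_le J d" "?r m = ?r m'"
    show "lookup m i = lookup m' i"
    proof (cases "i \<in> J")
      case True
      with fun_cong[OF *(3), of i] show ?thesis by simp
    next
      case False
      with * have "i \<notin> keys m" "i \<notin> keys m'" by (auto simp: exps_le_def)
      then show ?thesis by (simp add: in_keys_iff)
    qed
  qed
  have sub: "?r ` exps_le J d \<subseteq> J \<rightarrow>\<^sub>E {..d}"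
    by (auto simp: exps_le_def intro: order.trans[OF lookup_le_tdeg])
  have fin: "finite (J \<rightarrow>\<^sub>E {..d})" using assms by (intro finite_PiE) auto
  show "finite (exps_le J d)"
    using finite_subset[OF sub fin] finite_imageD[OF _ inj] by blast
  have "card (exps_le J d) = card (?r ` exps_le J d)" using card_image[OF inj] by simp
  also have "\<dots> \<le> card (J \<rightarrow>\<^sub>E {..d})" by (rule card_mono[OF fin sub])
  finally show "card (exps_le J d) \<le> (d + 1) ^ card J" using assms by (simp add: card_PiE)
qed

text \<open>The exponents with all entries at most \<open>t\<close> witness the lower bound.\<close>

lemma exps_le_card_lower:
  assumes J: "finite J"
  obtains B where "B \<subseteq> exps_le J (card J * t)" "card B = (t + 1) ^ card J"
proof -
  define mk where "mk f = Abs_poly_mapping (\<lambda>i. if i \<in> J then f i else 0)" for f :: "nat \<Rightarrow> nat"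
  have lk: "lookup (mk f) = (\<lambda>i. if i \<in> J then f i else 0)" for f
    unfolding mk_def by (rule lookup_Abs_poly_mapping) (rule finite_subset[OF _ J], auto)
  define B where "B = mk ` (J \<rightarrow>\<^sub>E {..t})"
  have "inj_on mk (J \<rightarrow>\<^sub>E {..t})"
  proof (rule inj_onI)
    fix f g assume fg: "f \<in> J \<rightarrow>\<^sub>E {..t}" "g \<in> J \<rightarrow>\<^sub>E {..t}" "mk f = mk g"
    show "f = g"
    proof (rule PiE_ext[OF fg(1,2)])
      fix i assume "i \<in> J"
      then show "f i = g i" using lk[of f] lk[of g] fg(3) by (metis (full_types))
    qed
  qed
  then have "card B = (t + 1) ^ card J"
    using J by (simp add: B_def card_image card_PiE)
  moreover have "B \<subseteq> exps_le J (card J * t)"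
  proof
    fix m assume "m \<in> B"
    then obtain f where f: "f \<in> J \<rightarrow>\<^sub>E {..t}" "m = mk f" by (auto simp: B_def)
    have k: "keys m \<subseteq> J" by (auto simp: in_keys_iff f lk split: if_splits)
    have "tdeg m = (\<Sum>i\<in>J. f i)" by (subst tdeg_eq_sum[OF J k]) (simp add: f lk)
    also have "\<dots> \<le> (\<Sum>i\<in>J. t)" using f by (intro sum_mono) auto
    finally show "m \<in> exps_le J (card J * t)" using k by (simp add: exps_le_def)
  qed
  ultimately show ?thesis using that by blast
qed

lemma polys_le_mono: "d \<le> e \<Longrightarrow> polys_le J d \<subseteq> polys_le J e"
  using exps_le_mono[of d e J] by (auto simp: polys_le_def)

lemma polys_le_0 [simp]: "0 \<in> polys_le J d"
  by (simp add: polys_le_def)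

lemma polys_le_add: "p \<in> polys_le J d \<Longrightarrow> q \<in> polys_le J d \<Longrightarrow> p + q \<in> polys_le J d"
  using Poly_Mapping.keys_add[of p q] by (auto simp: polys_le_def)

lemma polys_le_sum: "(\<And>i. i \<in> S \<Longrightarrow> f i \<in> polys_le J d) \<Longrightarrow> sum f S \<in> polys_le J d"
  by (induction S rule: infinite_finite_induct) (auto intro: polys_le_add)

lemma polys_le_single: "m \<in> exps_le J d \<Longrightarrow> single m a \<in> polys_le J d"
  by (simp add: polys_le_def)

lemma polys_le_const: "const c \<in> polys_le J d"
  unfolding const_def by (rule polys_le_single) (simp add: exps_le_def)

lemma polys_le_var: "i \<in> J \<Longrightarrow> var i \<in> polys_le J (Suc 0)"
  unfolding var_def by (rule polys_le_single) (simp add: exps_le_def)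

lemma polys_le_mult: "p \<in> polys_le J d \<Longrightarrow> q \<in> polys_le J e \<Longrightarrow> p * q \<in> polys_le J (d + e)"
proof -
  assume p: "p \<in> polys_le J d" and q: "q \<in> polys_le J e"
  have "a + b \<in> exps_le J (d + e)" if "a \<in> keys p" "b \<in> keys q" for a b
    using p q that by (intro exps_le_add) (auto simp: polys_le_def)
  then show ?thesis using Poly_Mapping.keys_mult[of p q] by (force simp: polys_le_def)
qed

lemma polys_le_const_mult: "p \<in> polys_le J d \<Longrightarrow> const c * p \<in> polys_le J d"
  using polys_le_mult[OF polys_le_const, of p J d c 0] by simp

lemma polys_le_var_mult: "i \<in> J \<Longrightarrow> p \<in> polys_le J d \<Longrightarrow> var i * p \<in> polys_le J (Suc d)"
  using polys_le_mult[OF polys_le_var, of i J p d] by simp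

lemma polys_le_uminus: "p \<in> polys_le J d \<Longrightarrow> - p \<in> polys_le J d"
  by (simp add: polys_le_def)

lemma polys_le_diff: "p \<in> polys_le J d \<Longrightarrow> q \<in> polys_le J d \<Longrightarrow> p - q \<in> polys_le J d"
  using polys_le_add[of p J d "- q"] polys_le_uminus[of q J d] by simp

lemma keys_pd: "m \<in> keys (pd i p) \<Longrightarrow> m + single i 1 \<in> keys p"
  by (auto simp: in_keys_iff lookup_pd)

lemma polys_le_pd: "p \<in> polys_le J (Suc d) \<Longrightarrow> pd i p \<in> polys_le J d"
  using keys_pd[of _ i p]
  by (fastforce simp: polys_le_def exps_le_def tdeg_add keys_add_nat)

lemma polys_le_pd': "p \<in> polys_le J d \<Longrightarrow> pd i p \<in> polys_le J d"
  using polys_le_mono[of d "Suc d" J] by (intro polys_le_pd) auto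

lemma polys_le_0_iff: "p \<in> polys_le J 0 \<longleftrightarrow> (\<exists>c. p = const c)"
proof
  assume "p \<in> polys_le J 0"
  then have "keys p \<subseteq> {0}" by (auto simp: polys_le_def exps_le_def tdeg_eq_0_iff)
  then have "p = const (lookup p 0)"
    by (intro poly_mapping_eqI) (auto simp: const_def lookup_single when_def in_keys_iff)
  then show "\<exists>c. p = const c" by blast
qed (auto intro: polys_le_const)

text \<open>Characteristic zero is needed here: otherwise the derivatives of a \<open>p\<close>-th power vanish too.\<close>

lemma polys_le_pd_eq_0:
  assumes p: "p \<in> polys_le J d" and pd: "\<And>i. i \<in> J \<Longrightarrow> pd i p = 0"
  shows "\<exists>c. p = const c"
proof -
  have "m = 0" if m: "m \<in> keys p" for m
  proof (rule ccontr)
    assume "m \<noteq> 0"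
    then obtain i where i: "lookup m i \<noteq> 0" by (metis lookup_zero poly_mapping_eqI)
    then have "i \<in> J" using m p by (force simp: polys_le_def exps_le_def in_keys_iff)
    from pd[OF this] have "lookup (pd i p) (m - single i 1) = 0" by simp
    then have "lookup p m = 0"
      unfolding lookup_pd diff_single_add[OF i] by (simp del: of_nat_Suc)
    with m show False by (simp add: in_keys_iff)
  qed
  then have "keys p \<subseteq> {0}" by blast
  then have "p \<in> polys_le J 0" by (force simp: polys_le_def exps_le_def)
  then show ?thesis by (simp add: polys_le_0_iff)
qed

lemma polys_eq_UN: "polys n = (\<Union>d. polys_le {1..n} d)"
proof (intro equalityI subsetI)
  fix p assume p: "p \<in> polys n"
  define d where "d = (\<Sum>m\<in>keys p. tdeg m)"
  have "tdeg m \<le> d" if "m \<in> keys p" for m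
    unfolding d_def using that by (intro member_le_sum) auto
  with p have "p \<in> polys_le {1..n} d" by (auto simp: polys_def polys_le_def exps_le_def)
  then show "p \<in> (\<Union>d. polys_le {1..n} d)" by blast
qed (auto simp: polys_def polys_le_def exps_le_def)

section \<open>Actions of the Weyl algebra\<close>

text \<open>The relations are required on the whole ambient space, whose elements of interest form \<open>V\<close>; only the
  operators with index in \<open>{1..n}\<close> have to preserve \<open>V\<close>.\<close>

locale weyl_action = K_space scale
  for scale :: "'a::field_char_0 \<Rightarrow> 'b::ab_group_add \<Rightarrow> 'b" (infixr \<open>*s\<close> 75) +
  fixes n :: nat and V :: "'b set" and X D :: "nat \<Rightarrow> 'b \<Rightarrow> 'b"
  assumes V: "subspace V"
    and X_closed: "i \<in> {1..n} \<Longrightarrow> v \<in> V \<Longrightarrow> X i v \<in> V"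
    and D_closed: "i \<in> {1..n} \<Longrightarrow> v \<in> V \<Longrightarrow> D i v \<in> V"
    and X_add: "X i (v + w) = X i v + X i w" and X_scale: "X i (c *s v) = c *s X i v"
    and D_add: "D i (v + w) = D i v + D i w" and D_scale: "D i (c *s v) = c *s D i v"
    and X_X: "X i (X j v) = X j (X i v)"
    and D_D: "D i (D j v) = D j (D i v)"
    and D_X: "D i (X j v) = X j (D i v) + (if i = j then v else 0)"
begin

lemma X_0 [simp]: "X i 0 = 0" using X_add[of i 0 0] by simp
lemma D_0 [simp]: "D i 0 = 0" using D_add[of i 0 0] by simp
lemma D_sum: "D i (sum f S) = (\<Sum>s\<in>S. D i (f s))"
  by (induction S rule: infinite_finite_induct) (simp_all add: D_add)

lemma X_pow_add: "(X i ^^ a) (v + w) = (X i ^^ a) v + (X i ^^ a) w"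
  and D_pow_add: "(D i ^^ a) (v + w) = (D i ^^ a) v + (D i ^^ a) w"
  and X_pow_scale: "(X i ^^ a) (c *s v) = c *s (X i ^^ a) v"
  and D_pow_scale: "(D i ^^ a) (c *s v) = c *s (D i ^^ a) v"
  by (induction a) (simp_all add: X_add D_add X_scale D_scale)

lemma pow_0 [simp]: "(X i ^^ a) 0 = 0" "(D i ^^ a) 0 = 0"
  by (induction a) simp_all

lemma X_X_pow: "X i ((X j ^^ a) v) = (X j ^^ a) (X i v)"
  by (induction a) (simp_all add: X_X[of i])

lemma D_D_pow: "D i ((D j ^^ a) v) = (D j ^^ a) (D i v)"
  by (induction a) (simp_all add: D_D[of i])

lemma X_D: "X j (D i v) = D i (X j v) - (if i = j then v else 0)"
  by (simp add: D_X)

lemma X_D_pow_neq: "i \<noteq> j \<Longrightarrow> X i ((D j ^^ a) v) = (D j ^^ a) (X i v)"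
  by (induction a) (simp_all add: X_D)

lemma D_X_pow_neq: "i \<noteq> j \<Longrightarrow> D i ((X j ^^ a) v) = (X j ^^ a) (D i v)"
  by (induction a) (simp_all add: D_X)

lemma D_X_pow: "D i ((X i ^^ a) v) = (X i ^^ a) (D i v) + of_nat a *s (X i ^^ (a - 1)) v"
proof (induction a)
  case (Suc a)
  have "X i ((X i ^^ (a - 1)) v) = (X i ^^ a) v" if "a \<noteq> 0"
    using that by (cases a) simp_all
  with Suc show ?case
    by (cases "a = 0") (simp_all add: D_X X_add X_scale scale_left_distrib algebra_simps)
qed simp

lemma D_pow_X: "(D i ^^ a) (X i v) = X i ((D i ^^ a) v) + of_nat a *s (D i ^^ (a - 1)) v"
proof (induction a)
  case (Suc a)
  have "D i ((D i ^^ (a - 1)) v) = (D i ^^ a) v" if "a \<noteq> 0"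
    using that by (cases a) simp_all
  with Suc show ?case
    by (cases "a = 0") (simp_all add: D_X D_add D_scale scale_left_distrib algebra_simps)
qed simp

text \<open>The operator \<open>\<Prod>\<^sub>i X\<^sub>i\<^bsup>\<alpha>\<^sub>i\<^esup> D\<^sub>i\<^bsup>\<beta>\<^sub>i\<^esup>\<close>, where the single exponent \<open>g\<close> carries \<open>\<alpha>\<^sub>i\<close> at the index \<open>2i\<close> and
  \<open>\<beta>\<^sub>i\<close> at the index \<open>2i + 1\<close>. Factors with different \<open>i\<close> commute.\<close>

primrec mon_upto :: "nat \<Rightarrow> (nat \<Rightarrow>\<^sub>0 nat) \<Rightarrow> 'b \<Rightarrow> 'b" where
  "mon_upto 0 g v = v"
| "mon_upto (Suc i) g v =
    (X (Suc i) ^^ lookup g (2 * Suc i)) ((D (Suc i) ^^ lookup g (2 * Suc i + 1)) (mon_upto i g v))"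

lemma mon_upto_cong:
  "(\<And>k. k < 2 * Suc i \<Longrightarrow> lookup g k = lookup g' k) \<Longrightarrow> mon_upto i g v = mon_upto i g' v"
  by (induction i) simp_all

lemma mon_upto_add_single: "2 * Suc i \<le> k \<Longrightarrow> mon_upto i (g + single k a) v = mon_upto i g v"
  by (rule mon_upto_cong) (simp add: lookup_add lookup_single when_def)

lemma mon_upto_diff_single: "2 * Suc i \<le> k \<Longrightarrow> mon_upto i (g - single k a) v = mon_upto i g v"
  by (rule mon_upto_cong) (simp add: lookup_minus lookup_single when_def)

lemma X_mon_upto_gt: "i < j \<Longrightarrow> X j (mon_upto i g v) = mon_upto i g (X j v)"
  by (induction i) (simp_all add: X_X_pow X_D_pow_neq)

lemma D_mon_upto_gt: "i < j \<Longrightarrow> D j (mon_upto i g v) = mon_upto i g (D j v)"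
  by (induction i) (simp_all add: D_D_pow D_X_pow_neq)

lemma mon_upto_add: "mon_upto i g (v + w) = mon_upto i g v + mon_upto i g w"
  and mon_upto_scale: "mon_upto i g (c *s v) = c *s mon_upto i g v"
  by (induction i) (simp_all add: X_pow_add D_pow_add X_pow_scale D_pow_scale)

lemma X_mon_upto:
  "j \<in> {1..i} \<Longrightarrow> X j (mon_upto i g v) = mon_upto i (g + single (2 * j) 1) v"
proof (induction i)
  case (Suc i)
  show ?case
  proof (cases "j = Suc i")
    case True
    then show ?thesis
      by (simp add: mon_upto_add_single lookup_add lookup_single when_def)
  next
    case False
    with Suc have "X j (mon_upto i g v) = mon_upto i (g + single (2 * j) 1) v" by simp
    moreover have "Suc (2 * i) \<noteq> 2 * j" for i by presburger
    ultimately show ?thesis using False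
      by (simp add: X_X_pow X_D_pow_neq lookup_add lookup_single when_def)
  qed
qed simp

lemma D_mon_upto:
  "j \<in> {1..i} \<Longrightarrow> D j (mon_upto i g v) = mon_upto i (g + single (2 * j + 1) 1) v +
    of_nat (lookup g (2 * j)) *s mon_upto i (g - single (2 * j) 1) v"
proof (induction i)
  case (Suc i)
  show ?case
  proof (cases "j = Suc i")
    case True
    then show ?thesis
      by (simp add: mon_upto_add_single mon_upto_diff_single lookup_add lookup_minus lookup_single when_def D_X_pow)
  next
    case False
    with Suc have "D j (mon_upto i g v) = mon_upto i (g + single (2 * j + 1) 1) v +
      of_nat (lookup g (2 * j)) *s mon_upto i (g - single (2 * j) 1) v" by simp
    moreover have "Suc (2 * i) \<noteq> 2 * j" "2 * i \<noteq> Suc (2 * j)" for i by presburger+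
    ultimately show ?thesis using False
      by (simp add: D_D_pow D_X_pow_neq lookup_add lookup_minus lookup_single when_def
          X_pow_add D_pow_add X_pow_scale D_pow_scale)
  qed
qed simp

lemma mon_upto_X:
  "j \<in> {1..i} \<Longrightarrow> mon_upto i g (X j v) = X j (mon_upto i g v) +
    of_nat (lookup g (2 * j + 1)) *s mon_upto i (g - single (2 * j + 1) 1) v"
proof (induction i)
  case (Suc i)
  show ?case
  proof (cases "j = Suc i")
    case True
    then show ?thesis
      by (simp add: X_mon_upto_gt[symmetric] mon_upto_diff_single lookup_minus lookup_single when_def D_pow_X
          X_pow_add X_pow_scale)
        (simp add: X_X_pow)
  next
    case False
    with Suc have "mon_upto i g (X j v) = X j (mon_upto i g v) +
      of_nat (lookup g (2 * j + 1)) *s mon_upto i (g - single (2 * j + 1) 1) v" by simp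
    moreover have "Suc (2 * i) \<noteq> 2 * j" "2 * i \<noteq> Suc (2 * j)" for i by presburger+
    ultimately show ?thesis using False
      by (simp add: X_X_pow X_D_pow_neq lookup_add lookup_minus lookup_single when_def
          X_pow_add D_pow_add X_pow_scale D_pow_scale)
  qed
qed simp

lemma mon_upto_D:
  "j \<in> {1..i} \<Longrightarrow> mon_upto i g (D j v) = mon_upto i (g + single (2 * j + 1) 1) v"
proof (induction i)
  case (Suc i)
  show ?case
  proof (cases "j = Suc i")
    case True
    then show ?thesis
      by (simp add: D_mon_upto_gt[symmetric] mon_upto_add_single lookup_add lookup_single when_def funpow_swap1)
  next
    case False
    with Suc have "mon_upto i g (D j v) = mon_upto i (g + single (2 * j + 1) 1) v" by simp
    moreover have "Suc (2 * i) \<noteq> 2 * j" "2 * i \<noteq> Suc (2 * j)" for i by presburger+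
    ultimately show ?thesis using False
      by (simp add: lookup_add lookup_single when_def)
  qed
qed simp

lemma mon_upto_0 [simp]: "mon_upto i 0 v = v"
  by (induction i) simp_all

abbreviation mon :: "(nat \<Rightarrow>\<^sub>0 nat) \<Rightarrow> 'b \<Rightarrow> 'b" where
  "mon \<equiv> mon_upto n"

text \<open>The operator with normally ordered symbol \<open>p\<close>, where \<open>z\<^bsub>2i\<^esub>\<close> stands for \<open>X\<^sub>i\<close> and \<open>z\<^bsub>2i+1\<^esub>\<close>
  for \<open>D\<^sub>i\<close>.\<close>

definition op :: "'a mpoly \<Rightarrow> 'b \<Rightarrow> 'b" where
  "op p v = (\<Sum>g\<in>keys p. lookup p g *s mon g v)"

lemma op_add: "op (p + q) v = op p v + op q v"
  unfolding op_def by (rule sum_keys_add) (simp_all add: scale_left_distrib)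

lemma op_single: "op (single g c) v = c *s mon g v"
  by (cases "c = 0") (simp_all add: op_def)

lemma op_0 [simp]: "op 0 v = 0" by (simp add: op_def)

lemma op_const: "op (const c) v = c *s v"
  by (simp add: const_def op_single)

lemma op_uminus: "op (- p) v = - op p v"
  using op_add[of p "- p" v] by (simp add: add_eq_0_iff)

lemma op_diff: "op (p - q) v = op p v - op q v"
  using op_add[of p "- q" v] by (simp add: op_uminus)

lemma op_const_mult: "op (const c * p) v = c *s op p v"
  by (rule poly_mapping_additive_eqI[where F = "\<lambda>p. op (const c * p) v"])
    (simp_all add: op_add op_single const_mult_single scale_right_distrib algebra_simps)

lemma op_sum: "op (sum f S) v = (\<Sum>s\<in>S. op (f s) v)"
  by (induction S rule: infinite_finite_induct) (simp_all add: op_add)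

lemma op_vadd: "op p (v + w) = op p v + op p w"
  by (simp add: op_def mon_upto_add scale_right_distrib sum.distrib)

lemma op_vscale: "op p (c *s v) = c *s op p v"
  by (simp add: op_def mon_upto_scale scale_sum_right mult.commute)

lemma op_v0 [simp]: "op p 0 = 0"
  using op_vadd[of p 0 0] by simp

lemma op_vsum: "op p (sum f S) = (\<Sum>s\<in>S. op p (f s))"
  by (induction S rule: infinite_finite_induct) (simp_all add: op_vadd)

lemma op_vdiff: "op p (v - w) = op p v - op p w"
  using op_vadd[of p "v - w" w] by simp

lemma X_op: assumes "j \<in> {1..n}" shows "X j (op p v) = op (var (2 * j) * p) v"
  by (rule poly_mapping_additive_eqI[where F = "\<lambda>p. X j (op p v)"])
    (simp_all add: op_add X_add distrib_left add_ac op_single var_mult_single X_scale X_mon_upto[OF assms])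

lemma D_op: assumes "j \<in> {1..n}"
  shows "D j (op p v) = op (var (2 * j + 1) * p + pd (2 * j) p) v"
  by (rule poly_mapping_additive_eqI[where F = "\<lambda>p. D j (op p v)"])
    (simp_all add: op_add D_add pd_add distrib_left add_ac op_single var_mult_single D_scale
      D_mon_upto[OF assms, unfolded One_nat_def] pd_single scale_right_distrib)

lemma op_D: assumes "j \<in> {1..n}" shows "op p (D j v) = op (var (2 * j + 1) * p) v"
  by (rule poly_mapping_additive_eqI[where F = "\<lambda>p. op p (D j v)"])
    (simp_all add: op_add distrib_left add_ac op_single var_mult_single mon_upto_D[OF assms, unfolded One_nat_def])

lemma op_X: assumes "j \<in> {1..n}"
  shows "op p (X j v) = op (var (2 * j) * p + pd (2 * j + 1) p) v"
  by (rule poly_mapping_additive_eqI[where F = "\<lambda>p. op p (X j v)"])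
    (simp_all add: op_add pd_add distrib_left add_ac op_single var_mult_single X_mon_upto[OF assms]
      mon_upto_X[OF assms, unfolded One_nat_def] pd_single scale_right_distrib)

text \<open>Commutators with the generators are partial derivatives of the symbol.\<close>

lemma op_pd_even: "j \<in> {1..n} \<Longrightarrow> op (pd (2 * j) p) v = D j (op p v) - op p (D j v)"
  by (simp add: D_op op_D op_add)

lemma op_pd_odd: "j \<in> {1..n} \<Longrightarrow> op (pd (2 * j + 1) p) v = op p (X j v) - X j (op p v)"
  by (simp add: X_op op_X op_add)

end

section \<open>The algebra of symbols\<close>

text \<open>Scalar multiplication of polynomials.\<close>

definition mscale :: "'a::field_char_0 \<Rightarrow> 'a mpoly \<Rightarrow> 'a mpoly" where
  "mscale c f = const c * f"

global_interpretation mv: K_space mscale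
  by unfold_locales (simp_all add: mscale_def const_add const_mult algebra_simps)

text \<open>The effect of left multiplication by \<open>X\<^sub>i\<close> and \<open>D\<^sub>i\<close> on symbols. These operators satisfy the relations of
  the Weyl algebra themselves, so that the product of symbols that corresponds to the composition of
  operators is the action of one symbol on another.\<close>

definition symX :: "nat \<Rightarrow> 'a::field_char_0 mpoly \<Rightarrow> 'a mpoly" where
  "symX i p = var (2 * i) * p"

definition symD :: "nat \<Rightarrow> 'a::field_char_0 mpoly \<Rightarrow> 'a mpoly" where
  "symD i p = var (2 * i + 1) * p + pd (2 * i) p"

definition star :: "nat \<Rightarrow> 'a::field_char_0 mpoly \<Rightarrow> 'a mpoly \<Rightarrow> 'a mpoly" where
  "star n = weyl_action.op mscale n symX symD"

lemma weyl_action_symbols: "weyl_action mscale n UNIV symX symD"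
proof unfold_locales
  have [simp]: "2 * i \<noteq> Suc (2 * j)" "Suc (2 * i) \<noteq> 2 * j" for i j by presburger+
  show "symD i (symX j p) = symX j (symD i p) + (if i = j then p else 0)" for i j and p :: "'a mpoly"
    by (simp add: symX_def symD_def pd_mult pd_var algebra_simps)
  show "symD i (symD j p) = symD j (symD i p)" for i j and p :: "'a mpoly"
    using pd_commute[of "2 * i" "2 * j" p]
    by (simp add: symD_def pd_add pd_mult pd_var distrib_left add_ac mult.left_commute)
qed (simp_all add: mv.subspace_UNIV symX_def symD_def mscale_def pd_add pd_mult algebra_simps)

text \<open>The symbol variables that belong to the variables with index in \<open>I\<close>.\<close>

definition symvars :: "nat set \<Rightarrow> nat set" where
  "symvars I = (\<lambda>i. 2 * i) ` I \<union> (\<lambda>i. 2 * i + 1) ` I"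

lemma symvars_I: "i \<in> I \<Longrightarrow> 2 * i \<in> symvars I" "i \<in> I \<Longrightarrow> 2 * i + 1 \<in> symvars I"
  "i \<in> I \<Longrightarrow> Suc (2 * i) \<in> symvars I"
  by (auto simp: symvars_def)

lemma symvars_iff: "2 * i \<in> symvars I \<longleftrightarrow> i \<in> I" "Suc (2 * i) \<in> symvars I \<longleftrightarrow> i \<in> I"
  by (auto simp: symvars_def image_iff Suc_double_not_eq_double double_not_eq_Suc_double)

lemma finite_symvars: "finite I \<Longrightarrow> finite (symvars I)"
  by (simp add: symvars_def)

lemma symvars_mono: "I \<subseteq> I' \<Longrightarrow> symvars I \<subseteq> symvars I'"
  by (auto simp: symvars_def)

lemma card_symvars: assumes "finite I" shows "card (symvars I) = 2 * card I"
proof -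
  have "(\<lambda>i. 2 * i) ` I \<inter> (\<lambda>i. 2 * i + 1) ` I = {}" by (auto, presburger)
  then have "card (symvars I) = card ((\<lambda>i. 2 * i) ` I) + card ((\<lambda>i. 2 * i + 1) ` I)"
    unfolding symvars_def using assms by (intro card_Un_disjoint) auto
  also have "card ((\<lambda>i. 2 * i) ` I) = card I" by (rule card_image) (auto simp: inj_on_def)
  also have "card ((\<lambda>i. 2 * i + 1) ` I) = card I" by (rule card_image) (auto simp: inj_on_def)
  finally show ?thesis by simp
qed

context weyl_action
begin

text \<open>A monomial operator other than the identity has a factor \<open>X\<^sub>i\<close> on the left or a factor \<open>D\<^sub>i\<close> on the right.\<close>

lemma mon_cases:
  assumes I: "I \<subseteq> {1..n}" and g: "keys g \<subseteq> symvars I" "g \<noteq> 0"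
  obtains (X) i h where "i \<in> I" "keys h \<subseteq> symvars I" "tdeg g = Suc (tdeg h)"
      "\<And>v. mon g v = X i (mon h v)"
    | (D) i h where "i \<in> I" "keys h \<subseteq> symvars I" "tdeg g = Suc (tdeg h)"
      "\<And>v. mon g v = mon h (D i v)"
proof -
  obtain k where k: "lookup g k \<noteq> 0" using g(2) by (metis lookup_zero poly_mapping_eqI)
  define h where "h = g - single k (1::nat)"
  have gh: "g = h + single k 1" by (simp add: h_def diff_single_add[OF k] del: One_nat_def)
  have h: "keys h \<subseteq> symvars I" "tdeg g = Suc (tdeg h)"
    using g(1) by (auto simp: gh keys_add_nat tdeg_add)
  have "k \<in> symvars I" using g(1) k by (auto simp: in_keys_iff)
  then consider i where "i \<in> I" "k = 2 * i" | i where "i \<in> I" "k = 2 * i + 1"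
    by (auto simp: symvars_def)
  then show ?thesis
  proof cases
    case 1
    with I have i: "i \<in> {1..n}" by blast
    show ?thesis by (rule X[OF 1(1) h]) (simp only: gh 1(2) X_mon_upto[OF i])
  next
    case 2
    with I have i: "i \<in> {1..n}" by blast
    show ?thesis by (rule D[OF 2(1) h]) (simp only: gh 2(2) mon_upto_D[OF i])
  qed
qed

lemma X_pow_op: "j \<in> {1..n} \<Longrightarrow> (X j ^^ a) (op p v) = op ((symX j ^^ a) p) v"
  and D_pow_op: "j \<in> {1..n} \<Longrightarrow> (D j ^^ a) (op p v) = op ((symD j ^^ a) p) v"
  by (induction a) (simp_all add: X_op D_op symX_def symD_def)

text \<open>The symbol of a product does not depend on the action.\<close>

lemma op_star: "op p (op p' v) = op (star n p p') v"
proof -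
  interpret S: weyl_action mscale n UNIV symX symD by (rule weyl_action_symbols)
  have "i \<le> n \<Longrightarrow> mon_upto i g (op p' v) = op (S.mon_upto i g p') v" for i g
    by (induction i) (simp_all add: X_pow_op D_pow_op)
  then show ?thesis
    by (simp add: op_def[of p] star_def S.op_def[of p] op_sum mscale_def op_const_mult)
qed

end

lemma star_polys_le:
  fixes p p' :: "'a::field_char_0 mpoly"
  assumes I: "I \<subseteq> {1..n}" and p: "p \<in> polys_le (symvars I) d" and p': "p' \<in> polys_le (symvars I) e"
  shows "star n p p' \<in> polys_le (symvars I) (d + e)"
proof -
  interpret S: weyl_action "mscale :: 'a \<Rightarrow> _" n UNIV symX symD by (rule weyl_action_symbols)
  have symX: "symX i r \<in> polys_le (symvars I) (Suc l)" and symD: "symD i r \<in> polys_le (symvars I) (Suc l)"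
    if "i \<in> I" "r \<in> polys_le (symvars I) l" for i l and r :: "'a mpoly"
  proof -
    have "r \<in> polys_le (symvars I) (Suc l)" using that(2) polys_le_mono[of l "Suc l"] by auto
    with that show "symD i r \<in> polys_le (symvars I) (Suc l)"
      unfolding symD_def by (intro polys_le_add polys_le_var_mult polys_le_pd' symvars_I)
    show "symX i r \<in> polys_le (symvars I) (Suc l)"
      unfolding symX_def using that by (intro polys_le_var_mult symvars_I)
  qed
  have mon: "keys g \<subseteq> symvars I \<Longrightarrow> r \<in> polys_le (symvars I) l \<Longrightarrow>
      S.mon_upto n g r \<in> polys_le (symvars I) (tdeg g + l)" for g l and r :: "'a mpoly"
  proof (induction "tdeg g" arbitrary: g r l)
    case 0
    then show ?case by (simp add: tdeg_eq_0_iff)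
  next
    case (Suc k)
    then have "g \<noteq> 0" by (metis tdeg_0 nat.distinct(1))
    with I Suc.prems(1) show ?case
    proof (cases rule: S.mon_cases)
      case (X i h)
      then have "S.mon_upto n h r \<in> polys_le (symvars I) (tdeg h + l)"
        using Suc.hyps Suc.prems(2) by simp
      from symX[OF X(1) this] show ?thesis by (simp add: X)
    next
      case (D i h)
      then have "k = tdeg h" using Suc.hyps(2) by simp
      from Suc.hyps(1)[OF this D(2) symD[OF D(1) Suc.prems(2)]]
      have "S.mon_upto n h (symD i r) \<in> polys_le (symvars I) (tdeg h + Suc l)" .
      then show ?thesis by (simp add: D)
    qed
  qed
  have "const c * S.mon_upto n g p' \<in> polys_le (symvars I) (d + e)" if "g \<in> keys p" for g c
  proof -
    have g: "keys g \<subseteq> symvars I" "tdeg g + e \<le> d + e" using that p by (auto simp: polys_le_def exps_le_def)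
    from mon[OF g(1) p'] polys_le_mono[OF g(2)] show ?thesis by (intro polys_le_const_mult) blast
  qed
  then show ?thesis unfolding star_def S.op_def mscale_def by (intro polys_le_sum)
qed

section \<open>A lower bound for the growth of modules\<close>

context weyl_action
begin

text \<open>Subspaces that are stable under the Weyl algebra in the variables with index in \<open>I\<close>.\<close>

definition stable :: "nat set \<Rightarrow> 'b set \<Rightarrow> bool" where
  "stable I W \<longleftrightarrow> subspace W \<and> (\<forall>i\<in>I. \<forall>w\<in>W. X i w \<in> W \<and> D i w \<in> W)"

lemma stableD:
  assumes "stable I W"
  shows "subspace W" "i \<in> I \<Longrightarrow> w \<in> W \<Longrightarrow> X i w \<in> W" "i \<in> I \<Longrightarrow> w \<in> W \<Longrightarrow> D i w \<in> W"
  using assms by (auto simp: stable_def)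

lemma stable_V: "I \<subseteq> {1..n} \<Longrightarrow> stable I V"
  using V X_closed D_closed by (auto simp: stable_def)

lemma stable_mono: "stable I W \<Longrightarrow> I' \<subseteq> I \<Longrightarrow> stable I' W"
  by (auto simp: stable_def)

lemma mon_stable:
  assumes W: "stable I W" and g: "keys g \<subseteq> symvars I" and w: "w \<in> W"
  shows "mon_upto i g w \<in> W"
proof (induction i)
  case (Suc i)
  have X: "(X (Suc i) ^^ a) v \<in> W" if "v \<in> W" "Suc i \<in> I" for a v
    using that by (induction a) (auto intro: stableD[OF W])
  have D: "(D (Suc i) ^^ a) v \<in> W" if "v \<in> W" "Suc i \<in> I" for a v
    using that by (induction a) (auto intro: stableD[OF W])
  show ?case
  proof (cases "Suc i \<in> I")
    case True
    then show ?thesis using Suc X D by simp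
  next
    case False
    have "2 * Suc i \<notin> symvars I" "2 * Suc i + 1 \<notin> symvars I"
      using False symvars_iff[of "Suc i" I] by simp_all
    with g have "2 * Suc i \<notin> keys g" "2 * Suc i + 1 \<notin> keys g" by blast+
    with Suc show ?thesis by (simp add: in_keys_iff)
  qed
qed (use w in simp)

lemma op_stable:
  assumes W: "stable I W" and p: "p \<in> polys_le (symvars I) d" and w: "w \<in> W"
  shows "op p w \<in> W"
  unfolding op_def using p
  by (intro subspace_sum subspace_scale stableD(1)[OF W] mon_stable[OF W _ w])
    (auto simp: polys_le_def exps_le_def)

lemma op_mon_sum:
  "op (\<Sum>b\<in>B. single b (c b)) v = (\<Sum>b\<in>B. c b *s mon b v)"
  by (simp add: op_sum op_single)

text \<open>Suppose that an operator of degree at most \<open>d\<close> annihilates, modulo \<open>W\<close>, whatever operators of degree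
  at most \<open>d\<close> make of \<open>u\<close>. Then its commutators with the generators do the same in degree \<open>d - 1\<close>.
  Iterated commutators of a nonzero operator end in a nonzero scalar, so \<open>u\<close> itself lies in \<open>W\<close>.\<close>

lemma op_annihilates:
  assumes I: "I \<subseteq> {1..n}" and W: "stable I W"
  shows "p \<in> polys_le (symvars I) d \<Longrightarrow> p \<noteq> 0 \<Longrightarrow>
    (\<And>g. g \<in> exps_le (symvars I) d \<Longrightarrow> op p (mon g u) \<in> W) \<Longrightarrow> u \<in> W"
proof (induction d arbitrary: p)
  case 0
  then obtain c where c: "p = const c" by (auto simp: polys_le_0_iff)
  have "op p (mon 0 u) \<in> W" by (rule 0) (simp add: exps_le_def)
  then have "c *s u \<in> W" by (simp add: c op_const)
  moreover have "c \<noteq> 0" using 0(2) c by auto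
  ultimately show ?case using subspace_scale[OF stableD(1)[OF W], of "c *s u" "1 / c"] by simp
next
  case (Suc d)
  have ann: "op p (mon g u) \<in> W" if "g \<in> exps_le (symvars I) (Suc d)" for g
    using Suc.prems(3)[OF that] .
  note sub = stableD(1)[OF W]
  show ?case
  proof (cases "\<exists>k\<in>symvars I. pd k p \<noteq> 0")
    case True
    then obtain k where k: "k \<in> symvars I" "pd k p \<noteq> 0" by blast
    show ?thesis
    proof (rule Suc.IH[OF polys_le_pd[OF Suc.prems(1)] k(2)])
      fix g assume g: "g \<in> exps_le (symvars I) d"
      then have g': "g \<in> exps_le (symvars I) (Suc d)" using exps_le_mono[of d "Suc d"] by auto
      from k(1) consider i where "i \<in> I" "k = 2 * i" | i where "i \<in> I" "k = 2 * i + 1"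
        by (auto simp: symvars_def)
      then show "op (pd k p) (mon g u) \<in> W"
      proof cases
        case 1
        with I have i: "i \<in> {1..n}" by blast
        have "g + single (2 * i + 1) 1 \<in> exps_le (symvars I) (Suc d)"
          using exps_le_add_single[OF g] symvars_I 1 by auto
        then have "op p (D i (mon g u)) \<in> W"
          unfolding D_mon_upto[OF i] op_vadd op_vscale
          using g' by (intro subspace_add[OF sub] subspace_scale[OF sub] ann exps_le_diff_single)
        moreover have "D i (op p (mon g u)) \<in> W" using 1 g' by (intro stableD[OF W] ann)
        ultimately show ?thesis
          unfolding 1(2) op_pd_even[OF i] by (intro subspace_diff[OF sub])
      next
        case 2
        with I have i: "i \<in> {1..n}" by blast
        have "g + single (2 * i) 1 \<in> exps_le (symvars I) (Suc d)"
          using exps_le_add_single[OF g] symvars_I 2 by auto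
        then have "op p (X i (mon g u)) \<in> W"
          unfolding X_mon_upto[OF i] by (rule ann)
        moreover have "X i (op p (mon g u)) \<in> W" using 2 g' by (intro stableD[OF W] ann)
        ultimately show ?thesis
          unfolding 2(2) op_pd_odd[OF i] by (intro subspace_diff[OF sub])
      qed
    qed
  next
    case False
    then obtain c where c: "p = const c" using polys_le_pd_eq_0[OF Suc.prems(1)] by blast
    have "op p (mon 0 u) \<in> W" by (rule ann) (simp add: exps_le_def)
    then have "c *s u \<in> W" by (simp add: c op_const)
    moreover have "c \<noteq> 0" using Suc.prems(2) c by auto
    ultimately show ?thesis using subspace_scale[OF sub, of "c *s u" "1 / c"] by simp
  qed
qed

text \<open>A quantitative form of Bernstein's inequality: the operators of degree at most \<open>4mt\<close>, where
  \<open>m = card I\<close>, make of an element \<open>u\<close> outside \<open>W\<close> a space of dimension at least \<open>(t + 1)\<^sup>m\<close> modulo \<open>W\<close>.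
  With \<open>B\<^sub>d\<close> denoting the operators of degree at most \<open>d = 2mt\<close>, every element of \<open>B\<^sub>d\<close> induces a linear map
  from \<open>B\<^sub>d u\<close> to \<open>B\<^bsub>2d\<^esub> u\<close>, both modulo \<open>W\<close>. If these spaces had dimension less than \<open>(t + 1)\<^sup>m\<close>, some nonzero
  combination of the \<open>(t + 1)\<^bsup>2m\<^esup>\<close> monomials with exponents at most \<open>t\<close> would induce the zero map.\<close>

lemma bernstein_lower_bound:
  assumes I: "I \<subseteq> {1..n}" and W: "stable I W" and u: "u \<notin> W"
  obtains A where "A \<subseteq> exps_le (symvars I) (4 * card I * t)" "indep_mod W A (\<lambda>g. mon g u)"
    "(t + 1) ^ card I \<le> card A"
proof -
  define J where "J = symvars I"
  define d where "d = card J * t"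
  have finI: "finite I" using I finite_subset by blast
  have J: "finite J" "card J = 2 * card I" using finI by (simp_all add: J_def finite_symvars card_symvars)
  have dd: "d + d = 4 * card I * t" by (simp add: d_def J)
  note sub = stableD(1)[OF W]
  obtain B where B: "B \<subseteq> exps_le J d" "card B = (t + 1) ^ card J"
    unfolding d_def by (rule exps_le_card_lower[OF J(1)])
  then have finB: "finite B" using exps_le_box(1)[OF J(1)] finite_subset by blast
  obtain A l where A: "A \<subseteq> exps_le J (d + d)" "indep_mod W A (\<lambda>g. mon g u)"
    "\<And>g. g \<in> exps_le J (d + d) \<Longrightarrow> mon g u - (\<Sum>a\<in>A. l g a *s mon a u) \<in> W"
    by (rule indep_mod_maximal[OF sub exps_le_box(1)[OF J(1)], where f = "\<lambda>g. mon g u"]) blast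
  obtain E k where E: "E \<subseteq> exps_le J d" "indep_mod W E (\<lambda>g. mon g u)"
    "\<And>g. g \<in> exps_le J d \<Longrightarrow> mon g u - (\<Sum>e\<in>E. k g e *s mon e u) \<in> W"
    by (rule indep_mod_maximal[OF sub exps_le_box(1)[OF J(1)], where f = "\<lambda>g. mon g u"]) blast
  have fin: "finite A" "finite E" using A(2) E(2) indep_mod_finite by auto
  have EA: "card E \<le> card A"
    using E(1) exps_le_mono[of d "d + d" J] by (intro indep_mod_card_le[OF sub E(2) fin(1) A(3)]) auto
  have "(t + 1) ^ card I \<le> card A"
  proof (rule ccontr)
    assume "\<not> ?thesis"
    then have "card A < (t + 1) ^ card I" by simp
    then have "card A * card A < (t + 1) ^ card I * (t + 1) ^ card I" by (intro mult_strict_mono) auto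
    moreover have "card E * card A \<le> card A * card A" using EA by simp
    ultimately have less: "card (E \<times> A) < card B"
      unfolding B(2) J(2) mult_2 power_add card_cartesian_product by (rule le_less_trans[rotated])
    have "\<exists>r. mon b (mon e u) - (\<Sum>a\<in>A. r a *s mon a u) \<in> W" if "b \<in> B" "e \<in> E" for b e
    proof -
      have "single e (1::'a) \<in> polys_le J d" "single b (1::'a) \<in> polys_le J d"
        using that E(1) B(1) by (auto intro: polys_le_single)
      from star_polys_le[OF I this(2,1)[unfolded J_def]] op_star[of "single b 1" "single e 1" u]
      obtain q where q: "q \<in> polys_le J (d + d)" "mon b (mon e u) = op q u"
        by (auto simp: op_single J_def)
      define r where "r = (\<lambda>a. \<Sum>g\<in>keys q. lookup q g * l g a)"
      have "(\<Sum>a\<in>A. r a *s mon a u) = (\<Sum>g\<in>keys q. lookup q g *s (\<Sum>a\<in>A. l g a *s mon a u))"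
        unfolding r_def scale_sum_left scale_sum_right by (subst sum.swap) simp
      then have "mon b (mon e u) - (\<Sum>a\<in>A. r a *s mon a u) =
          (\<Sum>g\<in>keys q. lookup q g *s (mon g u - (\<Sum>a\<in>A. l g a *s mon a u)))"
        unfolding q(2) op_def scale_right_diff_distrib sum_subtractf by simp
      also have "\<dots> \<in> W"
        using q(1) by (intro subspace_sum[OF sub] subspace_scale[OF sub] A(3)) (auto simp: polys_le_def)
      finally show ?thesis by blast
    qed
    then obtain r where r: "\<And>b e. b \<in> B \<Longrightarrow> e \<in> E \<Longrightarrow> mon b (mon e u) - (\<Sum>a\<in>A. r b e a *s mon a u) \<in> W"
      by metis
    \<comment> \<open>unknowns are the coefficients of the monomials in \<open>B\<close>, equations the entries of the matrix\<close>
    from homogeneous_system[OF _ finB less, of "\<lambda>(e, a) b. r b e a"] fin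
    obtain c where c: "\<exists>b\<in>B. c b \<noteq> 0" "\<And>e a. e \<in> E \<Longrightarrow> a \<in> A \<Longrightarrow> (\<Sum>b\<in>B. c b * r b e a) = 0" by auto
    define p where "p = (\<Sum>b\<in>B. single b (c b))"
    have lookup_p: "lookup p b = c b" if "b \<in> B" for b
      using that finB by (simp add: p_def lookup_sum lookup_single when_def)
    with c(1) have "p \<noteq> 0" by fastforce
    have p: "p \<in> polys_le (symvars I) d"
      using B(1) unfolding p_def by (intro polys_le_sum polys_le_single) (auto simp: J_def)
    have pe: "op p (mon e u) \<in> W" if e: "e \<in> E" for e
    proof -
      have "(\<Sum>b\<in>B. c b *s (\<Sum>a\<in>A. r b e a *s mon a u)) = (\<Sum>b\<in>B. \<Sum>a\<in>A. (c b * r b e a) *s mon a u)"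
        by (simp add: scale_sum_right)
      also have "\<dots> = (\<Sum>a\<in>A. (\<Sum>b\<in>B. c b * r b e a) *s mon a u)"
        by (subst sum.swap) (simp add: scale_sum_left)
      also have "\<dots> = 0" using c(2)[OF e] by simp
      finally have "op p (mon e u) = (\<Sum>b\<in>B. c b *s (mon b (mon e u) - (\<Sum>a\<in>A. r b e a *s mon a u)))"
        by (simp add: p_def op_mon_sum scale_right_diff_distrib sum_subtractf)
      also have "\<dots> \<in> W" by (intro subspace_sum[OF sub] subspace_scale[OF sub] r e)
      finally show ?thesis .
    qed
    have "u \<in> W"
    proof (rule op_annihilates[OF I W p \<open>p \<noteq> 0\<close>])
      fix g assume "g \<in> exps_le (symvars I) d"
      then have "mon g u - (\<Sum>e\<in>E. k g e *s mon e u) \<in> W" using E(3) by (simp add: J_def)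
      then have "op p (mon g u - (\<Sum>e\<in>E. k g e *s mon e u)) \<in> W" by (rule op_stable[OF W p])
      then have "op p (mon g u) - (\<Sum>e\<in>E. k g e *s op p (mon e u)) \<in> W"
        by (simp add: op_vdiff op_vsum op_vscale)
      moreover have "(\<Sum>e\<in>E. k g e *s op p (mon e u)) \<in> W"
        by (intro subspace_sum[OF sub] subspace_scale[OF sub] pe)
      ultimately show "op p (mon g u) \<in> W" using subspace_add[OF sub] by fastforce
    qed
    with u show False ..
  qed
  then show ?thesis using that A(1,2) unfolding dd J_def by blast
qed

end

section \<open>Growth of filtered modules\<close>

context weyl_action
begin

text \<open>The preimage of \<open>D\<^sub>i (V / U)\<close> in \<open>V\<close>.\<close>

definition add_image :: "nat \<Rightarrow> 'b set \<Rightarrow> 'b set" where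
  "add_image i U = {u + D i v |u v. u \<in> U \<and> v \<in> V}"

lemma add_imageI: "u \<in> U \<Longrightarrow> v \<in> V \<Longrightarrow> u + D i v \<in> add_image i U"
  by (auto simp: add_image_def)

lemma subspace_add_image:
  assumes sub: "subspace U"
  shows "subspace (add_image i U)"
proof (rule subspaceI)
  show "0 \<in> add_image i U" using add_imageI[OF subspace_0[OF sub] subspace_0[OF V]] by simp
  fix x assume "x \<in> add_image i U"
  then obtain u v where x: "u \<in> U" "v \<in> V" "x = u + D i v" by (auto simp: add_image_def)
  show "c *s x \<in> add_image i U" for c
    using add_imageI[OF subspace_scale[OF sub x(1)] subspace_scale[OF V x(2)]]
    by (simp add: x(3) scale_right_distrib D_scale)
  fix y assume "y \<in> add_image i U"
  then obtain u' v' where y: "u' \<in> U" "v' \<in> V" "y = u' + D i v'" by (auto simp: add_image_def)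
  show "x + y \<in> add_image i U"
    using add_imageI[OF subspace_add[OF sub x(1) y(1)] subspace_add[OF V x(2) y(2)], of i]
    by (simp add: x(3) y(3) D_add algebra_simps)
qed

lemma stable_add_image:
  assumes J: "J \<subseteq> {1..n}" "i \<notin> J" and U: "stable J U"
  shows "stable J (add_image i U)"
  unfolding stable_def
proof (intro conjI ballI subspace_add_image[OF stableD(1)[OF U]])
  fix j w assume j: "j \<in> J" and "w \<in> add_image i U"
  then obtain u v where w: "u \<in> U" "v \<in> V" "w = u + D i v" by (auto simp: add_image_def)
  have j': "j \<in> {1..n}" "i \<noteq> j" using j J by auto
  show "X j w \<in> add_image i U"
    using add_imageI[OF stableD(2)[OF U j w(1)] X_closed[OF j'(1) w(2)], of i] j'(2)
    by (simp add: w(3) X_add X_D)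
  show "D j w \<in> add_image i U"
    using add_imageI[OF stableD(3)[OF U j w(1)] D_closed[OF j'(1) w(2)], of i]
    by (simp add: w(3) D_add D_D[of i j])
qed

end

text \<open>An exhaustive filtration of \<open>V\<close> on which the generators have degree one.\<close>

locale filtered_weyl_action = weyl_action scale n V X D
  for scale :: "'a::field_char_0 \<Rightarrow> 'b::ab_group_add \<Rightarrow> 'b" (infixr \<open>*s\<close> 75) and n V X D +
  fixes F :: "nat \<Rightarrow> 'b set"
  assumes F_UN: "V = (\<Union>j. F j)"
    and F_Suc: "F j \<subseteq> F (Suc j)"
    and F_X: "i \<in> {1..n} \<Longrightarrow> v \<in> F j \<Longrightarrow> X i v \<in> F (Suc j)"
    and F_D: "i \<in> {1..n} \<Longrightarrow> v \<in> F j \<Longrightarrow> D i v \<in> F (Suc j)"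
begin

lemma F_mono: "i \<le> j \<Longrightarrow> F i \<subseteq> F j"
  using lift_Suc_mono_le[of F i j] F_Suc by blast

lemma F_V: "v \<in> F j \<Longrightarrow> v \<in> V"
  using F_UN by blast

lemma D_pow_closed: "i \<in> {1..n} \<Longrightarrow> v \<in> V \<Longrightarrow> (D i ^^ a) v \<in> V"
  by (induction a) (auto intro: D_closed)

lemma X_pow_closed: "i \<in> {1..n} \<Longrightarrow> v \<in> V \<Longrightarrow> (X i ^^ a) v \<in> V"
  by (induction a) (auto intro: X_closed)

lemma F_D_pow: "i \<in> {1..n} \<Longrightarrow> v \<in> F j \<Longrightarrow> (D i ^^ a) v \<in> F (j + a)"
  by (induction a) (auto intro: F_D)

lemma F_mon:
  assumes I: "I \<subseteq> {1..n}"
  shows "keys g \<subseteq> symvars I \<Longrightarrow> v \<in> F j \<Longrightarrow> mon g v \<in> F (j + tdeg g)"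
proof (induction "tdeg g" arbitrary: g j v)
  case 0
  then show ?case by (auto simp: tdeg_eq_0_iff)
next
  case (Suc d)
  then have "g \<noteq> 0" by (metis tdeg_0 nat.distinct(1))
  with I Suc.prems(1) show ?case
  proof (cases rule: mon_cases)
    case (X i h)
    then have "mon h v \<in> F (j + tdeg h)" using Suc by auto
    then show ?thesis using X I F_X by auto
  next
    case (D i h)
    with I have "i \<in> {1..n}" by blast
    then have "D i v \<in> F (Suc j)" using Suc.prems(2) by (rule F_D)
    with Suc.hyps D have "mon h (D i v) \<in> F (Suc j + tdeg h)" by (metis Suc_inject)
    then show ?thesis using D by simp
  qed
qed

text \<open>For some \<open>c\<close> and all \<open>j\<close>, the dimension of the image of \<open>F\<^sub>j\<close> in the quotient by \<open>U\<close> is at most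
  \<open>c (j + 1)\<^sup>m\<close>. By \<open>growthE\<close>, it is no restriction that families are indexed by natural numbers.\<close>

definition growth :: "'b set \<Rightarrow> nat \<Rightarrow> bool" where
  "growth U m \<longleftrightarrow> (\<exists>c. \<forall>j A. \<forall>f :: nat \<Rightarrow> 'b.
     indep_mod U A f \<and> f ` A \<subseteq> F j \<longrightarrow> card A \<le> c * (j + 1) ^ m)"

lemma growthE:
  assumes "growth U m"
  obtains c where "\<And>j A (f :: 'i \<Rightarrow> 'b). indep_mod U A f \<Longrightarrow> f ` A \<subseteq> F j \<Longrightarrow> card A \<le> c * (j + 1) ^ m"
proof -
  from assms obtain c where c: "\<And>j A (f :: nat \<Rightarrow> 'b). indep_mod U A f \<Longrightarrow> f ` A \<subseteq> F j \<Longrightarrow> card A \<le> c * (j + 1) ^ m"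
    unfolding growth_def by blast
  have "card A \<le> c * (j + 1) ^ m" if A: "indep_mod U A f" "f ` A \<subseteq> F j" for j A and f :: "'i \<Rightarrow> 'b"
  proof -
    obtain \<pi> where \<pi>: "bij_betw \<pi> {0..<card A} A"
      using ex_bij_betw_nat_finite indep_mod_finite[OF A(1)] by blast
    have "(f \<circ> \<pi>) ` {0..<card A} \<subseteq> F j"
      using \<pi> A(2) by (auto simp: bij_betw_def)
    from c[OF indep_mod_reindex[OF A(1) \<pi>] this] show ?thesis by simp
  qed
  then show ?thesis using that by blast
qed

text \<open>Let \<open>U\<close> be stable under \<open>X\<^sub>i\<close> and \<open>D\<^sub>i\<close>. An element \<open>w\<close> with \<open>D\<^sub>i\<^sup>s w\<close> in \<open>U\<close> is congruent modulo \<open>U\<close> to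
  \<open>D\<^sub>i (\<Sum>\<^bsub>a<s\<^esub> (-1)\<^sup>a X\<^sub>i\<^bsup>a+1\<^esup> D\<^sub>i\<^sup>a w / (a + 1)!)\<close>, by a telescoping sum.\<close>

lemma D_pow_in_imp_in_image:
  assumes i: "i \<in> {1..n}" and U: "stable {i} U" and w: "w \<in> V" and s: "(D i ^^ s) w \<in> U"
  obtains u v where "u \<in> U" "v \<in> V" "w = u + D i v"
proof -
  define h where "h a = ((- 1) ^ a / fact a) *s (X i ^^ a) ((D i ^^ a) w)" for a :: nat
  define g where "g a = ((- 1) ^ a / fact (Suc a)) *s (X i ^^ Suc a) ((D i ^^ a) w)" for a :: nat
  have Dg: "D i (g a) = h a - h (Suc a)" for a
  proof -
    have f: "(- 1) ^ a / fact (Suc a) * of_nat (Suc a) = (- 1) ^ a / (fact a :: 'a)"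
      by (simp add: field_simps del: of_nat_Suc)
    have "D i (g a) = ((- 1) ^ a / fact (Suc a)) *s ((X i ^^ Suc a) (D i ((D i ^^ a) w)) +
        of_nat (Suc a) *s (X i ^^ a) ((D i ^^ a) w))"
      unfolding g_def D_scale D_X_pow by simp
    also have "\<dots> = ((- 1) ^ a / fact (Suc a)) *s (X i ^^ Suc a) ((D i ^^ Suc a) w) + h a"
      unfolding scale_right_distrib scale_scale f h_def by simp
    finally show ?thesis by (simp add: h_def)
  qed
  have tele: "D i (\<Sum>a<s. g a) = w - h s"
    unfolding D_sum Dg sum_lessThan_telescope' by (simp add: h_def)
  have "(X i ^^ a) v \<in> U" if "v \<in> U" for v a
    using that by (induction a) (auto intro: stableD[OF U])
  then have "h s \<in> U" unfolding h_def using s by (intro subspace_scale[OF stableD(1)[OF U]])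
  moreover have "(\<Sum>a<s. g a) \<in> V" unfolding g_def
    by (intro subspace_sum[OF V] subspace_scale[OF V] X_pow_closed D_pow_closed i w)
  moreover have "w = h s + D i (\<Sum>a<s. g a)" unfolding tele by simp
  ultimately show ?thesis using that by blast
qed

text \<open>A family \<open>f\<close> in \<open>F\<^sub>j\<close> that is independent modulo \<open>U + D\<^sub>i V\<close> yields a family \<open>D\<^sub>i\<^sup>t f\<^sub>a\<close>, \<open>t \<le> j\<close>, in \<open>F\<^bsub>2j\<^esub>\<close>
  that is independent modulo \<open>U\<close> and \<open>j + 1\<close> times as large.\<close>

lemma growth_image:
  assumes i: "i \<in> {1..n}" and U: "stable {i} U" and UV: "U \<subseteq> V" and gr: "growth U (Suc m)"
  shows "growth (add_image i U) m"
proof -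
  note sub = stableD(1)[OF U]
  obtain c where c: "\<And>j A (f :: nat \<times> nat \<Rightarrow> 'b). indep_mod U A f \<Longrightarrow> f ` A \<subseteq> F j \<Longrightarrow> card A \<le> c * (j + 1) ^ Suc m"
    using growthE[OF gr] by blast
  have "card A \<le> (c * 2 ^ Suc m) * (j + 1) ^ m" if A: "indep_mod (add_image i U) A f" "f ` A \<subseteq> F j" for j A and f :: "nat \<Rightarrow> 'b"
  proof -
    have fin: "finite A" using A(1) by (rule indep_mod_finite)
    have fV: "f a \<in> V" if "a \<in> A" for a using A(2) that F_V by blast
    define h where "h = (\<lambda>(t, a). (D i ^^ t) (f a))"
    have ind: "indep_mod U ({..j} \<times> A) h"
      unfolding indep_mod_def
    proof (intro conjI allI impI)
      show "finite ({..j} \<times> A)" using fin by simp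
      fix r assume "(\<Sum>x\<in>{..j} \<times> A. r x *s h x) \<in> U"
      define w where "w t = (\<Sum>a\<in>A. r (t, a) *s f a)" for t
      have D_pow_sum: "(D i ^^ t) (sum g S) = (\<Sum>s\<in>S. (D i ^^ t) (g s))" for t S and g :: "nat \<Rightarrow> 'b"
        by (induction S rule: infinite_finite_induct) (simp_all add: D_pow_add)
      have wV: "w t \<in> V" for t unfolding w_def by (intro subspace_sum[OF V] subspace_scale[OF V] fV)
      have "(\<Sum>x\<in>{..j} \<times> A. r x *s h x) = (\<Sum>t\<le>j. \<Sum>a\<in>A. r (t, a) *s (D i ^^ t) (f a))"
        by (simp add: sum.cartesian_product h_def split_def)
      also have "\<dots> = (\<Sum>t\<le>j. (D i ^^ t) (w t))"
        by (simp add: w_def D_pow_sum D_pow_scale)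
      finally have inU: "(\<Sum>t\<le>j. (D i ^^ t) (w t)) \<in> U" using \<open>_ \<in> U\<close> by simp
      \<comment> \<open>after the coefficients below \<open>t\<close> have vanished, the sum is \<open>D\<^sub>i\<^sup>t\<close> of an element congruent to \<open>w t\<close>
        modulo the image of \<open>D\<^sub>i\<close>\<close>
      have "t \<le> j \<Longrightarrow> \<forall>a\<in>A. r (t, a) = 0" for t
      proof (induction t rule: less_induct)
        case (less t)
        have w0: "w s = 0" if "s < t" for s using less.IH[OF that] less.prems that by (simp add: w_def)
        define y where "y = (\<Sum>s\<in>{t<..j}. (D i ^^ (s - Suc t)) (w s))"
        have yV: "y \<in> V" unfolding y_def by (intro subspace_sum[OF V] D_pow_closed i wV)
        have "(\<Sum>s\<le>j. (D i ^^ s) (w s)) = (\<Sum>s\<in>{t..j}. (D i ^^ s) (w s))"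
          using w0 by (intro sum.mono_neutral_right) auto
        also have "\<dots> = (\<Sum>s\<in>{t..j}. (D i ^^ t) ((D i ^^ (s - t)) (w s)))"
          by (intro sum.cong refl) (simp add: funpow_add[symmetric, THEN fun_cong, unfolded comp_def])
        also have "\<dots> = (D i ^^ t) (\<Sum>s\<in>{t..j}. (D i ^^ (s - t)) (w s))" by (simp add: D_pow_sum)
        also have "(\<Sum>s\<in>{t..j}. (D i ^^ (s - t)) (w s)) = w t + (\<Sum>s\<in>{t<..j}. (D i ^^ (s - t)) (w s))"
          using less.prems by (simp add: sum.head)
        also have "(\<Sum>s\<in>{t<..j}. (D i ^^ (s - t)) (w s)) = D i y"
          unfolding y_def D_sum
        proof (intro sum.cong refl)
          fix s assume "s \<in> {t<..j}"
          then have "s - t = Suc (s - Suc t)" by auto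
          then show "(D i ^^ (s - t)) (w s) = D i ((D i ^^ (s - Suc t)) (w s))" by simp
        qed
        finally have "(D i ^^ t) (w t + D i y) \<in> U" using inU by simp
        moreover have "w t + D i y \<in> V" by (intro subspace_add[OF V] wV D_closed[OF i yV])
        ultimately obtain u v where uv: "u \<in> U" "v \<in> V" "w t + D i y = u + D i v"
          using D_pow_in_imp_in_image[OF i U] by blast
        have "w t = u + D i (v - y)" using uv(3) D_add[of i "v - y" y] by (simp add: algebra_simps)
        then have "w t \<in> add_image i U" using uv subspace_diff[OF V _ yV] by (auto intro: add_imageI)
        then show ?case using indep_modD[OF A(1), of "\<lambda>a. r (t, a)"] unfolding w_def by blast
      qed
      then show "\<forall>x\<in>{..j} \<times> A. r x = 0" by auto
    qed
    have "h ` ({..j} \<times> A) \<subseteq> F (2 * j)"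
    proof
      fix x assume "x \<in> h ` ({..j} \<times> A)"
      then obtain t a where ta: "t \<le> j" "a \<in> A" "x = (D i ^^ t) (f a)" by (auto simp: h_def)
      then have "x \<in> F (j + t)" using A(2) F_D_pow[OF i] by auto
      then show "x \<in> F (2 * j)" using F_mono[of "j + t" "2 * j"] ta by auto
    qed
    from c[OF ind this] have "(j + 1) * card A \<le> c * (2 * j + 1) ^ Suc m"
      by (simp add: card_cartesian_product)
    also have "\<dots> \<le> c * (2 * (j + 1)) ^ Suc m" by (intro mult_le_mono power_mono) auto
    also have "\<dots> = (j + 1) * ((c * 2 ^ Suc m) * (j + 1) ^ m)" unfolding power_mult_distrib by (simp add: algebra_simps)
    finally show ?thesis unfolding mult_le_cancel1 by simp
  qed
  then show ?thesis unfolding growth_def by blast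
qed

text \<open>The submodule over the Weyl algebra in the variables \<open>I\<close> that is generated by \<open>G\<close> and \<open>U\<close>.\<close>

definition generated :: "nat set \<Rightarrow> 'b set \<Rightarrow> 'b set \<Rightarrow> 'b set" where
  "generated I U G = span (U \<union> {mon g x |g x. keys g \<subseteq> symvars I \<and> x \<in> G})"

lemma generated_mono: "G \<subseteq> H \<Longrightarrow> generated I U G \<subseteq> generated I U H"
  unfolding generated_def by (intro span_mono) blast

lemma generated_base: "U \<subseteq> generated I U G"
  unfolding generated_def using span_superset by blast

lemma generated_mon: "x \<in> G \<Longrightarrow> keys g \<subseteq> symvars I \<Longrightarrow> mon g x \<in> generated I U G"
  unfolding generated_def by (intro span_base) blast

lemma generated_self: "x \<in> G \<Longrightarrow> x \<in> generated I U G"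
  using generated_mon[of x G 0] by simp

lemma stable_generated:
  assumes I: "I \<subseteq> {1..n}" and U: "stable I U"
  shows "stable I (generated I U G)"
  unfolding stable_def
proof (intro conjI ballI)
  show sub: "subspace (generated I U G)" unfolding generated_def by (rule subspace_span)
  fix i w assume i: "i \<in> I" and w: "w \<in> generated I U G"
  have i': "i \<in> {1..n}" using i I by blast
  have gens: "X i v \<in> generated I U G \<and> D i v \<in> generated I U G"
    if v: "v \<in> U \<union> {mon g x |g x. keys g \<subseteq> symvars I \<and> x \<in> G}" for v
    using v
  proof
    assume "v \<in> U"
    then show ?thesis using stableD(2,3)[OF U i] generated_base by blast
  next
    assume "v \<in> {mon g x |g x. keys g \<subseteq> symvars I \<and> x \<in> G}"
    then obtain g x where v: "v = mon g x" "keys g \<subseteq> symvars I" "x \<in> G" by blast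
    have k: "keys (g + single k 1) \<subseteq> symvars I" if "k \<in> symvars I" for k
      using v(2) that by (auto simp: keys_add_nat)
    have k': "keys (g - single k 1) \<subseteq> symvars I" for k
      by (rule order.trans[OF keys_diff_single v(2)])
    show ?thesis
      unfolding v(1) X_mon_upto[OF i'] D_mon_upto[OF i']
      by (rule conjI[OF generated_mon[OF v(3) k[OF symvars_I(1)[OF i]]]
            subspace_add[OF sub generated_mon[OF v(3) k[OF symvars_I(2)[OF i]]]
              subspace_scale[OF sub generated_mon[OF v(3) k']]]])
  qed
  show "X i w \<in> generated I U G"
    by (rule span_linear_subset[OF X_add X_scale sub _ w[unfolded generated_def]]) (use gens in blast)
  show "D i w \<in> generated I U G"
    by (rule span_linear_subset[OF D_add D_scale sub _ w[unfolded generated_def]]) (use gens in blast)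
qed

lemma generated_subset_V:
  assumes I: "I \<subseteq> {1..n}" and "U \<subseteq> V" "G \<subseteq> V"
  shows "generated I U G \<subseteq> V"
  unfolding generated_def using assms mon_stable[OF stable_V[OF I]] by (intro span_minimal V) auto

text \<open>A module over the Weyl algebra in \<open>m\<close> variables with a filtration of growth \<open>j\<^sup>m\<close> is finitely
  generated: in a strictly ascending chain of \<open>r\<close> submodules, each generated by one more element of
  \<open>F\<^sub>s\<close> than the one before, each step contributes at least \<open>(t + 1)\<^sup>m\<close> to the dimension of the image of
  \<open>F\<^bsub>s+4mt\<^esub>\<close>. The choice \<open>t = s\<close> bounds \<open>r\<close> by a constant that does not depend on \<open>s\<close>.\<close>

lemma finitely_generated_if_growth:
  assumes I: "I \<subseteq> {1..n}" and U: "stable I U" and UV: "U \<subseteq> V" and gr: "growth U (card I)"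
  obtains G where "finite G" "G \<subseteq> V" "generated I U G = V"
proof -
  define m where "m = card I"
  have finI: "finite I" using I finite_subset by blast
  note sub = stableD(1)[OF U]
  have "\<exists>G. finite G \<and> G \<subseteq> V \<and> V \<subseteq> generated I U G"
  proof (rule ccontr)
    assume no: "\<not> ?thesis"
    define big where "big r G s \<longleftrightarrow> (\<forall>t. \<exists>A. \<exists>f :: nat \<times> (nat \<Rightarrow>\<^sub>0 nat) \<Rightarrow> 'b. indep_mod U A f \<and>
        f ` A \<subseteq> F (s + 4 * m * t) \<inter> generated I U G \<and> A \<subseteq> {..<r} \<times> UNIV \<and> r * (t + 1) ^ m \<le> card A)" for r G s
    have chain: "\<exists>G s. finite G \<and> G \<subseteq> V \<and> big r G s" for r
    proof (induction r)
      case 0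
      have "indep_mod U {} f" for f :: "nat \<times> (nat \<Rightarrow>\<^sub>0 nat) \<Rightarrow> 'b" by (simp add: indep_mod_def)
      then show ?case by (intro exI[of _ "{}"] exI[of _ 0]) (auto simp: big_def)
    next
      case (Suc r)
      then obtain G s where G: "finite G" "G \<subseteq> V" and big: "big r G s" by blast
      define W where "W = generated I U G"
      have W: "stable I W" unfolding W_def by (rule stable_generated[OF I U])
      from no G obtain u where u: "u \<in> V" "u \<notin> W" by (auto simp: W_def)
      then obtain s' where s': "u \<in> F s'" using F_UN by blast
      let ?s = "max s s'" and ?G = "insert u G"
      have "big (Suc r) ?G ?s"
        unfolding big_def
      proof
        fix t
        from big obtain A and f :: "nat \<times> (nat \<Rightarrow>\<^sub>0 nat) \<Rightarrow> 'b" where A: "indep_mod U A f"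
          "f ` A \<subseteq> F (s + 4 * m * t) \<inter> W" "A \<subseteq> {..<r} \<times> UNIV" "r * (t + 1) ^ m \<le> card A"
          unfolding big_def W_def by blast
        obtain B where B: "B \<subseteq> exps_le (symvars I) (4 * card I * t)" "indep_mod W B (\<lambda>g. mon g u)"
            "(t + 1) ^ card I \<le> card B"
          by (rule bernstein_lower_bound[OF I W u(2)])
        let ?B = "{r} \<times> B"
        define h where "h x = (if fst x = r then mon (snd x) u else f x)" for x
        have hA: "h x = f x" if "x \<in> A" for x using A(3) that by (auto simp: h_def)
        have fin: "finite A" "finite B" using A(1) B(2) indep_mod_finite by auto
        have "indep_mod W ?B ((\<lambda>g. mon g u) \<circ> snd)"
          by (rule indep_mod_reindex[OF B(2)]) (auto simp: bij_betw_def inj_on_def)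
        then have hB: "indep_mod W ?B h"
          by (rule indep_mod_cong[THEN iffD1, rotated -1]) (auto simp: h_def)
        have hA': "indep_mod U A h" using A(1) indep_mod_cong[of A A h f] hA by blast
        have disj: "A \<inter> ?B = {}" using A(3) by auto
        have "indep_mod U (A \<union> ?B) h"
          by (rule indep_mod_Un[OF sub stableD(1)[OF W] _ hA' _ hB disj])
            (use A(2) hA generated_base in \<open>auto simp: W_def\<close>)
        moreover have "h ` (A \<union> ?B) \<subseteq> F (?s + 4 * m * t) \<inter> generated I U ?G"
        proof
          fix x assume "x \<in> h ` (A \<union> ?B)"
          then obtain y where y: "y \<in> A \<union> ?B" "x = h y" by blast
          have "snd y \<in> B \<and> h y = mon (snd y) u" if "y \<in> ?B" using that by (auto simp: h_def)
          with y hA consider a where "a \<in> A" "x = f a" | b where "b \<in> B" "x = mon b u" by blast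
          then show "x \<in> F (?s + 4 * m * t) \<inter> generated I U ?G"
          proof cases
            case 1
            then have "x \<in> F (s + 4 * m * t)" "x \<in> W" using A(2) by auto
            moreover have "W \<subseteq> generated I U ?G" unfolding W_def by (rule generated_mono) auto
            ultimately show ?thesis using F_mono[of "s + 4 * m * t" "?s + 4 * m * t"] by auto
          next
            case 2
            then have b: "keys b \<subseteq> symvars I" "tdeg b \<le> 4 * m * t"
              using B(1) by (auto simp: exps_le_def m_def)
            have "x \<in> F (s' + tdeg b)" using F_mon[OF I b(1) s'] 2 by simp
            moreover have "x \<in> generated I U ?G" using 2 b by (auto intro: generated_mon)
            moreover have "s' + tdeg b \<le> ?s + 4 * m * t" by (intro add_mono b) simp
            ultimately show ?thesis using F_mono by blast
          qed
        qed
        moreover have "A \<union> ?B \<subseteq> {..<Suc r} \<times> UNIV" using A(3) by auto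
        moreover have "Suc r * (t + 1) ^ m \<le> card (A \<union> ?B)"
          using A(4) B(3) by (subst card_Un_disjoint[OF _ _ disj])
            (simp_all add: fin card_cartesian_product m_def)
        ultimately show "\<exists>A. \<exists>f :: nat \<times> (nat \<Rightarrow>\<^sub>0 nat) \<Rightarrow> 'b. indep_mod U A f \<and>
            f ` A \<subseteq> F (?s + 4 * m * t) \<inter> generated I U ?G \<and> A \<subseteq> {..<Suc r} \<times> UNIV \<and> Suc r * (t + 1) ^ m \<le> card A"
          by blast
      qed
      then show ?case using G u by (intro exI[of _ ?G] exI[of _ ?s]) auto
    qed
    obtain c where c: "\<And>j A (f :: nat \<times> (nat \<Rightarrow>\<^sub>0 nat) \<Rightarrow> 'b). indep_mod U A f \<Longrightarrow> f ` A \<subseteq> F j \<Longrightarrow> card A \<le> c * (j + 1) ^ m"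
      using growthE[OF gr] unfolding m_def by blast
    define r where "r = Suc (c * (4 * m + 1) ^ m)"
    from chain[of r] obtain G s where "big r G s" by blast
    from this[unfolded big_def, THEN spec[of _ s]] obtain A and f :: "nat \<times> (nat \<Rightarrow>\<^sub>0 nat) \<Rightarrow> 'b" where A: "indep_mod U A f"
        "f ` A \<subseteq> F (s + 4 * m * s)" "r * (s + 1) ^ m \<le> card A" by blast
    have "r * (s + 1) ^ m \<le> c * (s + 4 * m * s + 1) ^ m" using c[OF A(1,2)] A(3) by simp
    also have "\<dots> \<le> c * ((4 * m + 1) * (s + 1)) ^ m"
      by (intro mult_le_mono power_mono) (auto simp: algebra_simps)
    also have "\<dots> = c * (4 * m + 1) ^ m * (s + 1) ^ m" by (simp only: power_mult_distrib mult.assoc)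
    finally have "r \<le> c * (4 * m + 1) ^ m" by simp
    then show False by (simp add: r_def)
  qed
  then show ?thesis using that generated_subset_V[OF I UV] by blast
qed

end

section \<open>Hilbert functions\<close>

text \<open>Functions that agree with a polynomial for all large arguments.\<close>

definition eventually_poly :: "(nat \<Rightarrow> rat) \<Rightarrow> bool" where
  "eventually_poly h \<longleftrightarrow> (\<exists>p. \<forall>\<^sub>F j in sequentially. h j = poly p (of_nat j))"

lemma eventually_poly_const: "eventually_poly (\<lambda>_. c)"
  unfolding eventually_poly_def by (intro exI[of _ "[:c:]"]) simp

lemma eventually_poly_add:
  assumes "eventually_poly g" "eventually_poly h"
  shows "eventually_poly (\<lambda>j. g j + h j)"
proof -
  from assms obtain p q where "\<forall>\<^sub>F j in sequentially. g j = poly p (of_nat j)"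
    "\<forall>\<^sub>F j in sequentially. h j = poly q (of_nat j)" by (auto simp: eventually_poly_def)
  then have "\<forall>\<^sub>F j in sequentially. g j + h j = poly (p + q) (of_nat j)"
    by eventually_elim simp
  then show ?thesis unfolding eventually_poly_def by blast
qed

lemma eventually_poly_sum:
  "(\<And>a. a \<in> S \<Longrightarrow> eventually_poly (h a)) \<Longrightarrow> eventually_poly (\<lambda>j. \<Sum>a\<in>S. h a j)"
  by (induction S rule: infinite_finite_induct) (simp_all add: eventually_poly_const eventually_poly_add)

lemma eventually_poly_cong:
  assumes "\<forall>\<^sub>F j in sequentially. g j = h j" "eventually_poly g"
  shows "eventually_poly h"
proof -
  from assms(2) obtain p where "\<forall>\<^sub>F j in sequentially. g j = poly p (of_nat j)"
    by (auto simp: eventually_poly_def)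
  with assms(1) have "\<forall>\<^sub>F j in sequentially. h j = poly p (of_nat j)" by eventually_elim simp
  then show ?thesis unfolding eventually_poly_def by blast
qed

lemma eventually_poly_shift:
  assumes "eventually_poly h"
  shows "eventually_poly (\<lambda>j. h (j - a))"
proof -
  from assms obtain p where "\<forall>\<^sub>F j in sequentially. h j = poly p (of_nat j)"
    by (auto simp: eventually_poly_def)
  then obtain N where N: "\<And>j. j \<ge> N \<Longrightarrow> h j = poly p (of_nat j)" by (auto simp: eventually_sequentially)
  have "h (j - a) = poly (pcompose p [:- of_nat a, 1:]) (of_nat j)" if "j \<ge> N + a" for j
    using N[of "j - a"] that by (simp add: poly_pcompose of_nat_diff)
  then show ?thesis unfolding eventually_poly_def eventually_sequentially by blast
qed

text \<open>By induction on a bound for the degree: the leading term \<open>a x\<^sup>d\<close> is removed by a multiple of the difference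
  \<open>(x + 1)\<^bsup>d+1\<^esup> - x\<^bsup>d+1\<^esup>\<close>.\<close>

lemma poly_antidifference:
  fixes p :: "rat poly"
  shows "\<exists>q. \<forall>x. poly q (x + 1) - poly q x = poly p x"
proof -
  have "\<forall>k\<ge>d. Polynomial.coeff p k = 0 \<Longrightarrow> \<exists>q. \<forall>x. poly q (x + 1) - poly q x = poly p x" for d and p :: "rat poly"
  proof (induction d arbitrary: p)
    case 0
    then have "p = 0" by (simp add: poly_eq_iff)
    then show ?case by (intro exI[of _ 0]) simp
  next
    case (Suc d)
    define m :: "rat poly" where "m = [:0, 1:] ^ Suc d"
    define s :: "rat poly" where "s = [:1, 1:] ^ Suc d"
    define a where "a = Polynomial.coeff p d / of_nat (Suc d)"
    define p' where "p' = p - Polynomial.smult a (s - m)"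
    have m: "Polynomial.coeff m k = of_nat (Suc d choose k) * 0 ^ (Suc d - k)" if "k \<le> Suc d" for k
      unfolding m_def using that by (subst coeff_linear_poly_power) simp_all
    have s: "Polynomial.coeff s k = of_nat (Suc d choose k)" if "k \<le> Suc d" for k
      unfolding s_def using that by (subst coeff_linear_poly_power) simp_all
    have ms: "Polynomial.coeff m k = 0" "Polynomial.coeff s k = 0" if "k > Suc d" for k
      using that by (simp_all only: m_def s_def coeff_eq_0 degree_linear_power)
    have "Polynomial.coeff p' k = 0" if "k \<ge> d" for k
    proof -
      consider "k = d" | "k = Suc d" | "k > Suc d" using \<open>k \<ge> d\<close> by linarith
      then show ?thesis
      proof cases
        case 1
        then show ?thesis by (simp add: p'_def m s a_def del: of_nat_Suc)
      qed (use Suc.prems in \<open>simp_all add: p'_def m s ms\<close>)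
    qed
    with Suc.IH[of p'] obtain q where q: "\<And>x. poly q (x + 1) - poly q x = poly p' x" by blast
    have "poly (q + Polynomial.smult a m) (x + 1) - poly (q + Polynomial.smult a m) x = poly p x" for x
      using q[of x] by (simp add: p'_def m_def s_def algebra_simps)
    then show ?case by blast
  qed
  from this[of "Suc (Polynomial.degree p)" p] show ?thesis by (auto simp: coeff_eq_0)
qed

lemma eventually_poly_partial_sum:
  assumes "eventually_poly h"
  shows "eventually_poly (\<lambda>j. \<Sum>i\<le>j. h i)"
proof -
  from assms obtain p where "\<forall>\<^sub>F j in sequentially. h j = poly p (of_nat j)"
    by (auto simp: eventually_poly_def)
  then obtain N where N: "\<And>j. j \<ge> N \<Longrightarrow> h j = poly p (of_nat j)" by (auto simp: eventually_sequentially)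
  obtain q where q: "\<And>x. poly q (x + 1) - poly q x = poly p x" using poly_antidifference[of p] by blast
  define r where "r = pcompose q [:1, 1:]"
  have r: "poly r x = poly q (x + 1)" for x by (simp add: r_def poly_pcompose add.commute)
  define b where "b = (\<Sum>i\<le>N. h i) - poly r (of_nat N)"
  have "(\<Sum>i\<le>j. h i) = poly (r + [:b:]) (of_nat j)" if "j \<ge> N" for j
    using that
  proof (induction rule: dec_induct)
    case (step j)
    have "h (Suc j) = poly r (of_nat (Suc j)) - poly r (of_nat j)"
      using N[of "Suc j"] step q[of "of_nat (Suc j)"] by (simp add: r algebra_simps)
    with step show ?case by simp
  qed (simp add: b_def)
  then show ?thesis unfolding eventually_poly_def eventually_sequentially by blast
qed

lemma nat_seq_mono_subseq:
  fixes f :: "nat \<Rightarrow> nat"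
  obtains r :: "nat \<Rightarrow> nat" where "strict_mono r" "mono (f \<circ> r)"
proof -
  obtain r where r: "strict_mono r" "monoseq (\<lambda>n. f (r n))" using seq_monosub[of f] by blast
  from r(2) consider "\<forall>m n. m \<le> n \<longrightarrow> f (r m) \<le> f (r n)" | "\<forall>m n. m \<le> n \<longrightarrow> f (r n) \<le> f (r m)"
    by (auto simp: monoseq_def)
  then show ?thesis
  proof cases
    case 1
    then show ?thesis using r by (intro that[of r]) (auto simp: mono_def)
  next
    case 2
    obtain N where N: "\<And>n. f (r N) \<le> f (r n)"
      using ex_has_least_nat[of "\<lambda>_. True" _ "\<lambda>n. f (r n)"] by blast
    have "f (r (N + n)) = f (r N)" for n
      by (rule antisym[OF 2[rule_format] N]) simp
    then show ?thesis using r
      by (intro that[of "\<lambda>n. r (N + n)"]) (auto simp: mono_def strict_mono_def)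
  qed
qed

text \<open>Dickson's lemma: a sequence of exponents has a subsequence that increases in each coordinate.\<close>

lemma dickson:
  fixes f :: "nat \<Rightarrow> nat \<Rightarrow>\<^sub>0 nat"
  assumes "finite J"
  obtains r :: "nat \<Rightarrow> nat" where "strict_mono r" "\<And>k. k \<in> J \<Longrightarrow> mono (\<lambda>i. lookup (f (r i)) k)"
proof -
  from assms have "\<exists>r :: nat \<Rightarrow> nat. strict_mono r \<and> (\<forall>k\<in>J. mono (\<lambda>i. lookup (f (r i)) k))"
  proof (induction J rule: finite_induct)
    case empty
    show ?case by (intro exI[of _ "\<lambda>i. i"]) (simp add: strict_mono_def)
  next
    case (insert k J)
    then obtain r :: "nat \<Rightarrow> nat" where r: "strict_mono r" "\<forall>k\<in>J. mono (\<lambda>i. lookup (f (r i)) k)" by blast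
    obtain s :: "nat \<Rightarrow> nat" where s: "strict_mono s" "mono ((\<lambda>i. lookup (f (r i)) k) \<circ> s)"
      by (rule nat_seq_mono_subseq)
    have "strict_mono (r \<circ> s)" using r s by (simp add: strict_mono_def)
    moreover have "mono (\<lambda>i. lookup (f ((r \<circ> s) i)) l)" if "l \<in> insert k J" for l
      using that s r(2) strict_mono_mono[OF s(1)] by (auto simp: mono_def comp_def)
    ultimately show ?case by blast
  qed
  then show ?thesis using that by blast
qed

text \<open>A set of exponents in the variables \<open>J\<close> that is closed under taking divisors.\<close>

definition downset :: "nat set \<Rightarrow> (nat \<Rightarrow>\<^sub>0 nat) set \<Rightarrow> bool" where
  "downset J S \<longleftrightarrow> (\<forall>g\<in>S. keys g \<subseteq> J) \<and> (\<forall>g. \<forall>k\<in>J. g + single k 1 \<in> S \<longrightarrow> g \<in> S)"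

lemma downset_add:
  assumes S: "downset J S"
  shows "keys h \<subseteq> J \<Longrightarrow> g + h \<in> S \<Longrightarrow> g \<in> S"
proof (induction "tdeg h" arbitrary: h)
  case 0
  then show ?case by (simp add: tdeg_eq_0_iff)
next
  case (Suc d)
  obtain k where k: "lookup h k \<noteq> 0"
    using Suc.hyps(2) by (metis tdeg_0 lookup_zero poly_mapping_eqI nat.distinct(1))
  define h' where "h' = h - single k (1::nat)"
  have h: "h = h' + single k 1" by (simp add: h'_def diff_single_add[OF k] del: One_nat_def)
  have "k \<in> J" using k Suc.prems(1) by (auto simp: in_keys_iff)
  with S Suc.prems(2) have "g + h' \<in> S"
    unfolding h add.assoc[symmetric] downset_def by blast
  then show ?case
    using Suc.hyps Suc.prems(1) by (intro Suc.hyps(1)[of h']) (auto simp: h tdeg_add keys_add_nat)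
qed

lemma downset_chain_stabilises:
  assumes J: "finite J" and S: "\<And>a. downset J (S a)" and dec: "\<And>a. S (Suc a) \<subseteq> S a"
  obtains N where "\<And>a. a \<ge> N \<Longrightarrow> S a = S N"
proof -
  have dec': "a \<le> b \<Longrightarrow> S b \<subseteq> S a" for a b
    by (induction rule: dec_induct) (use dec in auto)
  have "\<exists>N. \<forall>a\<ge>N. S a = S N"
  proof (rule ccontr)
    assume "\<not> ?thesis"
    then have "\<forall>N. \<exists>a\<ge>N. \<exists>g. g \<in> S N \<and> g \<notin> S a" using dec' by blast
    then obtain nx g where nx: "\<And>N. nx N \<ge> N" "\<And>N. g N \<in> S N" "\<And>N. g N \<notin> S (nx N)" by metis
    define a where "a = rec_nat 0 (\<lambda>_. nx)"
    have a: "a (Suc i) = nx (a i)" for i by (simp add: a_def)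
    have a_mono: "i \<le> j \<Longrightarrow> a i \<le> a j" for i j
      by (induction rule: dec_induct) (use nx(1) a in \<open>auto intro: order.trans\<close>)
    obtain r :: "nat \<Rightarrow> nat" where r: "strict_mono r" "\<And>k. k \<in> J \<Longrightarrow> mono (\<lambda>i. lookup (g (a (r i))) k)"
      using dickson[OF J, of "\<lambda>i. g (a i)"] by blast
    define g0 g1 where "g0 = g (a (r 0))" and "g1 = g (a (r 1))"
    have keys: "keys (g N) \<subseteq> J" for N
      using S[of N] nx(2)[of N] unfolding downset_def by blast
    have le: "lookup g0 k \<le> lookup g1 k" for k
    proof (cases "k \<in> J")
      case True
      from monoD[OF r(2)[OF this], of 0 1] show ?thesis by (simp add: g0_def g1_def)
    next
      case False
      then have "k \<notin> keys g0" using keys by (auto simp: g0_def)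
      then show ?thesis by (simp add: in_keys_iff)
    qed
    then have g1: "g1 = g0 + (g1 - g0)"
      by (intro poly_mapping_eqI) (simp add: lookup_add lookup_minus)
    have "Suc (r 0) \<le> r 1" using r(1) by (simp add: Suc_le_eq strict_mono_less)
    then have "g1 \<in> S (nx (a (r 0)))"
      using nx(2)[of "a (r 1)"] dec'[OF a_mono] a unfolding g1_def by (metis subsetD)
    moreover have "keys (g1 - g0) \<subseteq> J"
    proof -
      have "keys (g1 - g0) \<subseteq> keys g1" by (auto simp: in_keys_iff lookup_minus)
      then show ?thesis using keys unfolding g1_def by blast
    qed
    ultimately have "g0 \<in> S (nx (a (r 0)))" using g1 downset_add[OF S] by metis
    with nx(3) show False by (simp add: g0_def)
  qed
  then show ?thesis using that by blast
qed

text \<open>By induction on the set of variables: the slices at a fixed exponent \<open>a\<close> of a new variable decrease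
  with \<open>a\<close> and hence are eventually constant.\<close>

lemma eventually_poly_card_downset:
  "finite J \<Longrightarrow> downset J S \<Longrightarrow> eventually_poly (\<lambda>j. of_nat (card (S \<inter> exps_le J j)))"
proof (induction J arbitrary: S rule: finite_induct)
  case empty
  have "exps_le {} j = {0}" for j by (auto simp: exps_le_def)
  then show ?case by (simp add: eventually_poly_const)
next
  case (insert k J)
  define sl where "sl a = {g. keys g \<subseteq> J \<and> g + single k a \<in> S}" for a
  have down: "g \<in> S" if "g + single l 1 \<in> S" "l \<in> insert k J" for g l
    using insert.prems that unfolding downset_def by blast
  have dec: "sl (Suc a) \<subseteq> sl a" for a
  proof
    fix g assume g: "g \<in> sl (Suc a)"
    have "g + single k (Suc a) = (g + single k a) + single k 1"
      by (rule poly_mapping_eqI) (simp add: lookup_add lookup_single when_def)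
    with g show "g \<in> sl a" using down[of "g + single k a" k] by (simp add: sl_def)
  qed
  have sl: "downset J (sl a)" for a
    unfolding downset_def
  proof (intro conjI ballI allI impI)
    fix g l assume l: "l \<in> J" and g: "g + single l 1 \<in> sl a"
    have "(g + single l 1) + single k a = (g + single k a) + single l 1"
      by (simp only: ac_simps)
    with g show "g \<in> sl a"
      using down[of "g + single k a" l] l by (simp add: sl_def keys_add_nat)
  qed (simp add: sl_def)
  obtain N where N: "\<And>a. a \<ge> N \<Longrightarrow> sl a = sl N"
    using downset_chain_stabilises[where S = sl, OF insert.hyps(1) sl dec] by blast
  define H where "H a j = (of_nat (card (sl a \<inter> exps_le J j)) :: rat)" for a j
  have poly_H: "eventually_poly (H a)" for a unfolding H_def by (rule insert.IH[OF sl])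
  have fin: "finite (exps_le J j)" for j using insert.hyps(1) by (rule exps_le_box)
  have count: "(of_nat (card (S \<inter> exps_le (insert k J) j)) :: rat) = (\<Sum>a\<le>j. H a (j - a))" for j
  proof -
    let ?sh = "\<lambda>a g. g + single k a :: nat \<Rightarrow>\<^sub>0 nat"
    have k0: "lookup g k = 0" if "keys g \<subseteq> J" for g :: "nat \<Rightarrow>\<^sub>0 nat"
      using that insert.hyps(2) by (auto simp: in_keys_iff)
    have "S \<inter> exps_le (insert k J) j = (\<Union>a\<le>j. ?sh a ` (sl a \<inter> exps_le J (j - a)))"
    proof (intro equalityI subsetI)
      fix g assume g: "g \<in> S \<inter> exps_le (insert k J) j"
      define a where "a = lookup g k"
      define h where "h = g - single k a"
      have gh: "g = ?sh a h"
        by (rule poly_mapping_eqI) (auto simp: h_def a_def lookup_add lookup_minus lookup_single when_def)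
      have "keys h \<subseteq> J"
      proof
        fix x assume "x \<in> keys h"
        then have "x \<in> keys g" "x \<noteq> k"
          by (auto simp: h_def a_def in_keys_iff lookup_minus lookup_single when_def split: if_splits)
        with g show "x \<in> J" unfolding exps_le_def by blast
      qed
      moreover have "tdeg h + a \<le> j" using g by (auto simp: gh exps_le_def tdeg_add)
      ultimately have "a \<le> j" "h \<in> sl a \<inter> exps_le J (j - a)"
        using g gh by (auto simp: sl_def exps_le_def)
      with gh show "g \<in> (\<Union>a\<le>j. ?sh a ` (sl a \<inter> exps_le J (j - a)))" by blast
    next
      fix g assume "g \<in> (\<Union>a\<le>j. ?sh a ` (sl a \<inter> exps_le J (j - a)))"
      then show "g \<in> S \<inter> exps_le (insert k J) j"
        by (auto simp: sl_def exps_le_def keys_add_nat tdeg_add split: if_splits)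
    qed
    also have "card \<dots> = (\<Sum>a\<le>j. card (?sh a ` (sl a \<inter> exps_le J (j - a))))"
    proof (rule card_UN_disjoint)
      show "\<forall>a\<in>{..j}. \<forall>b\<in>{..j}. a \<noteq> b \<longrightarrow>
        ?sh a ` (sl a \<inter> exps_le J (j - a)) \<inter> ?sh b ` (sl b \<inter> exps_le J (j - b)) = {}"
      proof (intro ballI impI)
        fix a b :: nat assume "a \<noteq> b"
        have "?sh a g \<noteq> ?sh b h" if "keys g \<subseteq> J" "keys h \<subseteq> J" for g h
        proof
          assume "?sh a g = ?sh b h"
          then have "lookup (?sh a g) k = lookup (?sh b h) k" by simp
          then show False using that \<open>a \<noteq> b\<close> by (simp add: lookup_add k0)
        qed
        then show "?sh a ` (sl a \<inter> exps_le J (j - a)) \<inter> ?sh b ` (sl b \<inter> exps_le J (j - b)) = {}"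
          by (auto simp: sl_def)
      qed
    qed (use fin in auto)
    also have "\<dots> = (\<Sum>a\<le>j. card (sl a \<inter> exps_le J (j - a)))"
      by (intro sum.cong card_image refl) (auto simp: inj_on_def)
    finally show ?thesis by (simp add: H_def)
  qed
  have HN: "H a = H N" if "a \<ge> N" for a
    unfolding H_def N[OF that] ..
  have split: "(\<Sum>a\<le>j. H a (j - a)) = (\<Sum>a<N. H a (j - a)) + (\<Sum>i\<le>j - N. H N i)" if j: "j \<ge> N" for j
  proof -
    have "{..j} = {..<N} \<union> {N..j}" using j by auto
    then have "(\<Sum>a\<le>j. H a (j - a)) = (\<Sum>a<N. H a (j - a)) + (\<Sum>a=N..j. H a (j - a))"
      by (simp add: sum.union_disjoint ivl_disj_int)
    also have "(\<Sum>a=N..j. H a (j - a)) = (\<Sum>a=N..j. H N (j - a))"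
      by (intro sum.cong refl) (metis HN atLeastAtMost_iff)
    also have "\<dots> = (\<Sum>i\<le>j - N. H N i)"
      by (rule sum.reindex_bij_witness[of _ "\<lambda>i. j - i" "\<lambda>a. j - a"]) (use j in auto)
    finally show ?thesis .
  qed
  have "eventually_poly (\<lambda>j. (\<Sum>a<N. H a (j - a)) + (\<Sum>i\<le>j - N. H N i))"
    by (intro eventually_poly_add eventually_poly_sum eventually_poly_shift poly_H
        eventually_poly_shift[OF eventually_poly_partial_sum[OF poly_H]])
  then show ?case
    by (rule eventually_poly_cong[rotated])
      (auto simp: eventually_sequentially count split intro!: exI[of _ N])
qed

lemma degree_lead_coeff_diff:
  fixes P Q :: "'c::comm_ring_1 poly"
  assumes "Polynomial.degree Q < Polynomial.degree P"
  shows "Polynomial.degree (P - Q) = Polynomial.degree P" "lead_coeff (P - Q) = lead_coeff P"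
proof -
  show deg: "Polynomial.degree (P - Q) = Polynomial.degree P"
    using degree_add_eq_left[of "- Q" P] assms by simp
  show "lead_coeff (P - Q) = lead_coeff P"
    unfolding deg using assms by (simp add: coeff_eq_0)
qed

lemma degree_eq_if_bounds:
  fixes p :: "rat poly"
  assumes ev: "\<forall>\<^sub>F j in sequentially. of_nat (h j) = poly p (of_nat j)"
    and upper: "\<And>j. h j \<le> c * (j + s) ^ m"
    and lower: "\<And>t. (t + 1) ^ m \<le> h (b * t)" and b: "b > 0"
  shows "Polynomial.degree p = m"
proof -
  define P :: "real poly" where "P = map_poly of_rat p"
  have degP: "Polynomial.degree P = Polynomial.degree p" unfolding P_def by (rule degree_map_poly) simp
  have P: "poly P (of_nat j) = of_rat (poly p (of_nat j))" for j
  proof -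
    have "poly P (of_rat x) = of_rat (poly p x)" for x
      unfolding P_def by (induction p) (simp_all add: map_poly_pCons of_rat_add of_rat_mult)
    from this[of "of_nat j"] show ?thesis by simp
  qed
  obtain N where N: "\<And>j. j \<ge> N \<Longrightarrow> real (h j) = poly P (real j)"
    using ev unfolding eventually_sequentially by (metis P of_rat_of_nat_eq)
  have pow: "Polynomial.degree ([:x, y:] ^ m) = m \<and> lead_coeff ([:x, y:] ^ m) = y ^ m" if "y \<noteq> 0" for x y :: real
    using that lead_coeff_power[of "[:x, y:]" m] by (simp add: degree_power_eq)
  have le: "Polynomial.degree P \<le> m"
  proof (rule ccontr)
    assume less: "\<not> Polynomial.degree P \<le> m"
    define Q where "Q = Polynomial.smult (real c) ([:real s, 1:] ^ m)"
    have Q: "Polynomial.degree Q < Polynomial.degree P" unfolding Q_def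
      using degree_smult_le[of "real c" "[:real s, 1:] ^ m"] pow[of 1 "real s"] less by simp
    have PQ: "poly P (real j) \<le> poly Q (real j)" if "j \<ge> N" for j
    proof -
      have "real (h j) \<le> real (c * (j + s) ^ m)" using upper[of j] by (simp only: of_nat_le_iff)
      then show ?thesis using N[OF that] by (simp add: Q_def add.commute)
    qed
    have P0: "P \<noteq> 0" using Q by auto
    show False
    proof (cases "lead_coeff P > 0")
      case True
      with degree_lead_coeff_diff(2)[OF Q] have "lead_coeff (P - Q) > 0" by simp
      from poly_pinfty_gt_lc[OF this] obtain y where y: "\<And>x. x \<ge> y \<Longrightarrow> poly (P - Q) x \<ge> lead_coeff (P - Q)" by blast
      obtain j where "real j \<ge> max y (real N)" using real_arch_simple by blast
      then show False using y[of "real j"] PQ[of j] \<open>lead_coeff (P - Q) > 0\<close> by simp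
    next
      case False
      then have "lead_coeff (- P) > 0" using P0 by (simp add: less_le)
      from poly_pinfty_gt_lc[OF this] obtain y where y: "\<And>x. x \<ge> y \<Longrightarrow> poly (- P) x \<ge> lead_coeff (- P)" by blast
      obtain j where "real j \<ge> max y (real N)" using real_arch_simple by blast
      then show False using y[of "real j"] N[of j] \<open>lead_coeff (- P) > 0\<close> by simp
    qed
  qed
  have "m \<le> Polynomial.degree P"
  proof (rule ccontr)
    assume less: "\<not> m \<le> Polynomial.degree P"
    define R where "R = pcompose P [:0, real b:]"
    define Q where "Q = [:1, 1:] ^ m - R"
    have dR: "Polynomial.degree R < m" unfolding R_def using less by (simp add: degree_pcompose)
    have "lead_coeff Q = lead_coeff ([:1, 1:] ^ m :: real poly)"
      unfolding Q_def by (rule degree_lead_coeff_diff(2)) (use dR pow[of 1 1] in simp)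
    also have "\<dots> = 1" using pow[of 1 1] by (metis one_neq_zero power_one)
    finally have "lead_coeff Q = 1" .
    then have lc: "lead_coeff Q > 0" by simp
    from poly_pinfty_gt_lc[OF this] obtain y where y: "\<And>x. x \<ge> y \<Longrightarrow> poly Q x \<ge> lead_coeff Q" by blast
    obtain t where t: "real t \<ge> max y (real N)" using real_arch_simple by blast
    have "N \<le> b * t" using t b by (metis max.bounded_iff mult_le_mono1 of_nat_le_iff order.trans less_one linorder_not_less mult_1)
    then have "real (h (b * t)) = poly R (real t)" using N by (simp add: R_def poly_pcompose mult.commute)
    moreover have "real ((t + 1) ^ m) \<le> real (h (b * t))" using lower[of t] by (simp only: of_nat_le_iff)
    ultimately have "poly Q (real t) \<le> 0" by (simp add: Q_def add.commute)
    with y[of "real t"] t lc show False by simp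
  qed
  with le degP show ?thesis by simp
qed

section \<open>Standard monomials\<close>

text \<open>The graded lexicographic order on pairs of an exponent and the number of a generator.\<close>

definition mon_less :: "(nat \<Rightarrow>\<^sub>0 nat) \<times> nat \<Rightarrow> (nat \<Rightarrow>\<^sub>0 nat) \<times> nat \<Rightarrow> bool" where
  "mon_less x y \<longleftrightarrow> tdeg (fst x) < tdeg (fst y) \<or>
     tdeg (fst x) = tdeg (fst y) \<and> (fst x < fst y \<or> fst x = fst y \<and> snd x < snd y)"

lemma mon_less_trans: "mon_less x y \<Longrightarrow> mon_less y z \<Longrightarrow> mon_less x z"
  unfolding mon_less_def by (elim disjE conjE) auto

lemma mon_less_irrefl: "\<not> mon_less x x"
  unfolding mon_less_def by simp

lemma mon_less_total: "x \<noteq> y \<Longrightarrow> mon_less x y \<or> mon_less y x"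
  unfolding mon_less_def prod_eq_iff by (metis linorder_neqE)

lemma mon_less_tdeg: "mon_less x y \<Longrightarrow> tdeg (fst x) \<le> tdeg (fst y)"
  unfolding mon_less_def by auto

lemma mon_less_add: "mon_less (g, a) (h, b) \<Longrightarrow> mon_less (g + e, a) (h + e, b)"
  unfolding mon_less_def by (auto simp: tdeg_add)

lemma finite_mon_less_max:
  assumes "finite S" "S \<noteq> {}"
  obtains x where "x \<in> S" "\<And>y. y \<in> S \<Longrightarrow> y \<noteq> x \<Longrightarrow> mon_less y x"
proof -
  have "\<exists>x\<in>S. \<forall>y\<in>S. y \<noteq> x \<longrightarrow> mon_less y x"
    using assms
  proof (induction S rule: finite_ne_induct)
    case (insert z S)
    then obtain x where x: "x \<in> S" "\<And>y. y \<in> S \<Longrightarrow> y \<noteq> x \<Longrightarrow> mon_less y x" by blast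
    have "z \<noteq> x" using x insert by blast
    then consider "mon_less z x" | "mon_less x z" using mon_less_total by blast
    then show ?case
    proof cases
      case 1
      then show ?thesis using x by (intro bexI[of _ x]) auto
    next
      case 2
      then show ?thesis using x mon_less_trans by (intro bexI[of _ z]) blast+
    qed
  qed simp
  then show ?thesis using that by blast
qed

context filtered_weyl_action
begin

text \<open>Let \<open>u\<^sub>0, \<dots>, u\<^bsub>p-1\<^esub>\<close> generate modulo \<open>U\<close>. A monomial expression \<open>mon g u\<^sub>a\<close> is standard if it is
  not congruent modulo \<open>U\<close> to a combination of smaller ones.\<close>

definition lower :: "nat set \<Rightarrow> 'b set \<Rightarrow> nat \<Rightarrow> (nat \<Rightarrow> 'b) \<Rightarrow> (nat \<Rightarrow>\<^sub>0 nat) \<times> nat \<Rightarrow> 'b set" where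
  "lower I U p u x = span (U \<union> {mon h (u b) |h b. keys h \<subseteq> symvars I \<and> b < p \<and> mon_less (h, b) x})"

definition standard :: "nat set \<Rightarrow> 'b set \<Rightarrow> nat \<Rightarrow> (nat \<Rightarrow> 'b) \<Rightarrow> nat \<Rightarrow> ((nat \<Rightarrow>\<^sub>0 nat) \<times> nat) set" where
  "standard I U p u j = {(g, a). g \<in> exps_le (symvars I) j \<and> a < p \<and> mon g (u a) \<notin> lower I U p u (g, a)}"

lemma subspace_lower: "subspace (lower I U p u x)"
  unfolding lower_def by (rule subspace_span)

lemma lower_U: "U \<subseteq> lower I U p u x"
  unfolding lower_def by (rule order.trans[OF _ span_superset]) blast

lemma lower_mon:
  "keys h \<subseteq> symvars I \<Longrightarrow> b < p \<Longrightarrow> mon_less (h, b) x \<Longrightarrow> mon h (u b) \<in> lower I U p u x"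
  unfolding lower_def by (intro span_base) blast

text \<open>Multiples of nonstandard monomials are nonstandard, since the order is compatible with left
  multiplication up to terms of lower degree.\<close>

lemma mon_in_lower_step:
  assumes I: "I \<subseteq> {1..n}" and U: "stable I U" and g: "keys g \<subseteq> symvars I" and a: "a < p"
    and k: "k \<in> symvars I" and low: "mon g (u a) \<in> lower I U p u (g, a)"
  shows "mon (g + single k 1) (u a) \<in> lower I U p u (g + single k 1, a)"
proof -
  define L where "L = lower I U p u (g + single k 1, a)"
  have sub: "subspace L" unfolding L_def by (rule subspace_lower)
  have UL: "U \<subseteq> L" unfolding L_def by (rule lower_U)
  have small: "mon h (u b) \<in> L" if "keys h \<subseteq> symvars I" "b < p" "tdeg h \<le> tdeg g" for h b
    using that unfolding L_def by (intro lower_mon) (auto simp: mon_less_def tdeg_add)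
  have shift: "mon (h + single k 1) (u b) \<in> L"
    if "keys h \<subseteq> symvars I" "b < p" "mon_less (h, b) (g, a)" for h b
    using that k unfolding L_def by (intro lower_mon mon_less_add) (auto simp: keys_add_nat)
  have minus: "keys (h - single l 1) \<subseteq> symvars I" if "keys h \<subseteq> symvars I" for h :: "nat \<Rightarrow>\<^sub>0 nat" and l
    by (rule order.trans[OF keys_diff_single that])
  from k consider i where "i \<in> I" "k = 2 * i" | i where "i \<in> I" "k = 2 * i + 1"
    by (auto simp: symvars_def)
  then show ?thesis
  proof cases
    case 1
    with I have i: "i \<in> {1..n}" by blast
    have "X i (mon g (u a)) \<in> L"
    proof (rule span_linear_subset[OF X_add X_scale sub _ low[unfolded lower_def]])
      fix w assume "w \<in> U \<union> {mon h (u b) |h b. keys h \<subseteq> symvars I \<and> b < p \<and> mon_less (h, b) (g, a)}"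
      then show "X i w \<in> L"
        using stableD(2)[OF U 1(1)] UL shift by (auto simp: X_mon_upto[OF i] 1(2))
    qed
    then show ?thesis unfolding X_mon_upto[OF i] 1(2)[symmetric] L_def .
  next
    case 2
    with I have i: "i \<in> {1..n}" by blast
    have "D i (mon g (u a)) \<in> L"
    proof (rule span_linear_subset[OF D_add D_scale sub _ low[unfolded lower_def]])
      fix w assume "w \<in> U \<union> {mon h (u b) |h b. keys h \<subseteq> symvars I \<and> b < p \<and> mon_less (h, b) (g, a)}"
      then show "D i w \<in> L"
      proof
        assume "w \<in> U"
        then show ?thesis using stableD(3)[OF U 2(1)] UL by blast
      next
        assume "w \<in> {mon h (u b) |h b. keys h \<subseteq> symvars I \<and> b < p \<and> mon_less (h, b) (g, a)}"
        then obtain h b where h: "w = mon h (u b)" "keys h \<subseteq> symvars I" "b < p" "mon_less (h, b) (g, a)"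
          by blast
        have "tdeg (h - single (2 * i) 1) \<le> tdeg g"
          using order.trans[OF tdeg_diff_single mon_less_tdeg[OF h(4)]] by simp
        from small[OF minus[OF h(2)] h(3) this] shift[OF h(2-4)]
        show ?thesis unfolding h(1) D_mon_upto[OF i] 2(2)
          by (intro subspace_add[OF sub] subspace_scale[OF sub])
      qed
    qed
    moreover have "of_nat (lookup g (2 * i)) *s mon (g - single (2 * i) 1) (u a) \<in> L"
      by (intro subspace_scale[OF sub] small minus g a tdeg_diff_single)
    ultimately have "D i (mon g (u a)) - of_nat (lookup g (2 * i)) *s mon (g - single (2 * i) 1) (u a) \<in> L"
      by (rule subspace_diff[OF sub])
    then show ?thesis unfolding D_mon_upto[OF i] 2(2)[symmetric] L_def by simp
  qed
qed

lemma finite_standard: "I \<subseteq> {1..n} \<Longrightarrow> finite (standard I U p u j)"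
  by (rule finite_subset[of _ "exps_le (symvars I) j \<times> {..<p}"])
    (auto simp: standard_def intro!: exps_le_box finite_symvars dest: finite_subset)

lemma indep_mod_standard:
  assumes I: "I \<subseteq> {1..n}" and U: "subspace U"
  shows "indep_mod U (standard I U p u j) (\<lambda>(g, a). mon g (u a))"
  unfolding indep_mod_def
proof (intro conjI allI impI)
  let ?S = "standard I U p u j" and ?f = "\<lambda>(g, a). mon g (u a)"
  show fin: "finite ?S" by (rule finite_standard[OF I])
  fix c assume c: "(\<Sum>x\<in>?S. c x *s ?f x) \<in> U"
  show "\<forall>x\<in>?S. c x = 0"
  proof (rule ccontr)
    let ?N = "{x \<in> ?S. c x \<noteq> 0}"
    assume "\<not> ?thesis"
    then have "?N \<noteq> {}" by blast
    with fin obtain x where x: "x \<in> ?N" "\<And>y. y \<in> ?N \<Longrightarrow> y \<noteq> x \<Longrightarrow> mon_less y x"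
      by (auto intro: finite_mon_less_max[of ?N])
    let ?L = "lower I U p u x"
    note sub = subspace_lower[of I U p u x]
    have "(\<Sum>y\<in>?S. c y *s ?f y) = (\<Sum>y\<in>?N. c y *s ?f y)"
      using fin by (intro sum.mono_neutral_right) auto
    also have "\<dots> = c x *s ?f x + (\<Sum>y\<in>?N - {x}. c y *s ?f y)"
      using fin x(1) by (simp add: sum.remove)
    finally have eq: "c x *s ?f x = (\<Sum>y\<in>?S. c y *s ?f y) - (\<Sum>y\<in>?N - {x}. c y *s ?f y)" by simp
    have "(\<Sum>y\<in>?N - {x}. c y *s ?f y) \<in> ?L"
    proof (intro subspace_sum[OF sub] subspace_scale[OF sub])
      fix y assume "y \<in> ?N - {x}"
      then have "y \<in> ?S" "mon_less y x" using x(2) by auto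
      then show "?f y \<in> ?L" by (cases y) (auto simp: standard_def exps_le_def intro!: lower_mon)
    qed
    then have "c x *s ?f x \<in> ?L" unfolding eq
      using subsetD[OF lower_U c] by (intro subspace_diff[OF sub])
    then have "(1 / c x) *s c x *s ?f x \<in> ?L" by (rule subspace_scale[OF sub])
    then have "?f x \<in> ?L" using x(1) by simp
    with x(1) show False by (cases x) (auto simp: standard_def)
  qed
qed

lemma span_standard:
  assumes I: "I \<subseteq> {1..n}" and U: "subspace U"
    and g: "g \<in> exps_le (symvars I) j" and a: "a < p"
  shows "mon g (u a) \<in> span (U \<union> (\<lambda>(g, a). mon g (u a)) ` standard I U p u j)"
proof -
  let ?P = "exps_le (symvars I) j \<times> {..<p}" and ?f = "\<lambda>(g, a). mon g (u a)"
  let ?T = "span (U \<union> ?f ` standard I U p u j)"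
  have "finite I" using I finite_subset by blast
  then have fin: "finite ?P" by (auto intro!: exps_le_box finite_symvars)
  have "x \<in> ?P \<Longrightarrow> ?f x \<in> ?T" for x
  proof (induction "card {y \<in> ?P. mon_less y x}" arbitrary: x rule: less_induct)
    case less
    obtain g a where x: "x = (g, a)" by (cases x)
    show ?case
    proof (cases "x \<in> standard I U p u j")
      case True
      then show ?thesis by (intro span_base) blast
    next
      case False
      then have "mon g (u a) \<in> lower I U p u x" using less.prems by (auto simp: standard_def x)
      moreover have "lower I U p u x \<subseteq> ?T"
        unfolding lower_def
      proof (intro span_minimal subspace_span Un_least subsetI)
        fix w assume "w \<in> {mon h (u b) |h b. keys h \<subseteq> symvars I \<and> b < p \<and> mon_less (h, b) x}"
        then obtain h b where h: "w = mon h (u b)" "keys h \<subseteq> symvars I" "b < p" "mon_less (h, b) x"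
          by blast
        have hb: "(h, b) \<in> ?P"
          using less.prems mon_less_tdeg[OF h(4)] h(2,3) by (auto simp: x exps_le_def)
        have "{y \<in> ?P. mon_less y (h, b)} \<subset> {y \<in> ?P. mon_less y x}"
          using h(4) hb mon_less_trans mon_less_irrefl by blast
        then have "card {y \<in> ?P. mon_less y (h, b)} < card {y \<in> ?P. mon_less y x}"
          using fin by (intro psubset_card_mono) auto
        from less.hyps[OF this hb] show "w \<in> ?T" by (simp add: h(1))
      qed (auto intro: span_base)
      ultimately show ?thesis by (auto simp: x)
    qed
  qed
  from this[of "(g, a)"] g a show ?thesis by simp
qed

text \<open>The nonstandard monomials are closed under multiples, so the standard ones are counted by a
  polynomial. Its degree is the number of variables by the two bounds on the growth.\<close>

lemma hilbert_polynomial: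
  assumes I: "I \<subseteq> {1..n}" and U: "stable I U" and gr: "growth U (card I)"
    and u: "\<And>a. a < p \<Longrightarrow> u a \<in> V" and b: "b < p" "u b \<notin> U"
  obtains \<chi> :: "rat poly" where "\<forall>\<^sub>F j in sequentially. of_nat (card (standard I U p u j)) = poly \<chi> (of_nat j)"
    "Polynomial.degree \<chi> = card I"
proof -
  have finI: "finite I" using I finite_subset by blast
  note sub = stableD(1)[OF U]
  define S where "S a = {g. keys g \<subseteq> symvars I \<and> mon g (u a) \<notin> lower I U p u (g, a)}" for a
  have down: "downset (symvars I) (S a)" if "a < p" for a
    unfolding downset_def
  proof (intro conjI ballI allI impI)
    fix g k assume k: "k \<in> symvars I" and g: "g + single k 1 \<in> S a"
    then have "keys g \<subseteq> symvars I" by (auto simp: S_def keys_add_nat)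
    with mon_in_lower_step[OF I U this \<open>a < p\<close> k] g show "g \<in> S a" by (auto simp: S_def)
  qed (simp add: S_def)
  have count: "card (standard I U p u j) = (\<Sum>a<p. card (S a \<inter> exps_le (symvars I) j))" for j
  proof -
    have "bij_betw (\<lambda>(a, g). (g, a)) (SIGMA a:{..<p}. S a \<inter> exps_le (symvars I) j) (standard I U p u j)"
      by (rule bij_betwI[where g = "\<lambda>(g, a). (a, g)"]) (auto simp: standard_def S_def exps_le_def)
    then have "card (standard I U p u j) = card (SIGMA a:{..<p}. S a \<inter> exps_le (symvars I) j)"
      by (simp add: bij_betw_same_card)
    then show ?thesis
      using exps_le_box(1)[OF finite_symvars[OF finI]] by simp
  qed
  have "eventually_poly (\<lambda>j. \<Sum>a<p. of_nat (card (S a \<inter> exps_le (symvars I) j)))"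
    by (intro eventually_poly_sum eventually_poly_card_downset finite_symvars finI down) simp
  then have "eventually_poly (\<lambda>j. of_nat (card (standard I U p u j)))" by (simp add: count)
  then obtain \<chi> :: "rat poly" where \<chi>: "\<forall>\<^sub>F j in sequentially. of_nat (card (standard I U p u j)) = poly \<chi> (of_nat j)"
    by (auto simp: eventually_poly_def)
  obtain s where s: "\<And>a. a < p \<Longrightarrow> u a \<in> F s"
  proof -
    have "\<forall>a. \<exists>s. a < p \<longrightarrow> u a \<in> F s" using u F_UN by blast
    then obtain s where s: "\<And>a. a < p \<Longrightarrow> u a \<in> F (s a)" by metis
    have "u a \<in> F (\<Sum>a<p. s a)" if "a < p" for a
      using s[OF that] F_mono[of "s a" "\<Sum>a<p. s a"] member_le_sum[of a "{..<p}" s] that by auto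
    then show ?thesis using that by blast
  qed
  obtain c where c: "\<And>j A (f :: (nat \<Rightarrow>\<^sub>0 nat) \<times> nat \<Rightarrow> 'b). indep_mod U A f \<Longrightarrow> f ` A \<subseteq> F j \<Longrightarrow> card A \<le> c * (j + 1) ^ card I"
    using growthE[OF gr] by blast
  have upper: "card (standard I U p u j) \<le> c * (j + (s + 1)) ^ card I" for j
  proof -
    have "(\<lambda>(g, a). mon g (u a)) ` standard I U p u j \<subseteq> F (s + j)"
    proof clarify
      fix g a assume "(g, a) \<in> standard I U p u j"
      then have g: "keys g \<subseteq> symvars I" "tdeg g \<le> j" "a < p"
        by (auto simp: standard_def exps_le_def)
      then show "mon g (u a) \<in> F (s + j)"
        using F_mon[OF I g(1) s[OF g(3)]] F_mono[of "s + tdeg g" "s + j"] by auto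
    qed
    from c[OF indep_mod_standard[OF I sub] this] show ?thesis by (simp add: ac_simps)
  qed
  have lower: "(t + 1) ^ card I \<le> card (standard I U p u ((4 * card I + 1) * t))" for t
  proof -
    let ?j = "(4 * card I + 1) * t"
    obtain A where A: "A \<subseteq> exps_le (symvars I) (4 * card I * t)" "indep_mod U A (\<lambda>g. mon g (u b))"
      "(t + 1) ^ card I \<le> card A"
      by (rule bernstein_lower_bound[OF I U b(2)])
    have "\<exists>l. mon g (u b) - (\<Sum>x\<in>standard I U p u ?j. l x *s (\<lambda>(g, a). mon g (u a)) x) \<in> U" if "g \<in> A" for g
    proof -
      have "g \<in> exps_le (symvars I) ?j" using A(1) that exps_le_mono[of "4 * card I * t" ?j] by auto
      from span_standard[OF I sub this b(1)] show ?thesis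
        using span_Un_image[OF sub finite_standard[OF I]] by blast
    qed
    then have "\<forall>g\<in>A. \<exists>l. mon g (u b) - (\<Sum>x\<in>standard I U p u ?j. l x *s (\<lambda>(g, a). mon g (u a)) x) \<in> U" ..
    from bchoice[OF this] obtain l where
      l: "\<forall>g\<in>A. mon g (u b) - (\<Sum>x\<in>standard I U p u ?j. l g x *s (\<lambda>(g, a). mon g (u a)) x) \<in> U" ..
    have "card A \<le> card (standard I U p u ?j)"
      by (rule indep_mod_card_le[OF sub A(2) finite_standard[OF I] bspec[OF l]])
    with A(3) show ?thesis by (rule order.trans)
  qed
  have "Polynomial.degree \<chi> = card I"
    
    by (rule degree_eq_if_bounds[where h = "\<lambda>j. card (standard I U p u j)" and b = "4 * card I + 1", OF \<chi> upper lower])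
      simp
  with \<chi> show ?thesis using that by blast
qed

end

section \<open>The action on polynomials\<close>

text \<open>Multiplication by a variable.\<close>

definition vmul :: "nat \<Rightarrow> 'a::field_char_0 mpoly \<Rightarrow> 'a mpoly" where
  "vmul i f = var i * f"

lemma polys_iff: "f \<in> polys n \<longleftrightarrow> (\<exists>d. f \<in> polys_le {1..n} d)"
  using polys_eq_UN[of n] by blast

lemma polys_0 [simp]: "0 \<in> polys n"
  and polys_1 [simp]: "1 \<in> polys n"
  and polys_const [simp]: "const c \<in> polys n"
  using polys_le_const[of c "{1..n}" 0] polys_le_const[of 1 "{1..n}" 0] unfolding polys_iff by auto

lemma polys_add: "f \<in> polys n \<Longrightarrow> g \<in> polys n \<Longrightarrow> f + g \<in> polys n"
proof -
  assume "f \<in> polys n" "g \<in> polys n"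
  then obtain d e where "f \<in> polys_le {1..n} d" "g \<in> polys_le {1..n} e" by (auto simp: polys_iff)
  then have "f \<in> polys_le {1..n} (max d e)" "g \<in> polys_le {1..n} (max d e)"
    using polys_le_mono[of d "max d e" "{1..n}"] polys_le_mono[of e "max d e" "{1..n}"] by auto
  then show ?thesis using polys_le_add polys_iff by blast
qed

lemma polys_mult: "f \<in> polys n \<Longrightarrow> g \<in> polys n \<Longrightarrow> f * g \<in> polys n"
  unfolding polys_iff by (blast intro: polys_le_mult)

lemma polys_uminus: "f \<in> polys n \<Longrightarrow> - f \<in> polys n"
  unfolding polys_iff by (blast intro: polys_le_uminus)

lemma polys_diff: "f \<in> polys n \<Longrightarrow> g \<in> polys n \<Longrightarrow> f - g \<in> polys n"
  using polys_add[of f n "- g"] polys_uminus[of g n] by simp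

lemma polys_var: "i \<in> {1..n} \<Longrightarrow> var i \<in> polys n"
  unfolding polys_iff by (blast intro: polys_le_var)

lemma polys_pd: "f \<in> polys n \<Longrightarrow> pd i f \<in> polys n"
  unfolding polys_iff by (blast intro: polys_le_pd')

lemma polys_Phi: "q \<in> polys n \<Longrightarrow> f \<in> polys n \<Longrightarrow> Phi q i f \<in> polys n"
  unfolding Phi_def by (intro polys_diff polys_mult polys_pd)

lemma Phi_0: "Phi 0 i f = pd i f"
  by (simp add: Phi_def)

lemma weyl_action_Phi:
  assumes "q \<in> polys n"
  shows "weyl_action mscale n (polys n) vmul (Phi q)"
proof unfold_locales
  show "mv.subspace (polys n)"
    by (rule mv.subspaceI) (simp_all add: polys_add polys_mult mscale_def)
  show "Phi q i (Phi q j v) = Phi q j (Phi q i v)" for i j v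
    by (simp add: Phi_def pd_diff pd_mult pd_commute[of i j] algebra_simps)
  show "Phi q i (vmul j v) = vmul j (Phi q i v) + (if i = j then v else 0)" for i j v
    by (simp add: Phi_def vmul_def pd_mult pd_var algebra_simps)
  show "Phi q i v \<in> polys n" if "v \<in> polys n" for i v
    using assms that by (rule polys_Phi)
qed (simp_all add: vmul_def polys_mult polys_var mscale_def algebra_simps Phi_def pd_add pd_mult)

text \<open>With \<open>d\<close> a positive bound for the degree of \<open>q\<close>, the polynomials of degree at most \<open>d (j + 1)\<close>
  form a filtration of growth \<open>j\<^sup>n\<close>.\<close>

lemma filtered_weyl_action_Phi:
  fixes q :: "'a::field_char_0 mpoly"
  assumes q: "q \<in> polys_le {1..n} d" and d: "d \<ge> 1"
  shows "filtered_weyl_action mscale n (polys n) vmul (Phi q) (\<lambda>j. polys_le {1..n} (d * (j + 1)))"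
proof -
  have "q \<in> polys n" using q polys_iff by blast
  then interpret weyl_action mscale n "polys n" vmul "Phi q" by (rule weyl_action_Phi)
  show ?thesis
  proof unfold_locales
    show "polys n = (\<Union>j. polys_le {1..n} (d * (j + 1)))"
    proof (intro equalityI subsetI)
      fix f assume "f \<in> polys n"
      then obtain e where e: "f \<in> polys_le {1..n} e" by (auto simp: polys_iff)
      have "e \<le> d * (e + 1)" using mult_le_mono1[OF d, of "e + 1"] by simp
      with e polys_le_mono have "f \<in> polys_le {1..n} (d * (e + 1))" by blast
      then show "f \<in> (\<Union>j. polys_le {1..n} (d * (j + 1)))" by blast
    qed (auto simp: polys_iff)
    show "polys_le {1..n} (d * (j + 1)) \<subseteq> polys_le {1..n} (d * (Suc j + 1))" for j
      by (rule polys_le_mono) simp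
    fix i j :: nat and v :: "'a mpoly" assume i: "i \<in> {1..n}" and v: "v \<in> polys_le {1..n} (d * (j + 1))"
    have le: "Suc (d * (j + 1)) \<le> d * (Suc j + 1)" using d by simp
    show "vmul i v \<in> polys_le {1..n} (d * (Suc j + 1))"
      unfolding vmul_def using polys_le_var_mult[OF i v] polys_le_mono[OF le] by blast
    have "pd i v \<in> polys_le {1..n} (d * (Suc j + 1))"
      using polys_le_pd'[OF v] polys_le_mono[of "d * (j + 1)" "d * (Suc j + 1)"] by auto
    moreover have "v * pd i q \<in> polys_le {1..n} (d * (j + 1) + d)"
      by (rule polys_le_mult[OF v polys_le_pd'[OF q]])
    ultimately show "Phi q i v \<in> polys_le {1..n} (d * (Suc j + 1))"
      unfolding Phi_def by (intro polys_le_diff) (simp_all add: add.commute)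
  qed
qed

section \<open>Differential operators and their symbols\<close>

lemma End_K_iff: "F \<in> carrier (End_K n) \<longleftrightarrow> F \<in> extensional (polys n) \<and>
    (\<forall>f\<in>polys n. F f \<in> polys n) \<and>
    (\<forall>f\<in>polys n. \<forall>g\<in>polys n. F (f + g) = F f + F g) \<and>
    (\<forall>c. \<forall>f\<in>polys n. F (const c * f) = const c * F f)"
  by (auto simp: End_K_def PiE_def)

lemma End_K_mult: "F \<otimes>\<^bsub>End_K n\<^esub> G = restrict (\<lambda>f. F (G f)) (polys n)"
  and End_K_add: "F \<oplus>\<^bsub>End_K n\<^esub> G = restrict (\<lambda>f. F f + G f) (polys n)"
  and End_K_one: "\<one>\<^bsub>End_K n\<^esub> = restrict (\<lambda>f. f) (polys n)"
  and End_K_zero: "\<zero>\<^bsub>End_K n\<^esub> = restrict (\<lambda>f. 0) (polys n)"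
  by (simp_all add: End_K_def compose_def)

lemma restrict_End_K:
  assumes "\<And>f. f \<in> polys n \<Longrightarrow> F f \<in> polys n"
    and "\<And>f g. F (f + g) = F f + F g" "\<And>c f. F (const c * f) = const c * F f"
  shows "restrict F (polys n) \<in> carrier (End_K n)"
  using assms by (auto simp: End_K_iff polys_add polys_mult)

lemma ring_End_K: "ring (End_K n :: ('a::field_char_0 mpoly \<Rightarrow> 'a mpoly) ring)"
proof (rule ringI)
  have ext: "F = G" if "F \<in> carrier (End_K n)" "G \<in> carrier (End_K n)" "\<And>f. f \<in> polys n \<Longrightarrow> F f = G f"
    for F G :: "'a mpoly \<Rightarrow> 'a mpoly"
    using that by (auto simp: End_K_iff intro: extensionalityI)
  have add: "F \<oplus>\<^bsub>End_K n\<^esub> G \<in> carrier (End_K n)" and mult: "F \<otimes>\<^bsub>End_K n\<^esub> G \<in> carrier (End_K n)"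
    if "F \<in> carrier (End_K n)" "G \<in> carrier (End_K n)" for F G :: "'a mpoly \<Rightarrow> 'a mpoly"
    using that by (auto simp: End_K_iff End_K_add End_K_mult polys_add polys_mult distrib_left add_ac)
  have zero: "\<zero>\<^bsub>End_K n\<^esub> \<in> carrier (End_K n)" and one: "\<one>\<^bsub>End_K n\<^esub> \<in> carrier (End_K n)"
    unfolding End_K_zero End_K_one by (rule restrict_End_K; simp)+
  have neg: "restrict (\<lambda>f. - F f) (polys n) \<in> carrier (End_K n)" if "F \<in> carrier (End_K n)" for F :: "'a mpoly \<Rightarrow> 'a mpoly"
    using that by (auto simp: End_K_iff polys_add polys_mult polys_uminus)
  have cl: "F f \<in> polys n" if "F \<in> carrier (End_K n)" "f \<in> polys n" for F :: "'a mpoly \<Rightarrow> 'a mpoly" and f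
    using that by (auto simp: End_K_iff)
  show "abelian_group (End_K n :: ('a mpoly \<Rightarrow> 'a mpoly) ring)"
  proof (rule abelian_groupI)
    fix F G H :: "'a mpoly \<Rightarrow> 'a mpoly"
    assume F: "F \<in> carrier (End_K n)" and G: "G \<in> carrier (End_K n)" and H: "H \<in> carrier (End_K n)"
    show "(F \<oplus>\<^bsub>End_K n\<^esub> G) \<oplus>\<^bsub>End_K n\<^esub> H = F \<oplus>\<^bsub>End_K n\<^esub> (G \<oplus>\<^bsub>End_K n\<^esub> H)"
      by (rule ext) (intro add F G H, intro add F G H, simp add: End_K_add)
  next
    fix F G :: "'a mpoly \<Rightarrow> 'a mpoly"
    show "F \<oplus>\<^bsub>End_K n\<^esub> G = G \<oplus>\<^bsub>End_K n\<^esub> F" by (simp add: End_K_add add.commute)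
  next
    fix F :: "'a mpoly \<Rightarrow> 'a mpoly"
    assume F: "F \<in> carrier (End_K n)"
    show "\<zero>\<^bsub>End_K n\<^esub> \<oplus>\<^bsub>End_K n\<^esub> F = F"
      by (rule ext) (intro add zero F, rule F, simp add: End_K_add End_K_zero)
    have "restrict (\<lambda>f. - F f) (polys n) \<oplus>\<^bsub>End_K n\<^esub> F = \<zero>\<^bsub>End_K n\<^esub>"
      by (rule ext) (intro add neg F, rule zero, simp add: End_K_add End_K_zero)
    with neg[OF F] show "\<exists>G\<in>carrier (End_K n). G \<oplus>\<^bsub>End_K n\<^esub> F = \<zero>\<^bsub>End_K n\<^esub>" by blast
  qed (auto intro: add zero)
  show "monoid (End_K n :: ('a mpoly \<Rightarrow> 'a mpoly) ring)"
  proof (rule monoidI)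
    fix F G H :: "'a mpoly \<Rightarrow> 'a mpoly"
    assume F: "F \<in> carrier (End_K n)" and G: "G \<in> carrier (End_K n)" and H: "H \<in> carrier (End_K n)"
    show "(F \<otimes>\<^bsub>End_K n\<^esub> G) \<otimes>\<^bsub>End_K n\<^esub> H = F \<otimes>\<^bsub>End_K n\<^esub> (G \<otimes>\<^bsub>End_K n\<^esub> H)"
      by (rule ext) (intro mult F G H, intro mult F G H, simp add: End_K_mult cl H)
  next
    fix F :: "'a mpoly \<Rightarrow> 'a mpoly"
    assume F: "F \<in> carrier (End_K n)"
    show "\<one>\<^bsub>End_K n\<^esub> \<otimes>\<^bsub>End_K n\<^esub> F = F"
      by (rule ext) (intro mult one F, rule F, simp add: End_K_mult End_K_one cl F)
    show "F \<otimes>\<^bsub>End_K n\<^esub> \<one>\<^bsub>End_K n\<^esub> = F"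
      by (rule ext) (intro mult one F, rule F, simp add: End_K_mult End_K_one)
  qed (auto intro: mult one)
  fix F G H :: "'a mpoly \<Rightarrow> 'a mpoly"
  assume F: "F \<in> carrier (End_K n)" and G: "G \<in> carrier (End_K n)" and H: "H \<in> carrier (End_K n)"
  show "(F \<oplus>\<^bsub>End_K n\<^esub> G) \<otimes>\<^bsub>End_K n\<^esub> H = F \<otimes>\<^bsub>End_K n\<^esub> H \<oplus>\<^bsub>End_K n\<^esub> G \<otimes>\<^bsub>End_K n\<^esub> H"
    by (rule ext) (intro add mult F G H, intro add mult F G H, simp add: End_K_mult End_K_add cl H)
  have H_add: "H (f + g) = H f + H g" if "f \<in> polys n" "g \<in> polys n" for f g using H that by (auto simp: End_K_iff)
  show "H \<otimes>\<^bsub>End_K n\<^esub> (F \<oplus>\<^bsub>End_K n\<^esub> G) = H \<otimes>\<^bsub>End_K n\<^esub> F \<oplus>\<^bsub>End_K n\<^esub> H \<otimes>\<^bsub>End_K n\<^esub> G"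
    by (rule ext) (intro add mult F G H, intro add mult F G H, simp add: End_K_mult End_K_add cl F G H_add)
qed

lemma End_K_uminus:
  assumes "F \<in> carrier (End_K n)"
  shows "\<ominus>\<^bsub>End_K n\<^esub> F = restrict (\<lambda>f. - F f) (polys n)"
proof -
  interpret ring "End_K n" by (rule ring_End_K)
  have "restrict (\<lambda>f. - F f) (polys n) \<in> carrier (End_K n)"
    using assms by (auto simp: End_K_iff polys_add polys_mult polys_uminus)
  moreover have "restrict (\<lambda>f. - F f) (polys n) \<oplus>\<^bsub>End_K n\<^esub> F = \<zero>\<^bsub>End_K n\<^esub>"
    by (simp add: End_K_add End_K_zero cong: restrict_cong)
  ultimately show ?thesis using assms minus_equality by metis
qed

text \<open>The symbols of the operators in the Weyl algebra with index set \<open>I\<close>.\<close>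

definition syms :: "nat set \<Rightarrow> 'a::field_char_0 mpoly set" where
  "syms I = (\<Union>d. polys_le (symvars I) d)"

lemma symsI: "p \<in> polys_le (symvars I) d \<Longrightarrow> p \<in> syms I"
  by (auto simp: syms_def)

lemma syms_common:
  assumes "p \<in> syms I" "p' \<in> syms I"
  obtains d where "p \<in> polys_le (symvars I) d" "p' \<in> polys_le (symvars I) d"
proof -
  obtain d e where "p \<in> polys_le (symvars I) d" "p' \<in> polys_le (symvars I) e"
    using assms by (auto simp: syms_def)
  then have "p \<in> polys_le (symvars I) (max d e)" "p' \<in> polys_le (symvars I) (max d e)"
    using polys_le_mono[of d "max d e"] polys_le_mono[of e "max d e"] by (blast intro: max.cobounded1 max.cobounded2)+
  then show ?thesis using that by blast
qed

lemma syms_const: "const c \<in> syms I"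
  by (rule symsI[OF polys_le_const])

lemma syms_add: "p \<in> syms I \<Longrightarrow> p' \<in> syms I \<Longrightarrow> p + p' \<in> syms I"
  by (erule (1) syms_common) (blast intro: symsI polys_le_add)

lemma syms_uminus: "p \<in> syms I \<Longrightarrow> - p \<in> syms I"
  by (auto simp: syms_def intro: polys_le_uminus)

lemma syms_var: "k \<in> symvars I \<Longrightarrow> var k \<in> syms I"
  by (rule symsI[OF polys_le_var])

lemma polys_le_vars_mono: "J \<subseteq> J' \<Longrightarrow> polys_le J d \<subseteq> polys_le J' d"
  by (auto simp: polys_le_def exps_le_def)

lemma syms_eq: "syms I = {p. keys p \<subseteq> {m. keys m \<subseteq> symvars I}}"
proof (intro equalityI subsetI)
  fix p :: "'a mpoly" assume p: "p \<in> {p. keys p \<subseteq> {m. keys m \<subseteq> symvars I}}"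
  then have "keys p \<subseteq> exps_le (symvars I) (\<Sum>m\<in>keys p. tdeg m)"
    by (auto simp: exps_le_def intro: member_le_sum)
  then show "p \<in> syms I" by (intro symsI) (simp add: polys_le_def)
qed (auto simp: syms_def polys_le_def exps_le_def)

lemma syms_star: "I \<subseteq> {1..n} \<Longrightarrow> p \<in> syms I \<Longrightarrow> p' \<in> syms I \<Longrightarrow> star n p p' \<in> syms I"
  by (erule (1) syms_common) (blast intro: symsI star_polys_le)

lemma syms_mono: "I \<subseteq> I' \<Longrightarrow> syms I \<subseteq> syms I'"
  unfolding syms_def using polys_le_vars_mono[OF symvars_mono] by blast

text \<open>The polynomials carry the standard action of the Weyl algebra, prefixed by \<open>E\<close>, and the one with
  \<open>D\<^sub>i = \<Phi>\<^sub>i\<close>, prefixed by \<open>W\<close>.\<close>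

locale twisted =
  fixes n :: nat and q :: "'a::field_char_0 mpoly"
  assumes q: "q \<in> polys n"
begin

sublocale E: weyl_action mscale n "polys n" vmul pd
  using weyl_action_Phi[of 0 n] by (simp add: Phi_0[abs_def])

sublocale W: weyl_action mscale n "polys n" vmul "Phi q"
  by (rule weyl_action_Phi[OF q])

text \<open>The differential operator with a given symbol, and its image under \<open>\<partial>\<^sub>i \<mapsto> \<Phi>\<^sub>i\<close>.\<close>

definition dop :: "'a mpoly \<Rightarrow> 'a mpoly \<Rightarrow> 'a mpoly" where
  "dop p = restrict (E.op p) (polys n)"

definition tdop :: "'a mpoly \<Rightarrow> 'a mpoly \<Rightarrow> 'a mpoly" where
  "tdop p = restrict (W.op p) (polys n)"

lemma E_op_closed: "p \<in> syms {1..n} \<Longrightarrow> f \<in> polys n \<Longrightarrow> E.op p f \<in> polys n"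
  and W_op_closed: "p \<in> syms {1..n} \<Longrightarrow> f \<in> polys n \<Longrightarrow> W.op p f \<in> polys n"
  unfolding syms_def using E.op_stable[OF E.stable_V[OF order.refl]] W.op_stable[OF W.stable_V[OF order.refl]]
  by blast+

lemma E_op_const: "E.op p (const c * f) = const c * E.op p f" "E.op (const c * p) f = const c * E.op p f"
  unfolding mscale_def[symmetric, of c f] mscale_def[symmetric, of c "E.op p f"]
  by (rule E.op_vscale, rule E.op_const_mult)

lemma W_op_const: "W.op p (const c * f) = const c * W.op p f" "W.op (const c * p) f = const c * W.op p f"
  unfolding mscale_def[symmetric, of c f] mscale_def[symmetric, of c "W.op p f"]
  by (rule W.op_vscale, rule W.op_const_mult)

lemma dop_End: "p \<in> syms {1..n} \<Longrightarrow> dop p \<in> carrier (End_K n)"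
  unfolding dop_def
  by (rule restrict_End_K) (simp_all add: E_op_closed E.op_vadd E_op_const)

lemma tdop_End: "p \<in> syms {1..n} \<Longrightarrow> tdop p \<in> carrier (End_K n)"
  unfolding tdop_def
  by (rule restrict_End_K) (simp_all add: W_op_closed W.op_vadd W_op_const)

lemma dop_const: "dop (const c) = mul_op n (const c)"
  and tdop_const: "tdop (const c) = mul_op n (const c)"
  by (auto simp: dop_def tdop_def mul_op_def E.op_const W.op_const mscale_def)

lemma dop_1: "dop 1 = \<one>\<^bsub>End_K n\<^esub>"
  and tdop_1: "tdop 1 = \<one>\<^bsub>End_K n\<^esub>"
  using dop_const[of 1] tdop_const[of 1] by (simp_all add: mul_op_def End_K_one)

lemma dop_add: "dop (p + p') = dop p \<oplus>\<^bsub>End_K n\<^esub> dop p'"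
  and tdop_add: "tdop (p + p') = tdop p \<oplus>\<^bsub>End_K n\<^esub> tdop p'"
  by (auto simp: dop_def tdop_def End_K_add E.op_add W.op_add restrict_def)

lemma dop_uminus: "p \<in> syms {1..n} \<Longrightarrow> dop (- p) = \<ominus>\<^bsub>End_K n\<^esub> dop p"
  by (simp add: End_K_uminus dop_End) (auto simp: dop_def E.op_uminus restrict_def)

text \<open>The standard action is faithful: an operator that vanishes on all polynomials annihilates whatever
  operators make of \<open>1\<close>.\<close>

lemma dop_inj:
  assumes "p \<in> syms {1..n}" "p' \<in> syms {1..n}" "dop p = dop p'"
  shows "p = p'"
proof (rule ccontr)
  assume "p \<noteq> p'"
  then have "p - p' \<noteq> 0" by simp
  obtain d where d: "p \<in> polys_le (symvars {1..n}) d" "p' \<in> polys_le (symvars {1..n}) d"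
    using syms_common[OF assms(1,2)] .
  have stab: "E.stable {1..n} {0}" by (simp add: E.stable_def)
  have zero: "E.op (p - p') f = 0" if "f \<in> polys n" for f
    using fun_cong[OF assms(3), of f] that by (simp add: dop_def E.op_diff)
  have "(1::'a mpoly) \<in> {0}"
  proof (rule E.op_annihilates[OF order.refl stab polys_le_diff[OF d] \<open>p - p' \<noteq> 0\<close>])
    fix g assume "g \<in> exps_le (symvars {1..n}) d"
    then have "keys g \<subseteq> symvars {1..n}" by (simp add: exps_le_def)
    then have "E.mon_upto n g 1 \<in> polys n"
      by (rule E.mon_stable[OF E.stable_V[OF order.refl]]) simp
    then show "E.op (p - p') (E.mon_upto n g 1) \<in> {0}" using zero by blast
  qed
  then show False by simp
qed

lemma dop_left:
  assumes i: "i \<in> {1..n}" and p: "p \<in> syms {1..n}"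
  shows "mul_op n (var i) \<otimes>\<^bsub>End_K n\<^esub> dop p = dop (var (2 * i) * p)"
    and "pd_op n i \<otimes>\<^bsub>End_K n\<^esub> dop p = dop (var (2 * i + 1) * p + pd (2 * i) p)"
  unfolding dop_def End_K_mult mul_op_def pd_op_def
  using E_op_closed[OF p] E.X_op[OF i, of p] E.D_op[OF i, of p]
  by (auto intro!: restrict_ext simp: vmul_def)

lemma dop_scale: "p \<in> syms {1..n} \<Longrightarrow> mul_op n (const c) \<otimes>\<^bsub>End_K n\<^esub> dop p = dop (const c * p)"
  unfolding dop_def End_K_mult mul_op_def
  using E_op_closed by (auto intro!: restrict_ext simp: E_op_const)

lemma E_op_1: "E.op 1 f = f" and W_op_1: "W.op 1 f = f"
  using E.op_const[of 1 f] W.op_const[of 1 f] by (simp_all add: mscale_def)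

lemma pd_1: "pd k (1 :: 'a mpoly) = 0"
  using pd_const[of k 1] by simp

lemma dop_gens:
  assumes i: "i \<in> {1..n}"
  shows "mul_op n (var i) = dop (var (2 * i))" "pd_op n i = dop (var (2 * i + 1))"
proof -
  have "E.op (var (2 * i)) f = var i * f" for f :: "'a mpoly"
    using E.X_op[OF i, of 1 f] unfolding E_op_1 by (simp add: vmul_def[of i f])
  moreover have "E.op (var (2 * i + 1)) f = pd i f" for f :: "'a mpoly"
    using E.D_op[OF i, of 1 f] by (simp add: E_op_1 pd_1)
  ultimately show "mul_op n (var i) = dop (var (2 * i))" "pd_op n i = dop (var (2 * i + 1))"
    unfolding mul_op_def pd_op_def dop_def by (auto intro!: restrict_ext)
qed

lemma tdop_gens:
  assumes i: "i \<in> {1..n}"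
  shows "mul_op n (var i) = tdop (var (2 * i))" "(\<lambda>f\<in>polys n. Phi q i f) = tdop (var (2 * i + 1))"
proof -
  have "W.op (var (2 * i)) f = var i * f" for f
    using W.X_op[OF i, of 1 f] unfolding W_op_1 by (simp add: vmul_def[of i f])
  moreover have "W.op (var (2 * i + 1)) f = Phi q i f" for f
    using W.D_op[OF i, of 1 f] by (simp add: W_op_1 pd_1)
  ultimately show "mul_op n (var i) = tdop (var (2 * i))" "(\<lambda>f\<in>polys n. Phi q i f) = tdop (var (2 * i + 1))"
    unfolding mul_op_def tdop_def by (auto intro!: restrict_ext)
qed

lemma syms_gens: "i \<in> I \<Longrightarrow> var (2 * i) \<in> syms I" "i \<in> I \<Longrightarrow> var (2 * i + 1) \<in> syms I"
  by (rule syms_var[OF symvars_I(1)], assumption, rule syms_var[OF symvars_I(2)], assumption)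

lemma weyl_gens_syms:
  assumes I: "I \<subseteq> {1..n}"
  shows "scalar_ops n \<union> weyl_gens n I \<subseteq> dop ` syms I"
proof
  fix g :: "'a mpoly \<Rightarrow> 'a mpoly" assume "g \<in> scalar_ops n \<union> weyl_gens n I"
  then consider c where "g = mul_op n (const c)" | i where "i \<in> I" "g = mul_op n (var i)"
    | i where "i \<in> I" "g = pd_op n i" by (auto simp: scalar_ops_def weyl_gens_def)
  then show "g \<in> dop ` syms I"
  proof cases
    case 1
    then show ?thesis using dop_const syms_const by (metis image_eqI)
  next
    case 2
    then show ?thesis using dop_gens I syms_gens(1) by (metis image_eqI subsetD)
  next
    case 3
    then show ?thesis using dop_gens I syms_gens(2) by (metis image_eqI subsetD)
  qed
qed

lemma syms_subset: "I \<subseteq> {1..n} \<Longrightarrow> p \<in> syms I \<Longrightarrow> p \<in> syms {1..n}"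
  using syms_mono by blast

lemma dop_star: "p' \<in> syms {1..n} \<Longrightarrow> dop p \<otimes>\<^bsub>End_K n\<^esub> dop p' = dop (star n p p')"
  and tdop_star: "p' \<in> syms {1..n} \<Longrightarrow> tdop p \<otimes>\<^bsub>End_K n\<^esub> tdop p' = tdop (star n p p')"
  unfolding dop_def tdop_def End_K_mult
  using E_op_closed W_op_closed by (auto intro!: restrict_ext simp: E.op_star W.op_star)

lemma carrier_weyl_subset:
  assumes I: "I \<subseteq> {1..n}"
  shows "carrier (weyl n I) \<subseteq> dop ` syms I"
proof
  fix F :: "'a mpoly \<Rightarrow> 'a mpoly" assume "F \<in> carrier (weyl n I)"
  then have "F \<in> generate_ring (End_K n) (scalar_ops n \<union> weyl_gens n I)" by (simp add: weyl_def)
  then show "F \<in> dop ` syms I"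
  proof (induction rule: generate_ring.induct)
    case one
    show ?case using dop_1 syms_const[of 1] by (metis const_1 image_eqI)
  next
    case (incl h)
    then show ?case using weyl_gens_syms[OF I] by blast
  next
    case (a_inv h)
    then obtain p where "p \<in> syms I" "h = dop p" by blast
    then show ?case using dop_uminus[OF syms_subset[OF I]] by (intro image_eqI[of _ _ "- p"] syms_uminus) simp_all
  next
    case (eng_add F G)
    then obtain p p' where "p \<in> syms I" "F = dop p" "p' \<in> syms I" "G = dop p'" by blast
    then show ?case by (intro image_eqI[of _ _ "p + p'"] syms_add) (simp_all add: dop_add)
  next
    case (eng_mult F G)
    then obtain p p' where "p \<in> syms I" "F = dop p" "p' \<in> syms I" "G = dop p'" by blast
    then show ?case using dop_star[OF syms_subset[OF I], of p' p] syms_star[OF I, of p p'] by blast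
  qed
qed

lemma in_bernstein_mono: "in_bernstein n I j F \<Longrightarrow> j \<le> l \<Longrightarrow> in_bernstein n I l F"
proof (induction arbitrary: l rule: in_bernstein.induct)
  case (step g j F)
  then obtain l' where "l = Suc l'" "j \<le> l'" by (cases l) auto
  with step show ?case by (auto intro: in_bernstein.step)
qed (auto intro: in_bernstein.intros)

text \<open>Left multiplication by \<open>\<partial>\<^sub>i\<close> produces the wanted monomial together with one of lower degree.\<close>

lemma in_bernstein_single:
  assumes I: "I \<subseteq> {1..n}"
  shows "keys g \<subseteq> symvars I \<Longrightarrow> in_bernstein n I (tdeg g) (dop (single g c))"
proof (induction "tdeg g" arbitrary: g c rule: less_induct)
  case less
  show ?case
  proof (cases "g = 0")
    case True
    have "in_bernstein n I 0 (mul_op n (const c))" by (rule in_bernstein.scalar) (auto simp: scalar_ops_def)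
    with True show ?thesis by (simp add: const_def[symmetric] dop_const)
  next
    case False
    then obtain k where k: "lookup g k \<noteq> 0" by (metis lookup_zero poly_mapping_eqI)
    define h where "h = g - single k (1::nat)"
    have gh: "g = h + single k 1" by (simp add: h_def diff_single_add[OF k] del: One_nat_def)
    have h: "keys h \<subseteq> symvars I" "tdeg g = Suc (tdeg h)"
      using less.prems by (auto simp: gh keys_add_nat tdeg_add)
    have hs: "single h c \<in> syms {1..n}"
      using h(1) I by (intro syms_subset[OF I] symsI[where d = "tdeg h"] polys_le_single) (simp add: exps_le_def)
    have Bh: "in_bernstein n I (tdeg h) (dop (single h c))"
      using less.hyps[OF _ h(1)] h(2) by simp
    have "k \<in> symvars I" using less.prems k by (auto simp: in_keys_iff)
    then consider i where "i \<in> I" "k = 2 * i" | i where "i \<in> I" "k = 2 * i + 1" by (auto simp: symvars_def)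
    then show ?thesis
    proof cases
      case 1
      then have i: "i \<in> {1..n}" using I by blast
      have "dop (single g c) = mul_op n (var i) \<otimes>\<^bsub>End_K n\<^esub> dop (single h c)"
        unfolding dop_left(1)[OF i hs] gh 1(2) var_mult_single ..
      moreover have "mul_op n (var i) \<in> weyl_gens n I" using 1 by (simp add: weyl_gens_def)
      ultimately show ?thesis unfolding h(2) using in_bernstein.step Bh by metis
    next
      case 2
      then have i: "i \<in> {1..n}" using I by blast
      define e where "e = h - single (2 * i) (1::nat)"
      define c' where "c' = - (of_nat (lookup h (2 * i)) * c)"
      have e: "keys e \<subseteq> symvars I" "tdeg e \<le> tdeg h"
        unfolding e_def using order.trans[OF keys_diff_single h(1)] tdeg_diff_single by blast+
      have "single g c =
          (var (2 * i + 1) * single h c + pd (2 * i) (single h c)) + single e c'"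
        unfolding pd_single var_mult_single gh 2(2) e_def c'_def single_uminus by simp
      then have "dop (single g c) =
          pd_op n i \<otimes>\<^bsub>End_K n\<^esub> dop (single h c) \<oplus>\<^bsub>End_K n\<^esub> dop (single e c')"
        unfolding dop_left(2)[OF i hs] dop_add[symmetric] by simp
      moreover have "pd_op n i \<in> weyl_gens n I" using 2 by (simp add: weyl_gens_def)
      then have "in_bernstein n I (Suc (tdeg h)) (pd_op n i \<otimes>\<^bsub>End_K n\<^esub> dop (single h c))"
        using Bh by (rule in_bernstein.step)
      moreover have "in_bernstein n I (Suc (tdeg h)) (dop (single e c'))"
      proof (rule in_bernstein_mono)
        show "in_bernstein n I (tdeg e) (dop (single e c'))"
          using e(2) h(2) by (intro less.hyps e(1)) simp
      qed (use e(2) in simp)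
      ultimately show ?thesis unfolding h(2) by (simp only: in_bernstein.add)
    qed
  qed
qed

lemma bernstein_eq:
  assumes I: "I \<subseteq> {1..n}"
  shows "bernstein n I j = dop ` polys_le (symvars I) j"
proof (intro equalityI subsetI)
  fix F :: "'a mpoly \<Rightarrow> 'a mpoly" assume "F \<in> bernstein n I j"
  then have "in_bernstein n I j F" by (simp add: bernstein_def)
  then show "F \<in> dop ` polys_le (symvars I) j"
  proof (induction rule: in_bernstein.induct)
    case (scalar c j)
    then obtain a where a: "c = mul_op n (const a)" by (auto simp: scalar_ops_def)
    show ?case unfolding a dop_const[symmetric] by (intro imageI polys_le_const)
  next
    case (step g j F)
    then obtain p where p: "p \<in> polys_le (symvars I) j" "F = dop p" by blast
    then have ps: "p \<in> syms {1..n}" using syms_subset[OF I] symsI by blast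
    from step(1) consider i where "i \<in> I" "g = mul_op n (var i)" | i where "i \<in> I" "g = pd_op n i"
      by (auto simp: weyl_gens_def)
    then show ?case
    proof cases
      case 1
      then have i: "i \<in> {1..n}" using I by blast
      show ?thesis unfolding 1(2) p(2) dop_left(1)[OF i ps]
        using p(1) 1(1) by (intro imageI polys_le_var_mult symvars_I)
    next
      case 2
      then have i: "i \<in> {1..n}" using I by blast
      have "p \<in> polys_le (symvars I) (Suc j)" using p(1) polys_le_mono[of j "Suc j"] by auto
      then show ?thesis unfolding 2(2) p(2) dop_left(2)[OF i ps]
        using p(1) 2(1) by (intro imageI polys_le_add polys_le_pd' polys_le_var_mult symvars_I)
    qed
  next
    case (add j F G)
    then obtain p p' where "p \<in> polys_le (symvars I) j" "F = dop p" "p' \<in> polys_le (symvars I) j" "G = dop p'"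
      by blast
    then show ?case by (intro image_eqI[of _ _ "p + p'"] polys_le_add) (simp_all add: dop_add)
  qed
next
  fix F :: "'a mpoly \<Rightarrow> 'a mpoly" assume "F \<in> dop ` polys_le (symvars I) j"
  then obtain p where p: "p \<in> polys_le (symvars I) j" "F = dop p" by blast
  have "in_bernstein n I j (dop (\<Sum>g\<in>S. single g (lookup p g)))"
    if "finite S" "S \<subseteq> exps_le (symvars I) j" for S
    using that
  proof (induction S rule: finite_induct)
    case empty
    have "in_bernstein n I j (mul_op n (const (0 :: 'a)))"
      by (rule in_bernstein.scalar) (use scalar_ops_def in blast)
    then show ?case using dop_const[of 0] by simp
  next
    case (insert g S)
    have "in_bernstein n I j (dop (single g (lookup p g)))"
      using insert.prems by (intro in_bernstein_mono[OF in_bernstein_single[OF I]]) (auto simp: exps_le_def)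
    with insert show ?case by (simp add: dop_add in_bernstein.add)
  qed
  from this[of "keys p"] show "F \<in> bernstein n I j"
    using p by (simp add: bernstein_def polys_le_def poly_mapping_sum_single[symmetric])
qed

lemma carrier_weyl:
  assumes I: "I \<subseteq> {1..n}"
  shows "carrier (weyl n I) = dop ` syms I"
proof
  have "F \<in> carrier (weyl n I)" if "in_bernstein n I j F" for j and F :: "'a mpoly \<Rightarrow> 'a mpoly"
    using that unfolding weyl_def
    by (induction rule: in_bernstein.induct) (auto intro: generate_ring.intros)
  then have "bernstein n I j \<subseteq> (carrier (weyl n I) :: ('a mpoly \<Rightarrow> 'a mpoly) set)" for j by (auto simp: bernstein_def)
  then show "dop ` syms I \<subseteq> carrier (weyl n I)" unfolding syms_def bernstein_eq[OF I] by blast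
qed (rule carrier_weyl_subset[OF I])

lemma weyl_ops:
  "mult (weyl n I) = mult (End_K n)" "add (weyl n I) = add (End_K n)" "one (weyl n I) = one (End_K n)"
  "zero (weyl n I) = zero (End_K n)"
  by (simp_all add: weyl_def)

lemma gens_in_End:
  assumes I: "I \<subseteq> {1..n}"
  shows "(scalar_ops n \<union> weyl_gens n I :: ('a mpoly \<Rightarrow> 'a mpoly) set) \<subseteq> carrier (End_K n)"
proof
  fix g :: "'a mpoly \<Rightarrow> 'a mpoly" assume "g \<in> scalar_ops n \<union> weyl_gens n I"
  then obtain p where "p \<in> syms I" "g = dop p" using weyl_gens_syms[OF I] by blast
  then show "g \<in> carrier (End_K n)" using dop_End syms_subset[OF I] by blast
qed

lemma ring_weyl: "I \<subseteq> {1..n} \<Longrightarrow> ring (weyl n I :: ('a mpoly \<Rightarrow> 'a mpoly) ring)"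
  unfolding weyl_def by (rule ring.generate_ring_is_ring[OF ring_End_K gens_in_End])

text \<open>The automorphism \<open>\<partial>\<^sub>i \<mapsto> \<Phi>\<^sub>i\<close> replaces the operator with a given symbol by its twisted version.\<close>

definition tau :: "('a mpoly \<Rightarrow> 'a mpoly) \<Rightarrow> 'a mpoly \<Rightarrow> 'a mpoly" where
  "tau = restrict (\<lambda>F. tdop (the_inv_into (syms {1..n}) dop F)) (carrier (weyl n {1..n}))"

lemma tau_dop: "p \<in> syms {1..n} \<Longrightarrow> tau (dop p) = tdop p"
  unfolding tau_def carrier_weyl[OF order.refl]
  by (simp add: the_inv_into_f_f inj_on_def dop_inj)

lemma tau_ring_hom: "tau \<in> ring_hom (weyl n {1..n}) (End_K n)"
proof (rule ring_hom_memI)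
  note car = carrier_weyl[OF order.refl]
  fix F :: "'a mpoly \<Rightarrow> 'a mpoly" assume F: "F \<in> carrier (weyl n {1..n})"
  then show "tau F \<in> carrier (End_K n)" unfolding car using tau_dop tdop_End by auto
  fix G :: "'a mpoly \<Rightarrow> 'a mpoly" assume G: "G \<in> carrier (weyl n {1..n})"
  show "tau (F \<otimes>\<^bsub>weyl n {1..n}\<^esub> G) = tau F \<otimes>\<^bsub>End_K n\<^esub> tau G"
  proof -
    obtain p p' where p: "p \<in> syms {1..n}" "F = dop p" and p': "p' \<in> syms {1..n}" "G = dop p'"
      using F G unfolding car by blast
    show ?thesis
      unfolding weyl_ops p(2) p'(2) dop_star[OF p'(1)] tau_dop[OF p(1)] tau_dop[OF p'(1)] tdop_star[OF p'(1)]
      by (rule tau_dop[OF syms_star[OF order.refl p(1) p'(1)]])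
  qed
  show "tau (F \<oplus>\<^bsub>weyl n {1..n}\<^esub> G) = tau F \<oplus>\<^bsub>End_K n\<^esub> tau G"
    using F G unfolding car weyl_ops by (auto simp: dop_add[symmetric] tau_dop tdop_add syms_add)
next
  show "tau \<one>\<^bsub>weyl n {1..n}\<^esub> = \<one>\<^bsub>End_K n\<^esub>"
    unfolding weyl_ops using tau_dop[OF syms_const[of 1]] by (simp add: dop_1 tdop_1)
qed

lemma ring_hom_weyl_unique:
  fixes s t :: "('a mpoly \<Rightarrow> 'a mpoly) \<Rightarrow> 'a mpoly \<Rightarrow> 'a mpoly"
  assumes s: "s \<in> ring_hom (weyl n {1..n}) (End_K n)" and t: "t \<in> ring_hom (weyl n {1..n}) (End_K n)"
    and eq: "\<And>g. g \<in> scalar_ops n \<union> weyl_gens n {1..n} \<Longrightarrow> s g = t g"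
    and F: "F \<in> carrier (weyl n {1..n})"
  shows "s F = t F"
proof -
  interpret R: ring "End_K n :: ('a mpoly \<Rightarrow> 'a mpoly) ring" by (rule ring_End_K)
  interpret Wl: ring "weyl n {1..n} :: ('a mpoly \<Rightarrow> 'a mpoly) ring" by (rule ring_weyl[OF order.refl])
  interpret S: ring_hom_ring "weyl n {1..n}" "End_K n" s
    by (rule ring_hom_ringI2[OF ring_weyl[OF order.refl] ring_End_K s])
  interpret T: ring_hom_ring "weyl n {1..n}" "End_K n" t
    by (rule ring_hom_ringI2[OF ring_weyl[OF order.refl] ring_End_K t])
  have car: "carrier (weyl n {1..n}) = generate_ring (End_K n) (scalar_ops n \<union> weyl_gens n {1..n} :: ('a mpoly \<Rightarrow> 'a mpoly) set)"
    by (simp add: weyl_def)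
  have neg: "\<ominus>\<^bsub>End_K n\<^esub> G = \<ominus>\<^bsub>weyl n {1..n}\<^esub> G" if "G \<in> carrier (weyl n {1..n})" for G :: "'a mpoly \<Rightarrow> 'a mpoly"
  proof -
    have "subring (carrier (weyl n {1..n})) (End_K n :: ('a mpoly \<Rightarrow> 'a mpoly) ring)"
      unfolding car by (rule R.generate_ring_is_subring[OF gens_in_End[OF order.refl]])
    then have sub: "\<ominus>\<^bsub>End_K n\<^esub> G \<in> carrier (weyl n {1..n})" "G \<in> carrier (End_K n)"
      using that subringE(5) subsetD[OF subringE(1)] by metis+
    then have "\<ominus>\<^bsub>End_K n\<^esub> G \<oplus>\<^bsub>weyl n {1..n}\<^esub> G = \<zero>\<^bsub>weyl n {1..n}\<^esub>"
      unfolding weyl_ops by (simp add: R.l_neg)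
    then show ?thesis using sub that Wl.minus_equality by metis
  qed
  from F show ?thesis unfolding car
  proof (induction rule: generate_ring.induct)
    case one
    have "s \<one>\<^bsub>weyl n {1..n}\<^esub> = t \<one>\<^bsub>weyl n {1..n}\<^esub>" using ring_hom_one[OF s] ring_hom_one[OF t] by simp
    then show ?case unfolding weyl_ops .
  next
    case (incl h)
    then show ?case by (rule eq)
  next
    case (a_inv h)
    then have h: "h \<in> carrier (weyl n {1..n})" "s h = t h" unfolding car .
    show ?case unfolding neg[OF h(1)] S.hom_a_inv[OF h(1)] T.hom_a_inv[OF h(1)] h(2) ..
  next
    case (eng_add F G)
    then show ?case
      using ring_hom_add[OF s, of F G] ring_hom_add[OF t, of F G] unfolding car[symmetric] weyl_ops by simp
  next
    case (eng_mult F G)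
    then show ?case
      using ring_hom_mult[OF s, of F G] ring_hom_mult[OF t, of F G] unfolding car[symmetric] weyl_ops by simp
  qed
qed

lemma twist_eq_tau: "twist n q = tau"
  unfolding twist_def
proof (rule the_equality)
  show *: "tau \<in> ring_hom (weyl n {1..n}) (End_K n) \<and>
     tau \<in> extensional (carrier (weyl n {1..n})) \<and>
     (\<forall>c. tau (mul_op n (const c)) = mul_op n (const c)) \<and>
     (\<forall>i\<in>{1..n}. tau (mul_op n (var i)) = mul_op n (var i)) \<and>
     (\<forall>i\<in>{1..n}. tau (pd_op n i) = (\<lambda>f\<in>polys n. Phi q i f))"
  proof (intro conjI allI ballI tau_ring_hom)
    show "tau \<in> extensional (carrier (weyl n {1..n}))" by (simp add: tau_def)
    show "tau (mul_op n (const c)) = mul_op n (const c)" for c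
      using tau_dop[OF syms_const[of c]] by (simp add: dop_const tdop_const)
    fix i assume i: "i \<in> {1..n}"
    have v: "var (2 * i) \<in> syms {1..n}" "var (2 * i + 1) \<in> syms {1..n}" using i by (rule syms_gens)+
    show "tau (mul_op n (var i)) = mul_op n (var i)"
      using tau_dop[OF v(1)] dop_gens(1)[OF i] tdop_gens(1)[OF i] by simp
    show "tau (pd_op n i) = (\<lambda>f\<in>polys n. Phi q i f)"
      unfolding dop_gens(2)[OF i] tau_dop[OF v(2)] tdop_gens(2)[OF i] ..
  qed
  fix s assume s: "s \<in> ring_hom (weyl n {1..n}) (End_K n) \<and>
     s \<in> extensional (carrier (weyl n {1..n})) \<and>
     (\<forall>c. s (mul_op n (const c)) = mul_op n (const c)) \<and>
     (\<forall>i\<in>{1..n}. s (mul_op n (var i)) = mul_op n (var i)) \<and>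
     (\<forall>i\<in>{1..n}. s (pd_op n i) = (\<lambda>f\<in>polys n. Phi q i f))"
  show "s = tau"
  proof (rule extensionalityI[of _ "carrier (weyl n {1..n})"])
    fix F :: "'a mpoly \<Rightarrow> 'a mpoly" assume F: "F \<in> carrier (weyl n {1..n})"
    show "s F = tau F"
    proof (rule ring_hom_weyl_unique[OF _ tau_ring_hom _ F])
      fix g :: "'a mpoly \<Rightarrow> 'a mpoly" assume "g \<in> scalar_ops n \<union> weyl_gens n {1..n}"
      then show "s g = tau g" using s * unfolding scalar_ops_def weyl_gens_def by auto
    qed (use s in blast)
  qed (use s * in blast)+
qed

lemma twist_dop: "p \<in> syms {1..n} \<Longrightarrow> f \<in> polys n \<Longrightarrow> twist n q (dop p) f = W.op p f"
  by (simp add: twist_eq_tau tau_dop tdop_def)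

end

section \<open>The quotient module\<close>

lemma scalar_field_ops:
  "mult (scalar_field n) = mult (End_K n)" "add (scalar_field n) = add (End_K n)"
  "one (scalar_field n) = one (End_K n)" "zero (scalar_field n) = zero (End_K n)"
  "carrier (scalar_field n) = scalar_ops n"
  by (simp_all add: scalar_field_def)

context twisted
begin

lemma scalar_ops_eq: "scalar_ops n = range (\<lambda>c :: 'a. mul_op n (const c))"
  by (auto simp: scalar_ops_def)

lemma scalar_mult: "mul_op n (const (c :: 'a)) \<otimes>\<^bsub>End_K n\<^esub> mul_op n (const d) = mul_op n (const (c * d))"
  and scalar_add: "mul_op n (const (c :: 'a)) \<oplus>\<^bsub>End_K n\<^esub> mul_op n (const d) = mul_op n (const (c + d))"
  using dop_scale[OF syms_const[of d "{1..n}"], of c] dop_add[of "const c" "const d"]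
  by (simp_all add: dop_const const_mult[symmetric] const_add[symmetric])

lemma scalar_one: "\<one>\<^bsub>End_K n\<^esub> = mul_op n (const (1 :: 'a))"
  and scalar_zero: "\<zero>\<^bsub>End_K n\<^esub> = mul_op n (const (0 :: 'a))"
  by (auto simp: End_K_one End_K_zero mul_op_def intro!: restrict_ext)

lemma scalar_inj: "mul_op n (const c) = mul_op n (const (d :: 'a)) \<Longrightarrow> c = d"
proof -
  assume "mul_op n (const c) = mul_op n (const d)"
  from fun_cong[OF this, of 1] have "const c = const d" by (simp add: mul_op_def)
  from arg_cong[OF this, of "\<lambda>p. lookup p 0"] show ?thesis by (simp add: const_def)
qed

lemma field_scalar_field: "field (scalar_field n :: ('a mpoly \<Rightarrow> 'a mpoly) ring)"
proof -
  interpret R: ring "End_K n :: ('a mpoly \<Rightarrow> 'a mpoly) ring" by (rule ring_End_K)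
  have sub: "(scalar_ops n :: ('a mpoly \<Rightarrow> 'a mpoly) set) \<subseteq> carrier (End_K n)"
    using gens_in_End[of "{}"] by simp
  have neg: "\<ominus>\<^bsub>End_K n\<^esub> mul_op n (const c) = mul_op n (const (- c))" for c :: 'a
    using dop_uminus[OF syms_const[of c]] unfolding const_minus[symmetric] dop_const by simp
  have "subring (scalar_ops n) (End_K n :: ('a mpoly \<Rightarrow> 'a mpoly) ring)"
  proof (rule R.subringI[OF sub])
    show "\<one>\<^bsub>End_K n\<^esub> \<in> (scalar_ops n :: ('a mpoly \<Rightarrow> 'a mpoly) set)"
      unfolding scalar_one scalar_ops_eq by (rule rangeI)
  qed (auto simp: scalar_ops_eq scalar_mult scalar_add neg)
  then have "ring (scalar_field n :: ('a mpoly \<Rightarrow> 'a mpoly) ring)"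
    unfolding scalar_field_def by (rule R.subring_is_ring)
  then interpret S: ring "scalar_field n :: ('a mpoly \<Rightarrow> 'a mpoly) ring" .
  have "cring (scalar_field n :: ('a mpoly \<Rightarrow> 'a mpoly) ring)"
    by unfold_locales (auto simp: scalar_field_ops scalar_ops_eq scalar_mult mult.commute)
  then interpret S: cring "scalar_field n :: ('a mpoly \<Rightarrow> 'a mpoly) ring" .
  show ?thesis
  proof (rule S.cring_fieldI2)
    show "\<zero>\<^bsub>scalar_field n\<^esub> \<noteq> \<one>\<^bsub>scalar_field n :: ('a mpoly \<Rightarrow> 'a mpoly) ring\<^esub>"
      unfolding scalar_field_ops scalar_one scalar_zero using scalar_inj[of 0 1] by auto
    fix F :: "'a mpoly \<Rightarrow> 'a mpoly" assume F: "F \<in> carrier (scalar_field n)" "F \<noteq> \<zero>\<^bsub>scalar_field n\<^esub>"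
    then obtain c where c: "F = mul_op n (const c)" by (auto simp: scalar_field_ops scalar_ops_eq)
    then have "c \<noteq> 0" using F(2) unfolding scalar_field_ops scalar_zero by auto
    then have "F \<otimes>\<^bsub>End_K n\<^esub> mul_op n (const (inverse c)) = \<one>\<^bsub>End_K n\<^esub>"
      unfolding c scalar_mult scalar_one by simp
    then show "\<exists>G\<in>carrier (scalar_field n). F \<otimes>\<^bsub>scalar_field n\<^esub> G = \<one>\<^bsub>scalar_field n\<^esub>"
      unfolding scalar_field_ops scalar_ops_eq by blast
  qed
qed

text \<open>The module \<open>\<M>\<close>.\<close>

abbreviation M :: "('a mpoly \<Rightarrow> 'a mpoly, 'a mpoly) module" where
  "M \<equiv> twisted_module n q"

lemma M_simps: "carrier M = polys n" "add M = (+)" "zero M = 0" "smult M = twist n q"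
  by (simp_all add: twisted_module_def)

lemma M_smult: "p \<in> syms {1..n} \<Longrightarrow> f \<in> polys n \<Longrightarrow> dop p \<odot>\<^bsub>M\<^esub> f = W.op p f"
  by (simp add: M_simps twist_dop)

lemma abelian_group_M: "abelian_group M"
proof (rule abelian_groupI)
  fix f assume "f \<in> carrier M"
  then show "\<exists>g\<in>carrier M. g \<oplus>\<^bsub>M\<^esub> f = \<zero>\<^bsub>M\<^esub>"
    by (intro bexI[of _ "- f"]) (simp_all add: M_simps polys_uminus)
qed (simp_all add: M_simps polys_add add.assoc add.commute)

lemma left_module_M:
  assumes I: "I \<subseteq> {1..n}"
  shows "left_module (weyl n I) M"
proof (intro left_module.intro ring_weyl[OF I] abelian_group_M left_module_axioms.intro)
  note car = carrier_weyl[OF I]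
  have s: "p \<in> syms {1..n}" if "p \<in> syms I" for p using that by (rule syms_subset[OF I])
  fix F G :: "'a mpoly \<Rightarrow> 'a mpoly" and f g
  assume f: "f \<in> carrier M"
  then have f': "f \<in> polys n" by (simp add: M_simps)
  show "\<one>\<^bsub>weyl n I\<^esub> \<odot>\<^bsub>M\<^esub> f = f"
    using M_smult[OF syms_const f', of 1] by (simp add: weyl_ops dop_1 W_op_1)
  assume F: "F \<in> carrier (weyl n I)"
  then obtain p where p: "p \<in> syms I" "F = dop p" unfolding car by blast
  show "F \<odot>\<^bsub>M\<^esub> f \<in> carrier M"
    unfolding p(2) M_smult[OF s[OF p(1)] f'] using W_op_closed[OF s[OF p(1)] f'] by (simp add: M_simps)
  show "F \<odot>\<^bsub>M\<^esub> (f \<oplus>\<^bsub>M\<^esub> g) = F \<odot>\<^bsub>M\<^esub> f \<oplus>\<^bsub>M\<^esub> F \<odot>\<^bsub>M\<^esub> g" if "g \<in> carrier M"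
    using that f' s[OF p(1)] M_smult[of p] unfolding p(2) by (simp add: M_simps polys_add W.op_vadd)
  assume G: "G \<in> carrier (weyl n I)"
  then obtain p' where p': "p' \<in> syms I" "G = dop p'" unfolding car by blast
  show "(F \<oplus>\<^bsub>weyl n I\<^esub> G) \<odot>\<^bsub>M\<^esub> f = F \<odot>\<^bsub>M\<^esub> f \<oplus>\<^bsub>M\<^esub> G \<odot>\<^bsub>M\<^esub> f"
    unfolding p(2) p'(2) weyl_ops dop_add[symmetric]
      M_smult[OF s[OF p(1)] f'] M_smult[OF s[OF p'(1)] f'] M_smult[OF s[OF syms_add[OF p(1) p'(1)]] f']
    by (simp add: M_simps W.op_add)
  show "(F \<otimes>\<^bsub>weyl n I\<^esub> G) \<odot>\<^bsub>M\<^esub> f = F \<odot>\<^bsub>M\<^esub> (G \<odot>\<^bsub>M\<^esub> f)"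
    unfolding p(2) p'(2) weyl_ops dop_star[OF s[OF p'(1)]] M_smult[OF s[OF syms_star[OF I p(1) p'(1)]] f']
      M_smult[OF s[OF p'(1)] f'] M_smult[OF s[OF p(1)] W_op_closed[OF s[OF p'(1)] f']] W.op_star ..
qed

lemma submodule_M:
  assumes I: "I \<subseteq> {1..n}" and U: "W.stable I U" "U \<subseteq> polys n"
  shows "left_submodule U (weyl n I) M"
  unfolding left_submodule_def
proof (intro conjI left_module_M[OF I])
  note sub = W.stableD(1)[OF U(1)]
  have inv: "a_inv M f = - f" if "f \<in> polys n" for f
    using abelian_group.minus_equality[OF abelian_group_M, of "- f" f] that
    by (simp add: M_simps polys_uminus)
  have "group (add_monoid M)" using abelian_group.a_group[OF abelian_group_M] .
  then have "subgroup U (add_monoid M)"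
  proof (rule group.subgroupI)
    show "U \<subseteq> carrier (add_monoid M)" using U(2) by (simp add: M_simps)
    show "U \<noteq> {}" using mv.subspace_0[OF sub] by blast
    fix f g assume f: "f \<in> U"
    have "inv\<^bsub>add_monoid M\<^esub> f = - f" using inv[of f] f U(2) unfolding a_inv_def by blast
    then show "inv\<^bsub>add_monoid M\<^esub> f \<in> U" using mv.subspace_neg[OF sub f] by simp
    assume g: "g \<in> U"
    show "f \<otimes>\<^bsub>add_monoid M\<^esub> g \<in> U" using mv.subspace_add[OF sub f g] by (simp add: M_simps)
  qed
  then show "Module.submodule U (weyl n I) M"
  proof (intro Module.submodule.intro Module.submodule_axioms.intro)
    fix F :: "'a mpoly \<Rightarrow> 'a mpoly" and f assume "F \<in> carrier (weyl n I)" and f: "f \<in> U"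
    then obtain p where p: "p \<in> syms I" "F = dop p" unfolding carrier_weyl[OF I] by blast
    then obtain d where "p \<in> polys_le (symvars I) d" by (auto simp: syms_def)
    from W.op_stable[OF U(1) this f] show "F \<odot>\<^bsub>M\<^esub> f \<in> U"
      using M_smult[OF syms_subset[OF I p(1)]] f U(2) unfolding p(2) by (metis subsetD)
  qed
qed

end

text \<open>The quotient \<open>Q\<close> of \<open>\<M>\<close> by a submodule \<open>U\<close> over the Weyl algebra with index set \<open>I\<close>.\<close>

locale twisted_quotient = twisted n q
  for n and q :: "'a::field_char_0 mpoly" +
  fixes I :: "nat set" and U :: "'a mpoly set"
  assumes I: "I \<subseteq> {1..n}" and U: "W.stable I U" and U_polys: "U \<subseteq> polys n"
begin

lemmas subU = W.stableD(1)[OF U]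

text \<open>Right cosets of \<open>U\<close> in \<open>\<M>\<close> as a plain set.\<close>

definition coset :: "'a mpoly \<Rightarrow> 'a mpoly set" where
  "coset x = {h + x |h. h \<in> U}"

abbreviation Q :: "('a mpoly \<Rightarrow> 'a mpoly, 'a mpoly set) module" where
  "Q \<equiv> quot_module M U"

lemma coset_eq_iff: "coset x = coset y \<longleftrightarrow> x - y \<in> U"
proof
  assume eq: "coset x = coset y"
  have "x \<in> coset x" using mv.subspace_0[OF subU] by (force simp: coset_def)
  then obtain h where "h \<in> U" "x = h + y" unfolding eq by (auto simp: coset_def)
  then show "x - y \<in> U" by simp
next
  assume xy: "x - y \<in> U"
  show "coset x = coset y"
  proof (intro equalityI subsetI)
    fix z assume "z \<in> coset x"
    then obtain h where "h \<in> U" "z = h + x" by (auto simp: coset_def)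
    then have "h + (x - y) \<in> U" "z = (h + (x - y)) + y" using mv.subspace_add[OF subU _ xy] by auto
    then show "z \<in> coset y" unfolding coset_def by blast
  next
    fix z assume "z \<in> coset y"
    then obtain h where "h \<in> U" "z = h + y" by (auto simp: coset_def)
    then have "h - (x - y) \<in> U" "z = (h - (x - y)) + x" using mv.subspace_diff[OF subU _ xy] by auto
    then show "z \<in> coset x" unfolding coset_def by blast
  qed
qed

lemma coset_0: "coset 0 = U"
  by (simp add: coset_def)

lemma a_r_coset_M: "U +>\<^bsub>M\<^esub> x = coset x"
  by (auto simp: a_r_coset_def r_coset_def coset_def M_simps)

lemma a_rcosets_M: "a_rcosets\<^bsub>M\<^esub> U = coset ` polys n"
  by (auto simp: A_RCOSETS_def RCOSETS_def r_coset_def coset_def M_simps)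

lemma Q_simps: "carrier Q = coset ` polys n" "zero Q = U" "add Q = set_add M"
    "smult Q = (\<lambda>r X. \<Union>x\<in>X. coset (r \<odot>\<^bsub>M\<^esub> x))"
  by (simp_all add: quot_module_def a_rcosets_M a_r_coset_M)

lemma coset_add: "coset x \<oplus>\<^bsub>Q\<^esub> coset y = coset (x + y)"
proof (intro equalityI subsetI)
  fix z assume "z \<in> coset x \<oplus>\<^bsub>Q\<^esub> coset y"
  then obtain h h' where "h \<in> U" "h' \<in> U" "z = (h + x) + (h' + y)"
    by (auto simp: Q_simps set_add_def set_mult_def coset_def M_simps)
  then have "h + h' \<in> U" "z = (h + h') + (x + y)" using mv.subspace_add[OF subU] by (auto simp: algebra_simps)
  then show "z \<in> coset (x + y)" by (auto simp: coset_def)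
next
  fix z assume "z \<in> coset (x + y)"
  then obtain h where "h \<in> U" "z = (h + x) + (0 + y)" by (auto simp: coset_def algebra_simps)
  then show "z \<in> coset x \<oplus>\<^bsub>Q\<^esub> coset y"
    using mv.subspace_0[OF subU] unfolding Q_simps set_add_def set_mult_def coset_def by (auto simp: M_simps)
qed

lemma coset_smult:
  assumes p: "p \<in> syms I" and x: "x \<in> polys n"
  shows "dop p \<odot>\<^bsub>Q\<^esub> coset x = coset (W.op p x)"
proof -
  obtain d where d: "p \<in> polys_le (symvars I) d" using p by (auto simp: syms_def)
  have "coset (dop p \<odot>\<^bsub>M\<^esub> y) = coset (W.op p x)" if y: "y \<in> coset x" for y
  proof -
    obtain h where h: "h \<in> U" "y = h + x" using y by (auto simp: coset_def)
    have "y \<in> polys n" using h x U_polys by (auto intro: polys_add)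
    then have "dop p \<odot>\<^bsub>M\<^esub> y = W.op p h + W.op p x"
      using M_smult[OF syms_subset[OF I p]] h(2) by (simp add: W.op_vadd)
    then show ?thesis using W.op_stable[OF U d h(1)] by (simp add: coset_eq_iff)
  qed
  moreover have "x \<in> coset x" using mv.subspace_0[OF subU] by (force simp: coset_def)
  ultimately show ?thesis unfolding Q_simps by blast
qed

text \<open>Subspaces of \<open>\<M>\<close>, whose images in \<open>Q\<close> are studied.\<close>

definition image_sub :: "'a mpoly set \<Rightarrow> bool" where
  "image_sub Y \<longleftrightarrow> mv.subspace Y \<and> Y \<subseteq> polys n"

lemma image_subD: "image_sub Y \<Longrightarrow> mv.subspace Y" "image_sub Y \<Longrightarrow> x \<in> Y \<Longrightarrow> x \<in> polys n"
  by (auto simp: image_sub_def)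

lemma image_sub_polys: "image_sub (polys n)"
  using W.V by (simp add: image_sub_def)

abbreviation Q_on :: "'a mpoly set \<Rightarrow> ('a mpoly \<Rightarrow> 'a mpoly, 'a mpoly set) module" where
  "Q_on Y \<equiv> Q\<lparr>carrier := coset ` Y\<rparr>"

lemma abelian_group_image:
  assumes Y: "image_sub Y"
  shows "abelian_group (Q_on Y)"
proof (rule abelian_groupI)
  note sub = image_subD(1)[OF Y]
  fix A B assume "A \<in> carrier (Q_on Y)" "B \<in> carrier (Q_on Y)"
  then obtain a b where ab: "a \<in> Y" "A = coset a" "b \<in> Y" "B = coset b" by auto
  show "A \<oplus>\<^bsub>Q_on Y\<^esub> B \<in> carrier (Q_on Y)"
    using mv.subspace_add[OF sub ab(1,3)] by (simp add: ab coset_add)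
  show "A \<oplus>\<^bsub>Q_on Y\<^esub> B = B \<oplus>\<^bsub>Q_on Y\<^esub> A"
    by (simp add: ab coset_add add.commute)
  fix C assume "C \<in> carrier (Q_on Y)"
  then obtain c where c: "c \<in> Y" "C = coset c" by auto
  show "(A \<oplus>\<^bsub>Q_on Y\<^esub> B) \<oplus>\<^bsub>Q_on Y\<^esub> C =
      A \<oplus>\<^bsub>Q_on Y\<^esub> (B \<oplus>\<^bsub>Q_on Y\<^esub> C)"
    by (simp add: ab c coset_add add.assoc)
next
  note sub = image_subD(1)[OF Y]
  have zero: "\<zero>\<^bsub>Q_on Y\<^esub> = coset 0" by (simp add: Q_simps coset_0)
  show "\<zero>\<^bsub>Q_on Y\<^esub> \<in> carrier (Q_on Y)"
    unfolding zero using mv.subspace_0[OF sub] by simp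
  fix A assume "A \<in> carrier (Q_on Y)"
  then obtain a where a: "a \<in> Y" "A = coset a" by auto
  show "\<zero>\<^bsub>Q_on Y\<^esub> \<oplus>\<^bsub>Q_on Y\<^esub> A = A"
    unfolding zero by (simp add: a coset_add)
  show "\<exists>B\<in>carrier (Q_on Y). B \<oplus>\<^bsub>Q_on Y\<^esub> A = \<zero>\<^bsub>Q_on Y\<^esub>"
    unfolding zero using mv.subspace_neg[OF sub a(1)]
    by (intro bexI[of _ "coset (- a)"]) (simp_all add: a coset_add)
qed

lemma finsum_image:
  assumes Y: "image_sub Y" and fin: "finite A"
    and f: "\<And>a. a \<in> A \<Longrightarrow> f a \<in> Y" and F: "\<And>a. a \<in> A \<Longrightarrow> F a = coset (f a)"
  shows "(\<Oplus>\<^bsub>Q_on Y\<^esub> a\<in>A. F a) = coset (\<Sum>a\<in>A. f a)"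
proof -
  interpret N: abelian_group "Q_on Y" by (rule abelian_group_image[OF Y])
  from fin f F show ?thesis
  proof (induction A rule: finite_induct)
    case empty
    show ?case by (simp add: Q_simps coset_0)
  next
    case (insert a A)
    have "F \<in> A \<rightarrow> carrier (Q_on Y)" "F a \<in> carrier (Q_on Y)"
      using insert.prems by auto
    with insert show ?case by (simp add: N.finsum_insert coset_add)
  qed
qed

lemma Q_eq: "Q\<lparr>carrier := coset ` polys n\<rparr> = Q"
  by (simp add: quot_module_def a_rcosets_M)

lemma left_module_Q: "left_module (weyl n I) Q"
proof (intro left_module.intro ring_weyl[OF I] left_module_axioms.intro)
  show "abelian_group Q" using abelian_group_image[OF image_sub_polys] by (simp only: Q_eq)
  note s = syms_subset[OF I]
  fix F G :: "'a mpoly \<Rightarrow> 'a mpoly" and A B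
  assume "A \<in> carrier Q"
  then obtain a where a: "a \<in> polys n" "A = coset a" by (auto simp: Q_simps)
  show "\<one>\<^bsub>weyl n I\<^esub> \<odot>\<^bsub>Q\<^esub> A = A"
    using coset_smult[OF syms_const a(1), of 1] by (simp add: weyl_ops dop_1 W_op_1 a(2))
  assume "F \<in> carrier (weyl n I)"
  then obtain p where p: "p \<in> syms I" "F = dop p" unfolding carrier_weyl[OF I] by blast
  show "F \<odot>\<^bsub>Q\<^esub> A \<in> carrier Q"
    unfolding p(2) a(2) coset_smult[OF p(1) a(1)] using W_op_closed[OF s[OF p(1)] a(1)] by (simp add: Q_simps)
  show "F \<odot>\<^bsub>Q\<^esub> (A \<oplus>\<^bsub>Q\<^esub> B) = F \<odot>\<^bsub>Q\<^esub> A \<oplus>\<^bsub>Q\<^esub> F \<odot>\<^bsub>Q\<^esub> B" if "B \<in> carrier Q"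
  proof -
    from that obtain b where b: "b \<in> polys n" "B = coset b" by (auto simp: Q_simps)
    show ?thesis
      unfolding p(2) a(2) b(2) coset_add coset_smult[OF p(1) a(1)] coset_smult[OF p(1) b(1)]
        coset_smult[OF p(1) polys_add[OF a(1) b(1)]] W.op_vadd ..
  qed
  assume "G \<in> carrier (weyl n I)"
  then obtain p' where p': "p' \<in> syms I" "G = dop p'" unfolding carrier_weyl[OF I] by blast
  show "(F \<oplus>\<^bsub>weyl n I\<^esub> G) \<odot>\<^bsub>Q\<^esub> A = F \<odot>\<^bsub>Q\<^esub> A \<oplus>\<^bsub>Q\<^esub> G \<odot>\<^bsub>Q\<^esub> A"
    unfolding p(2) p'(2) a(2) weyl_ops dop_add[symmetric] coset_smult[OF p(1) a(1)] coset_smult[OF p'(1) a(1)]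
      coset_smult[OF syms_add[OF p(1) p'(1)] a(1)] coset_add W.op_add ..
  show "(F \<otimes>\<^bsub>weyl n I\<^esub> G) \<odot>\<^bsub>Q\<^esub> A = F \<odot>\<^bsub>Q\<^esub> (G \<odot>\<^bsub>Q\<^esub> A)"
    unfolding p(2) p'(2) a(2) weyl_ops dop_star[OF s[OF p'(1)]] coset_smult[OF syms_star[OF I p(1) p'(1)] a(1)]
      coset_smult[OF p'(1) a(1)] coset_smult[OF p(1) W_op_closed[OF s[OF p'(1)] a(1)]] W.op_star ..
qed

lemma scalar_smult: "x \<in> polys n \<Longrightarrow> mul_op n (const c) \<odot>\<^bsub>Q\<^esub> coset x = coset (mscale c x)"
  using coset_smult[OF syms_const, of x c] by (simp add: dop_const W.op_const)

lemma vectorspace_image: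
  assumes Y: "image_sub Y"
  shows "vectorspace (scalar_field n) (Q_on Y)"
proof -
  note sub = image_subD(1)[OF Y]
  have K: "field (scalar_field n :: ('a mpoly \<Rightarrow> 'a mpoly) ring)" by (rule field_scalar_field)
  have "Module.module (scalar_field n) (Q_on Y)"
  proof (rule moduleI)
    show "cring (scalar_field n :: ('a mpoly \<Rightarrow> 'a mpoly) ring)" by (rule fieldE(1)[OF K])
    show "abelian_group (Q_on Y)" by (rule abelian_group_image[OF Y])
    fix F G :: "'a mpoly \<Rightarrow> 'a mpoly" and A B
    assume "A \<in> carrier (Q_on Y)"
    then obtain a where a: "a \<in> Y" "A = coset a" by auto
    then have a': "a \<in> polys n" using image_subD(2)[OF Y] by blast
    show "\<one>\<^bsub>scalar_field n\<^esub> \<odot>\<^bsub>Q_on Y\<^esub> A = A"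
      using scalar_smult[OF a', of 1] by (simp add: scalar_field_ops scalar_one a(2))
    assume "F \<in> carrier (scalar_field n)"
    then obtain c where c: "F = mul_op n (const c)" by (auto simp: scalar_field_ops scalar_ops_eq)
    show "F \<odot>\<^bsub>Q_on Y\<^esub> A \<in> carrier (Q_on Y)"
      using mv.subspace_scale[OF sub a(1)] by (simp add: c a(2) scalar_smult[OF a'])
    show "F \<odot>\<^bsub>Q_on Y\<^esub> (A \<oplus>\<^bsub>Q_on Y\<^esub> B) =
        F \<odot>\<^bsub>Q_on Y\<^esub> A \<oplus>\<^bsub>Q_on Y\<^esub> F \<odot>\<^bsub>Q_on Y\<^esub> B"
      if "B \<in> carrier (Q_on Y)"
    proof -
      from that obtain b where b: "b \<in> Y" "B = coset b" by auto
      then have "b \<in> polys n" using image_subD(2)[OF Y] by blast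
      then show ?thesis using a' by (simp add: c a(2) b(2) coset_add scalar_smult polys_add mv.scale_right_distrib)
    qed
    assume "G \<in> carrier (scalar_field n)"
    then obtain d where d: "G = mul_op n (const d)" by (auto simp: scalar_field_ops scalar_ops_eq)
    show "(F \<oplus>\<^bsub>scalar_field n\<^esub> G) \<odot>\<^bsub>Q_on Y\<^esub> A =
        F \<odot>\<^bsub>Q_on Y\<^esub> A \<oplus>\<^bsub>Q_on Y\<^esub> G \<odot>\<^bsub>Q_on Y\<^esub> A"
      by (simp add: c d a(2) scalar_field_ops scalar_add coset_add scalar_smult[OF a'] mv.scale_left_distrib)
    have "mscale d a \<in> polys n" using a' by (simp add: mscale_def polys_mult)
    then show "(F \<otimes>\<^bsub>scalar_field n\<^esub> G) \<odot>\<^bsub>Q_on Y\<^esub> A =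
        F \<odot>\<^bsub>Q_on Y\<^esub> (G \<odot>\<^bsub>Q_on Y\<^esub> A)"
      by (simp add: c d a(2) scalar_field_ops scalar_mult scalar_smult[OF a'] scalar_smult)
  qed
  then show ?thesis using K by (simp add: vectorspace_def)
qed

text \<open>The dimension of a subspace of the quotient is the size of a family that spans it and is
  independent modulo \<open>U\<close>.\<close>

lemma dim_image:
  assumes T: "mv.indep_mod U T f" and Y: "Y = mv.span (U \<union> f ` T)" and YV: "Y \<subseteq> polys n"
  shows "dim_K n Q (coset ` Y) = card T"
proof -
  have fin: "finite T" using T by (rule mv.indep_mod_finite)
  have im: "image_sub Y" using YV by (simp add: image_sub_def Y mv.subspace_span)
  note sub = image_subD(1)[OF im]
  have fY: "f t \<in> Y" if "t \<in> T" for t unfolding Y using that by (intro mv.span_base) blast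
  have fV: "f t \<in> polys n" if "t \<in> T" for t using fY[OF that] YV by blast
  interpret N: vectorspace "scalar_field n :: ('a mpoly \<Rightarrow> 'a mpoly) ring" "Q_on Y"
    by (rule vectorspace_image[OF im])
  define h where "h t = coset (f t)" for t
  have inj: "inj_on h T"
  proof (rule inj_onI, rule ccontr)
    fix s t assume st: "s \<in> T" "t \<in> T" "h s = h t" "s \<noteq> t"
    define c :: "'b \<Rightarrow> 'a" where "c r = (if r = s then 1 else if r = t then - 1 else 0)" for r
    have "(\<Sum>r\<in>T. mscale (c r) (f r)) = (\<Sum>r\<in>{s, t}. mscale (c r) (f r))"
      using fin st by (intro sum.mono_neutral_right) (auto simp: c_def)
    also have "\<dots> = f s - f t" using st(4) by (simp add: c_def)
    also have "\<dots> \<in> U" using st(3) by (simp add: h_def coset_eq_iff)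
    finally have "c s = 0" using mv.indep_modD[OF T] st(1) by blast
    then show False by (simp add: c_def)
  qed
  have lincomb: "N.lincomb a (h ` T) = coset (\<Sum>t\<in>T. mscale (c t) (f t))"
    if a: "\<And>t. t \<in> T \<Longrightarrow> a (h t) = mul_op n (const (c t))" for a c
  proof -
    have inv: "the_inv_into T h (h t) = t" if "t \<in> T" for t using the_inv_into_f_f[OF inj that] .
    let ?g = "\<lambda>A. mscale (c (the_inv_into T h A)) (f (the_inv_into T h A))"
    have "N.lincomb a (h ` T) = coset (\<Sum>A\<in>h ` T. ?g A)"
      unfolding N.lincomb_def
    proof (rule finsum_image[OF im])
      fix A assume "A \<in> h ` T"
      then obtain t where t: "t \<in> T" "A = h t" by blast
      show "?g A \<in> Y" unfolding t(2) inv[OF t(1)] using fY[OF t(1)] by (rule mv.subspace_scale[OF sub])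
      show "a A \<odot>\<^bsub>Q_on Y\<^esub> A = coset (?g A)"
        unfolding t(2) inv[OF t(1)] a[OF t(1)] using scalar_smult[OF fV[OF t(1)]] by (simp add: h_def)
    qed (use fin in simp)
    also have "(\<Sum>A\<in>h ` T. ?g A) = (\<Sum>t\<in>T. mscale (c t) (f t))"
      using inv by (simp add: sum.reindex[OF inj])
    finally show ?thesis .
  qed
  have K: "carrier (scalar_field n) = range (\<lambda>c :: 'a. mul_op n (const c))"
    by (simp add: scalar_field_ops scalar_ops_eq)
  have "N.basis (h ` T)"
  proof (subst N.basis_criterion)
    show "finite (h ` T)" using fin by simp
    show "h ` T \<subseteq> carrier (Q_on Y)" using fY by (auto simp: h_def)
    show "\<forall>v. v \<in> carrier (Q_on Y) \<longrightarrow>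
        (\<exists>!a. a \<in> h ` T \<rightarrow>\<^sub>E carrier (scalar_field n) \<and> N.lincomb a (h ` T) = v)"
    proof (intro allI impI)
      fix v assume "v \<in> carrier (Q_on Y)"
      then obtain w where w: "w \<in> Y" "v = coset w" by auto
      obtain l where l: "w - (\<Sum>t\<in>T. mscale (l t) (f t)) \<in> U"
        by (rule mv.span_Un_image[OF subU fin w(1)[unfolded Y]])
      show "\<exists>!a. a \<in> h ` T \<rightarrow>\<^sub>E carrier (scalar_field n) \<and> N.lincomb a (h ` T) = v"
      proof (rule ex_ex1I)
        define a where "a = restrict (\<lambda>A. mul_op n (const (l (the_inv_into T h A)))) (h ` T)"
        have "a (h t) = mul_op n (const (l t))" if "t \<in> T" for t
          using that the_inv_into_f_f[OF inj that] by (simp add: a_def)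
        from lincomb[of a l, OF this] have "N.lincomb a (h ` T) = v"
          unfolding w(2) using l mv.subspace_neg[OF subU l] by (simp add: coset_eq_iff)
        moreover have "a \<in> h ` T \<rightarrow>\<^sub>E carrier (scalar_field n)" unfolding a_def K by auto
        ultimately show "\<exists>a. a \<in> h ` T \<rightarrow>\<^sub>E carrier (scalar_field n) \<and> N.lincomb a (h ` T) = v" by blast
      next
        fix a b assume a: "a \<in> h ` T \<rightarrow>\<^sub>E carrier (scalar_field n) \<and> N.lincomb a (h ` T) = v"
          and b: "b \<in> h ` T \<rightarrow>\<^sub>E carrier (scalar_field n) \<and> N.lincomb b (h ` T) = v"
        have "\<forall>t\<in>T. \<exists>c. a (h t) = mul_op n (const c)" using a unfolding K by blast
        then obtain c where c: "\<And>t. t \<in> T \<Longrightarrow> a (h t) = mul_op n (const (c t))" by metis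
        have "\<forall>t\<in>T. \<exists>c. b (h t) = mul_op n (const c)" using b unfolding K by blast
        then obtain d where d: "\<And>t. t \<in> T \<Longrightarrow> b (h t) = mul_op n (const (d t))" by metis
        have "coset (\<Sum>t\<in>T. mscale (c t) (f t)) = coset (\<Sum>t\<in>T. mscale (d t) (f t))"
          using lincomb[of a c, OF c] lincomb[of b d, OF d] a b by simp
        then have "(\<Sum>t\<in>T. mscale (c t - d t) (f t)) \<in> U"
          by (simp add: coset_eq_iff mv.scale_left_diff_distrib sum_subtractf)
        then have "c t - d t = 0" if "t \<in> T" for t
          using mv.indep_modD[OF T, of "\<lambda>t. c t - d t"] that by blast
        then have "a (h t) = b (h t)" if "t \<in> T" for t using c[OF that] d[OF that] that by simp
        then show "a = b" using a b by (intro PiE_ext[of a "h ` T" "\<lambda>_. carrier (scalar_field n)" b]) auto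
      qed
    qed
  qed
  then have "N.dim = card (h ` T)" using fin by (intro N.dim_basis) simp_all
  then show ?thesis unfolding dim_K_def using card_image[OF inj] by simp
qed

text \<open>The combinations of cosets \<open>g\<close> with representatives \<open>rep g\<close>, with coefficients among the operators
  whose symbols have all exponents in \<open>E\<close>. Both \<open>B\<^sub>j\<close> and the full Weyl algebra are of this form.\<close>

lemma combinations_eq:
  assumes G: "finite G" and rep: "\<And>g. g \<in> G \<Longrightarrow> rep g \<in> polys n" "\<And>g. g \<in> G \<Longrightarrow> coset (rep g) = g"
    and E: "\<And>m. m \<in> E \<Longrightarrow> keys m \<subseteq> symvars I"
  shows "combinations Q (dop ` {p. keys p \<subseteq> E}) G =
    coset ` mv.span (U \<union> {W.mon_upto n m (rep g) |m g. m \<in> E \<and> g \<in> G})"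
proof -
  let ?S = "{p :: 'a mpoly. keys p \<subseteq> E}"
  let ?Y = "mv.span (U \<union> {W.mon_upto n m (rep g) |m g. m \<in> E \<and> g \<in> G})"
  have S: "p \<in> syms I" if "p \<in> ?S" for p using that E by (auto simp: syms_eq)
  have comb: "(\<Oplus>\<^bsub>Q\<^esub> g\<in>G. dop (P g) \<odot>\<^bsub>Q\<^esub> g) = coset (\<Sum>g\<in>G. W.op (P g) (rep g))"
    if "\<And>g. g \<in> G \<Longrightarrow> P g \<in> ?S" for P
  proof -
    have "dop (P g) \<odot>\<^bsub>Q\<^esub> g = coset (W.op (P g) (rep g))" "W.op (P g) (rep g) \<in> polys n" if "g \<in> G" for g
      using coset_smult[OF S rep(1), of "P g" g] W_op_closed[OF syms_subset[OF I S] rep(1)]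
        rep(2)[OF that] that \<open>\<And>g. g \<in> G \<Longrightarrow> P g \<in> ?S\<close> by auto
    then show ?thesis
      using finsum_image[OF image_sub_polys G, of "\<lambda>g. W.op (P g) (rep g)" "\<lambda>g. dop (P g) \<odot>\<^bsub>Q\<^esub> g"]
      by (simp add: Q_eq)
  qed
  show ?thesis
  proof (intro equalityI subsetI)
    fix A assume "A \<in> combinations Q (dop ` ?S) G"
    then obtain b where b: "A = (\<Oplus>\<^bsub>Q\<^esub> g\<in>G. b g \<odot>\<^bsub>Q\<^esub> g)" "b \<in> G \<rightarrow> dop ` ?S" by (auto simp: combinations_def)
    have "\<forall>g\<in>G. \<exists>p. p \<in> ?S \<and> b g = dop p" using b(2) by blast
    then obtain P where P: "\<And>g. g \<in> G \<Longrightarrow> P g \<in> ?S" "\<And>g. g \<in> G \<Longrightarrow> b g = dop (P g)" by metis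
    interpret AQ: abelian_group Q using abelian_group_image[OF image_sub_polys] by (simp only: Q_eq)
    have "W.op (P g) (rep g) \<in> ?Y" if g: "g \<in> G" for g
      unfolding W.op_def using P(1)[OF g] g
      by (intro mv.span_sum mv.span_scale mv.span_base) blast
    then have in_Y: "(\<Sum>g\<in>G. W.op (P g) (rep g)) \<in> ?Y" by (rule mv.span_sum)
    have "dop (P g) \<odot>\<^bsub>Q\<^esub> g \<in> carrier Q" if g: "g \<in> G" for g
      using coset_smult[OF S[OF P(1)[OF g]] rep(1)[OF g]] W_op_closed[OF syms_subset[OF I S[OF P(1)[OF g]]] rep(1)[OF g]]
      by (simp add: rep(2)[OF g] Q_simps)
    then have A: "A = (\<Oplus>\<^bsub>Q\<^esub> g\<in>G. dop (P g) \<odot>\<^bsub>Q\<^esub> g)"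
      unfolding b(1) by (intro AQ.finsum_cong') (simp_all add: P(2))
    also have "\<dots> = coset (\<Sum>g\<in>G. W.op (P g) (rep g))" by (rule comb) (rule P(1))
    finally show "A \<in> coset ` ?Y" using in_Y by simp
  next
    fix A assume "A \<in> coset ` ?Y"
    then obtain w where w: "w \<in> ?Y" "A = coset w" by blast
    let ?B = "{W.mon_upto n m (rep g) |m g. m \<in> E \<and> g \<in> G}"
    obtain x y where xy: "x \<in> mv.span U" "y \<in> mv.span ?B" "w = x + y" using w(1) unfolding mv.span_Un by blast
    then have x: "x \<in> U" using subU by (simp add: mv.span_eq_iff[THEN iffD2])
    from xy(2) obtain T l where T: "finite T" "T \<subseteq> ?B" "y = (\<Sum>v\<in>T. mscale (l v) v)"
      unfolding mv.span_explicit by blast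
    have "\<forall>v\<in>T. \<exists>m g. v = W.mon_upto n m (rep g) \<and> m \<in> E \<and> g \<in> G" using T(2) by blast
    then obtain m \<gamma> where m: "\<And>v. v \<in> T \<Longrightarrow> v = W.mon_upto n (m v) (rep (\<gamma> v))" "\<And>v. v \<in> T \<Longrightarrow> m v \<in> E"
      "\<And>v. v \<in> T \<Longrightarrow> \<gamma> v \<in> G" by metis
    define P where "P g = (\<Sum>v\<in>{v \<in> T. \<gamma> v = g}. single (m v) (l v))" for g
    have "keys (P g) \<subseteq> E" for g
    proof
      fix x assume "x \<in> keys (P g)"
      then have "(\<Sum>v\<in>{v \<in> T. \<gamma> v = g}. lookup (single (m v) (l v)) x) \<noteq> 0"
        by (simp add: P_def in_keys_iff lookup_sum)
      then obtain v where "v \<in> {v \<in> T. \<gamma> v = g}" "lookup (single (m v) (l v)) x \<noteq> 0"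
        by (rule sum.not_neutral_contains_not_neutral)
      then show "x \<in> E" using m(2) by (auto simp: lookup_single when_def split: if_splits)
    qed
    then have P_S: "P \<in> G \<rightarrow> ?S" by simp
    have "(\<Sum>g\<in>G. W.op (P g) (rep g)) = (\<Sum>g\<in>G. \<Sum>v\<in>{v \<in> T. \<gamma> v = g}. mscale (l v) v)"
      unfolding P_def W.op_sum W.op_single
    proof (intro sum.cong refl)
      fix g v assume "v \<in> {v \<in> T. \<gamma> v = g}"
      then show "mscale (l v) (W.mon_upto n (m v) (rep g)) = mscale (l v) v" using m(1)[of v, symmetric] by auto
    qed
    also have "\<dots> = y" unfolding T(3) using m(3) by (intro sum.group T(1) G) auto
    finally have P: "P \<in> G \<rightarrow> ?S" "w - (\<Sum>g\<in>G. W.op (P g) (rep g)) \<in> U" using P_S x xy(3) by simp_all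
    then have "A = (\<Oplus>\<^bsub>Q\<^esub> g\<in>G. dop (P g) \<odot>\<^bsub>Q\<^esub> g)"
      unfolding w(2) using comb[of P] by (simp add: Pi_iff coset_eq_iff)
    then show "A \<in> combinations Q (dop ` ?S) G"
      unfolding combinations_def mem_Collect_eq using P(1) by (intro exI[of _ "\<lambda>g. dop (P g)"]) blast
  qed
qed

end

section \<open>The quotient by the image of the operators\<close>

context twisted
begin

lemma Im_C_0: "Im_C n 0 q = {0}"
  by (auto simp: Im_C_def)

lemma Im_C_Suc: "Im_C n (Suc l) q = W.add_image (Suc l) (Im_C n l q)"
proof (intro equalityI subsetI)
  fix w assume "w \<in> Im_C n (Suc l) q"
  then obtain f where f: "f \<in> {1..Suc l} \<rightarrow> polys n" "w = (\<Sum>i\<in>{1..Suc l}. Phi q i (f i))"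
    by (auto simp: Im_C_def)
  then have "(\<Sum>i\<in>{1..l}. Phi q i (f i)) \<in> Im_C n l q" unfolding Im_C_def by (auto simp: Pi_iff)
  from W.add_imageI[OF this, of "f (Suc l)" "Suc l"] f show "w \<in> W.add_image (Suc l) (Im_C n l q)"
    by (auto simp: Pi_iff)
next
  fix w assume "w \<in> W.add_image (Suc l) (Im_C n l q)"
  then obtain f v where f: "f \<in> {1..l} \<rightarrow> polys n" "v \<in> polys n" "w = (\<Sum>i\<in>{1..l}. Phi q i (f i)) + Phi q (Suc l) v"
    by (auto simp: W.add_image_def Im_C_def)
  have "(\<Sum>i\<in>{1..l}. Phi q i (f i)) = (\<Sum>i\<in>{1..l}. Phi q i ((f(Suc l := v)) i))"
    by (intro sum.cong) auto
  then have "w = (\<Sum>i\<in>{1..Suc l}. Phi q i ((f(Suc l := v)) i))" using f(3) by simp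
  moreover have "f(Suc l := v) \<in> {1..Suc l} \<rightarrow> polys n" using f(1,2) by (auto simp: Pi_iff)
  ultimately show "w \<in> Im_C n (Suc l) q" unfolding Im_C_def by blast
qed

lemma Im_C_polys: "l \<le> n \<Longrightarrow> Im_C n l q \<subseteq> polys n"
proof (induction l)
  case (Suc l)
  then show ?case
    by (auto simp: Im_C_Suc W.add_image_def intro!: polys_add polys_Phi[OF q])
qed (simp add: Im_C_0)

lemma stable_Im_C: "l \<le> n \<Longrightarrow> W.stable {l + 1..n} (Im_C n l q)"
proof (induction l)
  case 0
  have "vmul i 0 = 0" "Phi q i 0 = 0" for i by (simp_all add: vmul_def Phi_def)
  then show ?case by (simp add: W.stable_def Im_C_0)
next
  case (Suc l)
  then have "W.stable {l + 1..n} (Im_C n l q)" by simp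
  then have "W.stable {Suc l + 1..n} (Im_C n l q)" by (rule W.stable_mono) auto
  then show ?case unfolding Im_C_Suc by (intro W.stable_add_image) auto
qed

end

text \<open>A bound \<open>d\<close> for the degree of \<open>q\<close> fixes a filtration of \<open>\<M>\<close>, prefixed by \<open>F\<close>.\<close>

locale filtered_twisted = twisted n q
  for n and q :: "'a::field_char_0 mpoly" +
  fixes d :: nat
  assumes q_le: "q \<in> polys_le {1..n} d" and d: "d \<ge> 1"
begin

sublocale F: filtered_weyl_action mscale n "polys n" vmul "Phi q" "\<lambda>j. polys_le {1..n} (d * (j + 1))"
  by (rule filtered_weyl_action_Phi[OF q_le d])

lemma growth_polys: "F.growth {0} n"
  unfolding F.growth_def
proof (intro exI allI impI, elim conjE)
  fix j A and f :: "nat \<Rightarrow> 'a mpoly"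
  assume ind: "mv.indep_mod {0} A f" and f: "f ` A \<subseteq> polys_le {1..n} (d * (j + 1))"
  let ?B = "exps_le {1..n} (d * (j + 1))"
  have B: "finite ?B" "card ?B \<le> (d * (j + 1) + 1) ^ n"
    using exps_le_box[of "{1..n}" "d * (j + 1)"] by simp_all
  have "card A \<le> card ?B"
  proof (rule mv.indep_mod_card_le[OF mv.subspace_single_0 ind B(1)])
    fix a assume "a \<in> A"
    with f have keys: "keys (f a) \<subseteq> ?B" by (auto simp: polys_le_def)
    have "f a = (\<Sum>m\<in>keys (f a). single m (lookup (f a) m))"
      by (rule poly_mapping_sum_single)
    also have "\<dots> = (\<Sum>m\<in>?B. single m (lookup (f a) m))"
      using B(1) keys by (intro sum.mono_neutral_left) (auto simp: in_keys_iff)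
    also have "\<dots> = (\<Sum>m\<in>?B. mscale (lookup (f a) m) (single m 1))"
      by (simp add: mscale_def const_mult_single)
    finally show "f a - (\<Sum>m\<in>?B. mscale (lookup (f a) m) (single m 1)) \<in> {0}" by simp
  qed
  also note B(2)
  also have "(d * (j + 1) + 1) ^ n \<le> ((d + 1) * (j + 1)) ^ n" by (intro power_mono) simp_all
  also have "\<dots> = (d + 1) ^ n * (j + 1) ^ n" by (rule power_mult_distrib)
  finally show "card A \<le> (d + 1) ^ n * (j + 1) ^ n" .
qed

lemma growth_Im_C: "l \<le> n \<Longrightarrow> F.growth (Im_C n l q) (n - l)"
proof (induction l)
  case 0
  show ?case using growth_polys by (simp add: Im_C_0)
next
  case (Suc l)
  have "W.stable {Suc l} (Im_C n l q)"
    using Suc.prems by (intro W.stable_mono[OF stable_Im_C[of l]]) auto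
  moreover have "Im_C n l q \<subseteq> polys n" using Suc.prems by (intro Im_C_polys) simp
  moreover have "F.growth (Im_C n l q) (Suc (n - Suc l))" using Suc by (simp add: Suc_diff_Suc)
  ultimately show ?case
    unfolding Im_C_Suc using Suc.prems by (intro F.growth_image) auto
qed

text \<open>Holonomicity of quotients of sufficiently small growth.\<close>

lemma holonomic_quotient:
  assumes I: "I \<subseteq> {1..n}" and U: "W.stable I U" "U \<subseteq> polys n" and gr: "F.growth U (card I)"
  shows "holonomic n I (quot_module (twisted_module n q) U)"
proof -
  interpret twisted_quotient n q I U
    by unfold_locales (fact I, fact U(1), fact U(2))
  obtain G0 where G0: "finite G0" "G0 \<subseteq> polys n" "F.generated I U G0 = polys n"
    by (rule F.finitely_generated_if_growth[OF I U U_polys gr])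
  define G where "G = coset ` G0"
  define rep where "rep g = (SOME x. x \<in> G0 \<and> coset x = g)" for g
  have rep: "rep g \<in> G0" "coset (rep g) = g" if "g \<in> G" for g
    using that someI_ex[of "\<lambda>x. x \<in> G0 \<and> coset x = g"] by (auto simp: G_def rep_def)
  have rep_polys: "rep g \<in> polys n" if "g \<in> G" for g using rep(1)[OF that] G0(2) by blast
  have finG: "finite G" using G0(1) by (simp add: G_def)
  have gen: "F.generated I U (rep ` G) = polys n"
  proof
    show "F.generated I U (rep ` G) \<subseteq> polys n"
      using rep_polys by (intro F.generated_subset_V[OF I U_polys]) auto
    have st: "W.stable I (F.generated I U (rep ` G))" by (rule F.stable_generated[OF I U])
    have "x \<in> F.generated I U (rep ` G)" if x: "x \<in> G0" for x
    proof -
      have cx: "coset x \<in> G" using x by (simp add: G_def)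
      have "x - rep (coset x) \<in> U" using rep(2)[OF cx] by (simp add: coset_eq_iff[symmetric])
      then have "x - rep (coset x) \<in> F.generated I U (rep ` G)" using F.generated_base by blast
      moreover have "rep (coset x) \<in> F.generated I U (rep ` G)" using cx by (intro F.generated_self) simp
      ultimately show ?thesis using mv.subspace_add[OF W.stableD(1)[OF st]] by fastforce
    qed
    then have "F.generated I U G0 \<subseteq> F.generated I U (rep ` G)"
      unfolding F.generated_def[of I U G0] using F.generated_base W.mon_stable[OF st]
      by (intro mv.span_minimal W.stableD(1)[OF st]) blast
    then show "polys n \<subseteq> F.generated I U (rep ` G)" by (simp add: G0(3))
  qed
  have fgs: "finite_generating_set (weyl n I) Q G"
    unfolding finite_generating_set_def
  proof (intro conjI)
    show "finite G" by (rule finG)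
    show "G \<subseteq> carrier Q" using G0(2) by (auto simp: G_def Q_simps)
    have "{W.mon_upto n m (rep g) |m g. m \<in> {m. keys m \<subseteq> symvars I} \<and> g \<in> G} =
        {W.mon_upto n m x |m x. keys m \<subseteq> symvars I \<and> x \<in> rep ` G}" by blast
    then show "combinations Q (carrier (weyl n I)) G = carrier Q"
      unfolding carrier_weyl[OF I] syms_eq
        combinations_eq[where rep = rep, OF finG rep_polys rep(2), of "{m. keys m \<subseteq> symvars I}", simplified]
      using gen by (simp add: F.generated_def Q_simps)
  qed
  have "carrier Q = {\<zero>\<^bsub>Q\<^esub>} \<or> has_bernstein_dim n I Q (card I)"
  proof (cases "polys n \<subseteq> U")
    case True
    have "coset x = U" if "x \<in> polys n" for x
      using True that by (subst coset_0[symmetric]) (auto simp: coset_eq_iff)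
    then have "coset ` polys n = {U}" using polys_0 by blast
    then show ?thesis by (simp add: Q_simps)
  next
    case False
    obtain \<pi> where \<pi>: "bij_betw \<pi> {0..<card G} G" using ex_bij_betw_nat_finite[OF finG] by blast
    define p where "p = card G"
    define u where "u a = rep (\<pi> a)" for a
    have \<pi>_in: "\<pi> a \<in> G" if "a < p" for a using \<pi> that by (auto simp: bij_betw_def p_def)
    have G_\<pi>: "G = \<pi> ` {..<p}" using \<pi> by (simp add: bij_betw_def p_def lessThan_atLeast0)
    have u: "u a \<in> polys n" if "a < p" for a using rep_polys[OF \<pi>_in[OF that]] by (simp add: u_def)
    have "\<exists>b<p. u b \<notin> U"
    proof (rule ccontr)
      assume "\<not> ?thesis"
      then have "rep ` G \<subseteq> U" by (auto simp: G_\<pi> u_def)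
      then have "F.generated I U (rep ` G) \<subseteq> U"
        unfolding F.generated_def using W.mon_stable[OF U] by (intro mv.span_minimal subU) blast
      with gen False show False by simp
    qed
    then obtain b where b: "b < p" "u b \<notin> U" by blast
    obtain \<chi> :: "rat poly" where
      \<chi>: "\<forall>\<^sub>F j in sequentially. of_nat (card (F.standard I U p u j)) = poly \<chi> (of_nat j)"
      "Polynomial.degree \<chi> = card I"
      by (rule F.hilbert_polynomial[where p = p and u = u, OF I U gr u b])
    have "dim_K n Q (combinations Q (bernstein n I j) G) = card (F.standard I U p u j)" for j
    proof -
      let ?E = "exps_le (symvars I) j" and ?f = "\<lambda>(g, a). W.mon_upto n g (u a)"
      let ?Y = "mv.span (U \<union> {W.mon_upto n m (rep g) |m g. m \<in> ?E \<and> g \<in> G})"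
      have "combinations Q (bernstein n I j) G = coset ` ?Y"
        unfolding bernstein_eq[OF I] polys_le_def
        by (rule combinations_eq[OF finG rep_polys rep(2)]) (simp_all add: exps_le_def)
      moreover have "?Y = mv.span (U \<union> ?f ` F.standard I U p u j)"
      proof
        have "W.mon_upto n m (rep g) \<in> mv.span (U \<union> ?f ` F.standard I U p u j)" if m: "m \<in> ?E" and g: "g \<in> G" for m g
        proof -
          obtain a where "a < p" "g = \<pi> a" using g by (auto simp: G_\<pi>)
          with F.span_standard[OF I subU m, of a p u] show ?thesis by (simp add: u_def)
        qed
        then show "?Y \<subseteq> mv.span (U \<union> ?f ` F.standard I U p u j)"
          by (intro mv.span_minimal mv.subspace_span) (auto intro: mv.span_base)
        show "mv.span (U \<union> ?f ` F.standard I U p u j) \<subseteq> ?Y"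
          using \<pi>_in by (intro mv.span_mono) (auto simp: F.standard_def u_def)
      qed
      moreover have "?Y \<subseteq> polys n"
        using rep_polys U_polys W.mon_stable[OF W.stable_V[OF I]]
        by (intro mv.span_minimal W.V) (auto simp: exps_le_def)
      ultimately show ?thesis using dim_image[OF F.indep_mod_standard[OF I subU]] by simp
    qed
    then show ?thesis unfolding has_bernstein_dim_def using fgs \<chi> by auto
  qed
  then show ?thesis unfolding holonomic_def using left_module_Q fgs by blast
qed

end

theorem theorem2p10:
  fixes n k :: nat and q :: "'a::field_char_0 mpoly"
  assumes "1 \<le> k" and "k \<le> n" and "q \<in> polys n"
  shows "left_submodule (Im_C n k q) (weyl n {k+1..n}) (twisted_module n q) \<and>
         holonomic n {k+1..n} (quot_module (twisted_module n q) (Im_C n k q))"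
proof -
  obtain e where "q \<in> polys_le {1..n} e" using assms(3) by (auto simp: polys_iff)
  then have "q \<in> polys_le {1..n} (Suc e)" using polys_le_mono[of e "Suc e"] by auto
  with assms(3) interpret filtered_twisted n q "Suc e" by unfold_locales auto
  have I: "{k+1..n} \<subseteq> {1..n}" by auto
  have U: "W.stable {k+1..n} (Im_C n k q)" "Im_C n k q \<subseteq> polys n"
    using stable_Im_C[OF assms(2)] Im_C_polys[OF assms(2)] .
  have "F.growth (Im_C n k q) (card {k+1..n})" using growth_Im_C[OF assms(2)] by simp
  then show ?thesis using submodule_M[OF I U] holonomic_quotient[OF I U] by blast
qed

end
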